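(* Let $k\ge1$ and $d\ge2$ be integers, let $\delta>0$, let $x_1,\dots,x_d\in\mathbb T^k$ be free, and let $\Psi:\{2^i:i\in\mathbb N\}\to\mathbb R$ satisfy $\sum_{i=0}^\infty \Psi(2^i)/2^{(d-2)i}<\infty$. Define $\Phi(2^i):=2^i\Psi(2^i)$ for $i\in\mathbb N$. (1) If Lebesgue measurable sets $A,B\subseteq\mathbb T^k$ are $\Psi$-uniform of density $\delta$ with respect to every $(d-1)$-tuple of distinct vectors from $\{x_1,\dots,x_d\}$, then there are partitions $A=A_1\cup\dots\cup A_m$, $B=B_1\cup\dots\cup B_m$ into Lebesgue measurable pieces and vectors $v_1,\dots,v_m$, each an integer combination of $x_1,\dots,x_d$, such that $B_i=A_i+v_i$ (addition in $\mathbb T^k$) for all $i$. (2) If Baire measurable sets $A,B\subseteq\mathbb T^k$ are $\Phi$-uniform of density $\delta$ with respect to $x_1,\dots,x_d$, then the same conclusion holds with all pieces Baire measurable.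
   Context: $\mathbb T^k=\mathbb R^k/\mathbb Z^k$ is identified with $[0,1)^k$ with addition modulo 1; $\mathbb N=\{0,1,2,\dots\}$. Vectors $x_1,\dots,x_d\in\mathbb T^k$ are free if no non-trivial integer combination of them is $0$ in $\mathbb T^k$. Given vectors $y_1,\dots,y_e\in\mathbb T^k$, for $X\subseteq\mathbb T^k$ and $u\in\mathbb T^k$ let $X_u:=\{n\in\mathbb Z^e: u+n_1y_1+\dots+n_ey_e\in X\}$. An $n$-cube in $\mathbb Z^e$ is a set $\prod_{j=1}^e\{n_j,n_j+1,\dots,n_j+n-1\}$. For $\Phi:\{2^i:i\in\mathbb N\}\to\mathbb R$ and $\delta\ge0$, a set $X\subseteq\mathbb Z^e$ is $\Phi$-uniform of density $\delta$ if $\bigl||X\cap Q|-\delta|Q|\bigr|\le\Phi(2^i)$ for every $i\in\mathbb N$ and every $2^i$-cube $Q\subseteq\mathbb Z^e$; a set $Y\subseteq\mathbb T^k$ is $\Phi$-uniform of density $\delta$ with respect to $y_1,\dots,y_e$ if $Y_u$ is $\Phi$-uniform of density $\delta$ for every $u\in\mathbb T^k$. *)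

theory Defs
  imports "HOL-Analysis.Analysis"
begin

text \<open>The torus T^k is modelled as the cube [0,1)^k inside real^'k, with the
  dimension k = CARD('k) given by a finite type (so k >= 1 automatically).\<close>

definition torus :: "(real^'k) set" where
  "torus = {x. \<forall>j. 0 \<le> x $ j \<and> x $ j < 1}"

definition tproj :: "real^'k \<Rightarrow> real^'k" where
  "tproj x = (\<chi> j. frac (x $ j))"

definition tadd :: "real^'k \<Rightarrow> real^'k \<Rightarrow> real^'k" where
  "tadd x y = tproj (x + y)"

definition tcomb :: "(real^'k) list \<Rightarrow> (nat \<Rightarrow> int) \<Rightarrow> real^'k" where
  "tcomb ys n = tproj (\<Sum>i<length ys. of_int (n i) *\<^sub>R (ys ! i))"

definition free_vecs :: "(real^'k) list \<Rightarrow> bool" where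
  "free_vecs xs \<longleftrightarrow> (\<forall>n. tcomb xs n = 0 \<longrightarrow> (\<forall>i<length xs. n i = 0))"

text \<open>Z^e is modelled as functions nat => int vanishing from index e on.\<close>
definition lattice :: "nat \<Rightarrow> (nat \<Rightarrow> int) set" where
  "lattice e = {n. \<forall>i\<ge>e. n i = 0}"

definition tsection :: "real^'k \<Rightarrow> (real^'k) list \<Rightarrow> (real^'k) set \<Rightarrow> (nat \<Rightarrow> int) set" where
  "tsection u ys X = {n \<in> lattice (length ys). tadd u (tcomb ys n) \<in> X}"

definition cube :: "nat \<Rightarrow> (nat \<Rightarrow> int) \<Rightarrow> nat \<Rightarrow> (nat \<Rightarrow> int) set" where
  "cube e a s = {n \<in> lattice e. \<forall>i<e. a i \<le> n i \<and> n i < a i + int s}"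

text \<open>Phi-uniformity of density delta for X subset of Z^e; Phi i stands for Phi(2^i).\<close>
definition uniform_Z :: "nat \<Rightarrow> (nat \<Rightarrow> real) \<Rightarrow> real \<Rightarrow> (nat \<Rightarrow> int) set \<Rightarrow> bool" where
  "uniform_Z e Phi \<delta> X \<longleftrightarrow>
     (\<forall>i a. \<bar>real (card (X \<inter> cube e a (2 ^ i))) - \<delta> * real (card (cube e a (2 ^ i)))\<bar> \<le> Phi i)"

definition uniform_T :: "(nat \<Rightarrow> real) \<Rightarrow> real \<Rightarrow> (real^'k) list \<Rightarrow> (real^'k) set \<Rightarrow> bool" where
  "uniform_T Phi \<delta> ys Y \<longleftrightarrow> (\<forall>u\<in>torus. uniform_Z (length ys) Phi \<delta> (tsection u ys Y))"

definition torus_top :: "(real^'k) topology" where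
  "torus_top = topology (\<lambda>U. U \<subseteq> torus \<and> open (tproj -` U))"

definition nowhere_dense_in :: "'a topology \<Rightarrow> 'a set \<Rightarrow> bool" where
  "nowhere_dense_in T S \<longleftrightarrow> S \<subseteq> topspace T \<and> T interior_of (T closure_of S) = {}"

definition meager_in :: "'a topology \<Rightarrow> 'a set \<Rightarrow> bool" where
  "meager_in T S \<longleftrightarrow> (\<exists>F. countable F \<and> (\<forall>N\<in>F. nowhere_dense_in T N) \<and> S \<subseteq> \<Union>F)"

definition baire_measurable_in :: "'a topology \<Rightarrow> 'a set \<Rightarrow> bool" where
  "baire_measurable_in T A \<longleftrightarrow> A \<subseteq> topspace T \<and>
     (\<exists>U. openin T U \<and> meager_in T ((A - U) \<union> (U - A)))"

definition equidecomposable :: "((real^'k) set \<Rightarrow> bool) \<Rightarrow> (real^'k) list \<Rightarrow> (real^'k) set \<Rightarrow> (real^'k) set \<Rightarrow> bool" where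
  "equidecomposable P xs A B \<longleftrightarrow>
    (\<exists>m::nat. \<exists>AA BB :: nat \<Rightarrow> (real^'k) set. \<exists>v :: nat \<Rightarrow> real^'k.
       A = (\<Union>i<m. AA i) \<and> B = (\<Union>i<m. BB i) \<and>
       (\<forall>i<m. \<forall>j<m. i \<noteq> j \<longrightarrow> AA i \<inter> AA j = {} \<and> BB i \<inter> BB j = {}) \<and>
       (\<forall>i<m. P (AA i) \<and> P (BB i)) \<and>
       (\<forall>i<m. \<exists>n. v i = tcomb xs n) \<and>
       (\<forall>i<m. BB i = (\<lambda>a. tadd a (v i)) ` AA i))"

end

theory Submission
  imports Defs "HOL-Library.Function_Algebras"
begin

text \<open>Write \<open>f\<close> for the difference of the indicator functions of \<open>A\<close> and \<open>B\<close>, and let \<open>\<int>\<^sup>d\<close> act on the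
  torus by the translations \<open>x\<^sub>1, \<dots>, x\<^sub>d\<close>. Replacing dyadic averages of \<open>f\<close> over cubes of side \<open>2^i\<close>
  by averages over cubes of side \<open>2^(i+1)\<close> moves mass along a flow of size \<open>\<Phi>(2^i)/2^((d-1)i)\<close>; as
  these sizes are summable and the averages tend to \<open>0\<close>, one obtains a bounded measurable real flow
  with divergence \<open>f\<close>.

  The flow is made integral inside the planes spanned by \<open>x\<^sub>1\<close> and \<open>x\<^sub>2\<close>. Outside a null (meager) set the
  points can be 2-coloured so that all monochromatic components are finite, and every component has
  a canonical base point. An object that is determined by an orbit with a base point is glued
  along this colouring: locally only two base points compete, so no consistency condition arises.
  First the fractional parts of the flow in the directions \<open>x\<^sub>3, \<dots>, x\<^sub>d\<close> are written as
  divergences within the planes, which makes these components integral; then the remaining planar flow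
  with integral divergence is corrected by the curl of a bounded function which has the right values
  modulo \<open>1\<close>.

  Finally the torus is cut into Voronoi cells of large finite sets. In each cell the points of \<open>A\<close> and
  \<open>B\<close> outnumber the units of flow crossing its boundary, so every unit can be carried by its own
  point, which turns the flow into a bijection with bounded displacement. The same argument works for
  Lebesgue and for Baire measurable sets; they differ only in the proof that one of finitely many
  sets covering the space can be chosen at each stage so that almost every point is covered
  infinitely often.\<close>

section \<open>Countably valued measurable functions\<close>

text \<open>The obstacle is that orbits have no measurable base point. On a single orbit a primitive
  of the flow can be written down from any origin, but it changes with the origin; base points can
  be chosen only for pieces of orbits. Planes help because a triangle has three corners: two colours
  force two adjacent corners into one component, and terms involving only two base points cancel by
  antisymmetry. The number \<open>9\<close> counts the sup-norm balls of radius \<rho> that cover a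
  planar ball of radius \<open>3\<rho>\<close>: a maximal \<open>3\<rho>\<close>-separated set
  covers only at radius \<open>3\<rho>\<close>, while the balls kept isolated have radius \<rho>, so
  one of nine translates is picked at each scale. The ideal \<open>N\<close> is closed under subsets
  and consists of measurable sets; hence arbitrary choices on exceptional orbits are harmless and
  the final pieces cover every point. Both parts of the theorem merge, since uniformity for
  (d-1)-tuples with bound \<open>Psi\<close> gives uniformity for the full tuple with bound
  \<open>2 ^ i * Psi i\<close>.\<close>

definition dmeas :: "'a measure \<Rightarrow> ('a \<Rightarrow> 'b) \<Rightarrow> bool" where
  "dmeas M f \<longleftrightarrow> countable (f ` space M) \<and> (\<forall>v. {x \<in> space M. f x = v} \<in> sets M)"

lemma dmeas_const: "dmeas M (\<lambda>_. c)"
proof -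
  have "{x \<in> space M. c = v} = (if c = v then space M else {})" for v
    by auto
  then show ?thesis unfolding dmeas_def by (auto intro: countable_subset[of _ "{c}"])
qed

lemma dmeas_vimage:
  assumes "dmeas M f" shows "{x \<in> space M. f x \<in> S} \<in> sets M"
proof -
  have "{x \<in> space M. f x \<in> S} = (\<Union>v \<in> f ` space M \<inter> S. {x \<in> space M. f x = v})" by auto
  also have "\<dots> \<in> sets M"
    using assms unfolding dmeas_def by (intro sets.countable_UN'') auto
  finally show ?thesis .
qed

lemma dmeas_pred: "dmeas M P \<Longrightarrow> {x \<in> space M. P x} \<in> sets M"
  using dmeas_vimage[of M P "{True}"] by simp

lemma dmeas_predI:
  assumes "{x \<in> space M. P x} \<in> sets M" shows "dmeas M P"
proof -
  have "{x \<in> space M. P x = True} \<in> sets M" using assms by simp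
  moreover have "{x \<in> space M. P x = False} = space M - {x \<in> space M. P x}" by auto
  ultimately have "{x \<in> space M. P x = v} \<in> sets M" for v
    using assms by (cases v) auto
  then show ?thesis unfolding dmeas_def by auto
qed

lemma dmeas_mem: "A \<in> sets M \<Longrightarrow> dmeas M (\<lambda>x. x \<in> A)"
  by (rule dmeas_predI) (simp add: Collect_conj_eq)

text \<open>With countably many values, the space splits into countably many slices on which
  \<open>f\<close> is constant. So anything computed from \<open>f\<close>, even by an arbitrary
  choice, stays measurable, and no structure on the type of values is involved.\<close>

lemma dmeas_dep:
  assumes f: "dmeas M f" and g: "\<And>v. v \<in> f ` space M \<Longrightarrow> dmeas M (g v)"
  shows "dmeas M (\<lambda>x. g (f x) x)"
  unfolding dmeas_def
proof
  have "(\<lambda>x. g (f x) x) ` space M \<subseteq> (\<Union>v \<in> f ` space M. g v ` space M)" by auto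
  moreover have "countable (\<Union>v \<in> f ` space M. g v ` space M)"
    using f g unfolding dmeas_def by (intro countable_UN) auto
  ultimately show "countable ((\<lambda>x. g (f x) x) ` space M)" by (rule countable_subset)
  show "\<forall>w. {x \<in> space M. g (f x) x = w} \<in> sets M"
  proof
    fix w
    have "{x \<in> space M. g (f x) x = w}
        = (\<Union>v \<in> f ` space M. {x \<in> space M. f x = v} \<inter> {x \<in> space M. g v x = w})" by auto
    also have "\<dots> \<in> sets M"
      using f g unfolding dmeas_def by (intro sets.countable_UN'') auto
    finally show "{x \<in> space M. g (f x) x = w} \<in> sets M" .
  qed
qed

lemma dmeas_comp: "dmeas M f \<Longrightarrow> dmeas M (\<lambda>x. h (f x))"
  by (rule dmeas_dep[of M f "\<lambda>v _. h v"]) (auto intro: dmeas_const)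

lemma dmeas_comp2:
  assumes "dmeas M f" "dmeas M g" shows "dmeas M (\<lambda>x. h (f x) (g x))"
  by (rule dmeas_dep[of M f "\<lambda>v x. h v (g x)", OF assms(1)]) (rule dmeas_comp[OF assms(2)])

lemma dmeas_comp3:
  assumes "dmeas M f" "dmeas M g" "dmeas M k" shows "dmeas M (\<lambda>x. h (f x) (g x) (k x))"
  by (rule dmeas_dep[of M f "\<lambda>v x. h v (g x) (k x)", OF assms(1)]) (rule dmeas_comp2[OF assms(2,3)])

lemma dmeas_shift:
  assumes f: "dmeas M f" and t: "t \<in> measurable M M" shows "dmeas M (\<lambda>x. f (t x))"
  unfolding dmeas_def
proof (intro conjI allI)
  have "(\<lambda>x. f (t x)) ` space M \<subseteq> f ` space M" using measurable_space[OF t] by auto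
  then show "countable ((\<lambda>x. f (t x)) ` space M)"
    using f unfolding dmeas_def by (meson countable_subset)
  fix v
  have "{x \<in> space M. f (t x) = v} = t -` {x \<in> space M. f x = v} \<inter> space M"
    using measurable_space[OF t] by auto
  then show "{x \<in> space M. f (t x) = v} \<in> sets M"
    using f measurable_sets[OF t] unfolding dmeas_def by metis
qed

lemma dmeas_ex:
  assumes "countable I" "\<And>i. i \<in> I \<Longrightarrow> dmeas M (P i)"
  shows "dmeas M (\<lambda>x. \<exists>i\<in>I. P i x)"
proof (rule dmeas_predI)
  have "{x \<in> space M. \<exists>i\<in>I. P i x} = (\<Union>i\<in>I. {x \<in> space M. P i x})" by auto
  also have "\<dots> \<in> sets M"
    using assms by (intro sets.countable_UN'' dmeas_pred) auto
  finally show "{x \<in> space M. \<exists>i\<in>I. P i x} \<in> sets M" .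
qed

lemma dmeas_all:
  assumes "countable I" "\<And>i. i \<in> I \<Longrightarrow> dmeas M (P i)"
  shows "dmeas M (\<lambda>x. \<forall>i\<in>I. P i x)"
proof -
  have "dmeas M (\<lambda>x. \<not> (\<exists>i\<in>I. \<not> P i x))"
    by (intro dmeas_comp[of _ _ Not] dmeas_ex assms)
  then show ?thesis by simp
qed

lemma dmeas_countable_type:
  fixes f :: "'a \<Rightarrow> 'b::countable"
  assumes "\<And>v. dmeas M (\<lambda>x. f x = v)" shows "dmeas M f"
  unfolding dmeas_def using dmeas_pred[OF assms] by auto

lemma dmeas_finite_set:
  assumes W: "finite W" and sub: "\<And>x. x \<in> space M \<Longrightarrow> F x \<subseteq> W"
    and m: "\<And>w. w \<in> W \<Longrightarrow> dmeas M (\<lambda>x. w \<in> F x)"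
  shows "dmeas M F"
  unfolding dmeas_def
proof (intro conjI allI)
  have "F ` space M \<subseteq> Pow W" using sub by auto
  then show "countable (F ` space M)" using W by (meson countable_finite finite_Pow_iff finite_subset)
  fix V
  have "{x \<in> space M. F x = V} = {x \<in> space M. V \<subseteq> W \<and> (\<forall>w\<in>W. (w \<in> F x) = (w \<in> V))}"
    using sub by auto
  moreover have "dmeas M (\<lambda>x. V \<subseteq> W \<and> (\<forall>w\<in>W. (w \<in> F x) = (w \<in> V)))"
    by (intro dmeas_comp2[of _ _ _ "(\<and>)"] dmeas_const dmeas_all countable_finite W
        dmeas_comp[of _ _ "\<lambda>b. b = (_ \<in> V)"] m)
  ultimately show "{x \<in> space M. F x = V} \<in> sets M" by (simp add: dmeas_pred)
qed

lemma borel_measurable_dep: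
  fixes g :: "'c \<Rightarrow> 'a \<Rightarrow> 'b::topological_space"
  assumes f: "dmeas M f" and g: "\<And>v. g v \<in> borel_measurable M"
  shows "(\<lambda>x. g (f x) x) \<in> borel_measurable M"
proof (rule measurableI)
  fix B :: "'b set" assume B: "B \<in> sets borel"
  have "(\<lambda>x. g (f x) x) -` B \<inter> space M
      = (\<Union>v \<in> f ` space M. {x \<in> space M. f x = v} \<inter> (g v -` B \<inter> space M))" by auto
  also have "\<dots> \<in> sets M"
    using f measurable_sets[OF g B] unfolding dmeas_def by (intro sets.countable_UN'') auto
  finally show "(\<lambda>x. g (f x) x) -` B \<inter> space M \<in> sets M" .
qed auto

lemma dmeas_floor:
  fixes f :: "'a \<Rightarrow> real"
  assumes "f \<in> borel_measurable M" shows "dmeas M (\<lambda>x. \<lfloor>f x\<rfloor>)"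
proof (rule dmeas_countable_type, rule dmeas_predI)
  fix v
  have "{x \<in> space M. \<lfloor>f x\<rfloor> = v} = {x \<in> space M. of_int v \<le> f x \<and> f x < of_int v + 1}"
    by (auto simp: floor_eq_iff)
  also have "\<dots> \<in> sets M" using assms by measurable
  finally show "{x \<in> space M. \<lfloor>f x\<rfloor> = v} \<in> sets M" .
qed

lemma maximal_independent_set:
  fixes M :: "'a measure" and \<FF> :: "('a \<Rightarrow> 'a) set" and q :: "'a \<Rightarrow> nat"
  assumes fin: "finite \<FF>" and meas: "\<And>f. f \<in> \<FF> \<Longrightarrow> f \<in> measurable M M"
    and inv: "\<And>f. f \<in> \<FF> \<Longrightarrow> \<exists>g\<in>\<FF>. \<forall>x\<in>space M. g (f x) = x"
    and q: "dmeas M q" "\<And>x. x \<in> space M \<Longrightarrow> q x < k"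
    and col: "\<And>x f. x \<in> space M \<Longrightarrow> f \<in> \<FF> \<Longrightarrow> q (f x) \<noteq> q x"
  obtains U where "U \<in> sets M" "\<And>x f. x \<in> U \<Longrightarrow> f \<in> \<FF> \<Longrightarrow> f x \<notin> U"
    "\<And>x. x \<in> space M \<Longrightarrow> x \<in> U \<or> (\<exists>f\<in>\<FF>. f x \<in> U)"
proof -
  define V where "V = rec_nat {} (\<lambda>i V. V \<union> {x \<in> space M. q x = i \<and> (\<forall>f\<in>\<FF>. f x \<notin> V)})"
  have V0: "V 0 = {}" and VS: "V (Suc i) = V i \<union> {x \<in> space M. q x = i \<and> (\<forall>f\<in>\<FF>. f x \<notin> V i)}" for i
    by (simp_all add: V_def)
  have Vs: "V i \<in> sets M" for i
  proof (induction i)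
    case (Suc i)
    have "dmeas M (\<lambda>x. q x = i \<and> (\<forall>f\<in>\<FF>. f x \<notin> V i))"
      by (intro dmeas_comp2[of _ _ _ "(\<and>)"] dmeas_comp[of _ _ "\<lambda>z. z = i"] q dmeas_all
          countable_finite fin dmeas_comp[of _ _ Not] dmeas_shift[OF dmeas_mem[OF Suc]] meas)
    then show ?case using Suc dmeas_pred by (auto simp: VS)
  qed (simp add: V0)
  \<comment> \<open>A point can enter only at the stage of its own colour, so its membership is
    settled from stage \<open>Suc (q x)\<close> on.\<close>
  have Vq: "x \<in> V i \<longleftrightarrow> x \<in> V j \<and> q x < i" if "i \<le> j" for x i j
    using that
  proof (induction j)
    case 0 then show ?case by (simp add: V0)
  next
    case (Suc j)
    have less: "y \<in> V i \<Longrightarrow> q y < i" for y i by (induction i) (auto simp: V0 VS)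
    show ?case
    proof (cases "i = Suc j")
      case True then show ?thesis using less by auto
    next
      case False
      then have "i \<le> j" using Suc by simp
      then show ?thesis using Suc.IH by (auto simp: VS)
    qed
  qed
  have sp: "V k \<subseteq> space M" using sets.sets_into_space[OF Vs] .
  have mem: "x \<in> V k \<Longrightarrow> f \<in> \<FF> \<Longrightarrow> f x \<notin> V (q x)" for x f
  proof -
    assume "x \<in> V k" "f \<in> \<FF>"
    moreover have "x \<in> V (Suc (q x))" using \<open>x \<in> V k\<close> Vq[of "Suc (q x)" k x] q(2) sp
      by (metis Suc_leI lessI subsetD)
    moreover have "x \<notin> V (q x)" using \<open>x \<in> V k\<close> Vq[of "q x" k x] q(2) sp
      by (metis less_irrefl less_imp_le subsetD)
    ultimately show ?thesis by (auto simp: VS)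
  qed
  show thesis
  proof (rule that[of "V k"])
    show "V k \<in> sets M" by (rule Vs)
    fix x f assume x: "x \<in> V k" and f: "f \<in> \<FF>"
    show "f x \<notin> V k"
    proof
      assume fx: "f x \<in> V k"
      obtain g where g: "g \<in> \<FF>" "g (f x) = x" using inv[OF f] x sp by blast
      have lt: "q x < k" "q (f x) < k" using x fx sp q(2) by auto
      consider "q (f x) < q x" | "q x < q (f x)" using col[of x f] x f sp by fastforce
      then show False
      proof cases
        case 1 then show False using mem[OF x f] fx Vq[of "q x" k "f x"] lt by simp
      next
        case 2 then show False using mem[OF fx g(1)] g(2) x Vq[of "q (f x)" k x] lt by simp
      qed
    qed
  next
    fix x assume x: "x \<in> space M"
    then have "q x < k" using q(2) by auto
    show "x \<in> V k \<or> (\<exists>f\<in>\<FF>. f x \<in> V k)"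
    proof (rule ccontr)
      assume a: "\<not> ?thesis"
      then have "\<forall>f\<in>\<FF>. f x \<notin> V (q x)" using Vq[of "q x" k] \<open>q x < k\<close> by auto
      then have "x \<in> V (Suc (q x))" using x by (auto simp: VS)
      then show False using a Vq[of "Suc (q x)" k x] \<open>q x < k\<close> by auto
    qed
  qed
qed

section \<open>Two-colourings with finite components\<close>

text \<open>\<open>N\<close> plays the role of the null or meager sets. The translation-invariant
  total order \<open>le\<close> serves to single out one point of a finite component,
  \<open>colour\<close> encodes freeness in a measurable way, and the \<open>9\<close> in
  \<open>doubling\<close> is matched by the \<open>9\<close> in \<open>choice\<close>.\<close>

locale normed_action =
  fixes M :: "'a measure" and N :: "'a set set" and s :: "'g::{ab_group_add,countable} \<Rightarrow> 'a \<Rightarrow> 'a"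
    and nrm :: "'g \<Rightarrow> int" and le :: "'g \<Rightarrow> 'g \<Rightarrow> bool"
  assumes nrm_add: "nrm (m + n) \<le> nrm m + nrm n"
    and nrm_minus [simp]: "nrm (- n) = nrm n"
    and nrm_zero [simp]: "nrm 0 = 0"
    and finite_nrm: "finite {n. nrm n \<le> r}"
    and doubling: "0 \<le> r \<Longrightarrow> \<exists>t :: nat \<Rightarrow> 'g. \<forall>n. nrm n \<le> 3 * r \<longrightarrow> (\<exists>w<9. nrm (n - t w) \<le> r)"
    and le_antisym: "le m n \<Longrightarrow> le n m \<Longrightarrow> m = n"
    and le_trans: "le k m \<Longrightarrow> le m n \<Longrightarrow> le k n"
    and le_total: "le m n \<or> le n m"
    and le_add: "le m n \<Longrightarrow> le (m + k) (n + k)"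
    and s_meas: "s n \<in> measurable M M"
    and s_0: "x \<in> space M \<Longrightarrow> s 0 x = x"
    and s_add: "x \<in> space M \<Longrightarrow> s (m + n) x = s m (s n x)"
    and N_sets: "A \<in> N \<Longrightarrow> A \<in> sets M"
    and N_sub: "A \<in> N \<Longrightarrow> B \<subseteq> A \<Longrightarrow> B \<in> N"
    and N_UN: "(\<And>i::nat. H i \<in> N) \<Longrightarrow> (\<Union>i. H i) \<in> N"
    and N_shift: "A \<in> N \<Longrightarrow> {x \<in> space M. s n x \<in> A} \<in> N"
    and colour: "finite F \<Longrightarrow> 0 \<notin> F \<Longrightarrow>
      \<exists>q (k::nat). dmeas M q \<and> (\<forall>x\<in>space M. q x < k) \<and> (\<forall>x\<in>space M. \<forall>n\<in>F. q (s n x) \<noteq> q x)"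
    and choice: "(\<And>i w. C i w \<in> sets M) \<Longrightarrow> (\<And>i::nat. space M \<subseteq> (\<Union>w<9. C i w)) \<Longrightarrow>
      \<exists>g :: nat \<Rightarrow> nat. (\<forall>i. g i < 9) \<and> {x \<in> space M. \<exists>m. \<forall>i\<ge>m. x \<notin> C i (g i)} \<in> N"
begin

section \<open>Neighbourhoods and components along orbits\<close>

lemma nrm_diff: "nrm (m - n) \<le> nrm m + nrm n"
  using nrm_add[of m "- n"] by simp

lemma nrm_minus_commute: "nrm (m - n) = nrm (n - m)"
  using nrm_minus[of "m - n"] by simp

lemma nrm_nonneg [simp]: "0 \<le> nrm n"
  using nrm_add[of n "- n"] by simp

lemma s_space: "x \<in> space M \<Longrightarrow> s n x \<in> space M"
  using measurable_space[OF s_meas] .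

lemma s_s: "x \<in> space M \<Longrightarrow> s m (s n x) = s (m + n) x"
  by (simp add: s_add)

definition thick :: "int \<Rightarrow> 'a set \<Rightarrow> 'a set" where
  "thick r A = {x \<in> space M. \<exists>n. nrm n \<le> r \<and> s n x \<in> A}"

lemma thick_space: "thick r A \<subseteq> space M" by (auto simp: thick_def)

lemma thick_sets: assumes "A \<in> sets M" shows "thick r A \<in> sets M"
proof -
  have "dmeas M (\<lambda>x. \<exists>n\<in>{n. nrm n \<le> r}. s n x \<in> A)"
    by (intro dmeas_ex dmeas_shift[OF dmeas_mem[OF assms] s_meas] countable_finite finite_nrm)
  from dmeas_pred[OF this] show ?thesis by (simp add: thick_def)
qed

lemma thick_mono: "r \<le> t \<Longrightarrow> A \<subseteq> B \<Longrightarrow> thick r A \<subseteq> thick t B"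
  unfolding thick_def by (blast intro: order_trans)

lemma thick_thick: "thick r (thick t A) \<subseteq> thick (r + t) A"
proof
  fix x assume "x \<in> thick r (thick t A)"
  then obtain m n where x: "x \<in> space M" "nrm n \<le> r" "nrm m \<le> t" "s m (s n x) \<in> A"
    by (auto simp: thick_def)
  then have "s (m + n) x \<in> A" "nrm (m + n) \<le> r + t" using nrm_add[of m n] by (auto simp: s_s)
  then show "x \<in> thick (r + t) A" using x by (auto simp: thick_def)
qed

lemma thick_Un: "thick r (A \<union> B) = thick r A \<union> thick r B"
  by (auto simp: thick_def)

lemma subset_thick: "A \<subseteq> space M \<Longrightarrow> 0 \<le> r \<Longrightarrow> A \<subseteq> thick r A"
  by (auto simp: thick_def s_0 subset_iff intro!: exI[of _ 0])

lemma thickI: "x \<in> space M \<Longrightarrow> nrm n \<le> r \<Longrightarrow> s n x \<in> A \<Longrightarrow> x \<in> thick r A"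
  by (auto simp: thick_def)

text \<open>The predicate records the displacement and not the end point: the size of a component is
  then measured by \<open>nrm\<close>, and a component becomes a set of group elements in which
  \<open>le\<close> can select a least one.\<close>

inductive conn :: "'a set \<Rightarrow> 'a \<Rightarrow> 'g \<Rightarrow> bool" for K x where
  conn_0: "x \<in> space M \<Longrightarrow> x \<in> K \<Longrightarrow> conn K x 0"
| conn_step: "conn K x n \<Longrightarrow> nrm (m - n) \<le> 1 \<Longrightarrow> s m x \<in> K \<Longrightarrow> conn K x m"

lemma conn_space: "conn K x n \<Longrightarrow> x \<in> space M"
  by (induction rule: conn.induct)

lemma conn_start: "conn K x n \<Longrightarrow> x \<in> K"
  by (induction rule: conn.induct)

lemma conn_end: "conn K x n \<Longrightarrow> s n x \<in> K"
  by (induction rule: conn.induct) (auto simp: s_0)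

lemma conn_mono: "conn K x n \<Longrightarrow> K \<subseteq> L \<Longrightarrow> conn L x n"
  by (induction rule: conn.induct) (auto intro: conn.intros)

lemma conn_trans:
  assumes "conn K (s n x) m" and n: "conn K x n" shows "conn K x (m + n)"
  using assms(1)
proof (induction rule: conn.induct)
  case conn_0 then show ?case using n by simp
next
  case (conn_step m m')
  have "s (m' + n) x \<in> K" using conn_step(3) conn_space[OF n] by (simp add: s_add)
  then show ?case using conn.conn_step[OF conn_step(4), of "m' + n"] conn_step(2) by simp
qed

lemma conn_one:
  assumes "x \<in> space M" "x \<in> K" "nrm e \<le> 1" "s e x \<in> K" shows "conn K x e"
  using conn_step[OF conn_0, of x K e] assms by simp

lemma conn_sym: "conn K x n \<Longrightarrow> conn K (s n x) (- n)"
proof (induction rule: conn.induct)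
  case conn_0 then show ?case using conn.conn_0[of x K] by (simp add: s_0)
next
  case (conn_step n m)
  note x = conn_space[OF conn_step(1)]
  have "conn K (s m x) (n - m)"
    by (rule conn_one) (use conn_step x in \<open>auto simp: s_space s_s nrm_minus_commute[of n] conn_end\<close>)
  moreover have "conn K (s (n - m) (s m x)) (- n)" using conn_step x by (simp add: s_s)
  ultimately show ?case using conn_trans[of K "n - m" "s m x" "- n"] by simp
qed

lemma conn_shift:
  assumes "conn K x a" shows "conn K (s a x) m \<longleftrightarrow> conn K x (m + a)"
proof
  assume "conn K x (m + a)"
  moreover have "s (- a) (s a x) = x" using conn_space[OF assms] by (simp add: s_s s_0)
  ultimately show "conn K (s a x) m"
    using conn_trans[OF _ conn_sym[OF assms], of "m + a"] by simp
qed (use conn_trans assms in blast)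

text \<open>Counting steps turns the inductive predicate into a countable union of conditions whose
  measurability follows by induction.\<close>

primrec reach :: "'a set \<Rightarrow> nat \<Rightarrow> 'a \<Rightarrow> 'g \<Rightarrow> bool" where
  "reach K 0 x n \<longleftrightarrow> n = 0 \<and> x \<in> K"
| "reach K (Suc i) x n \<longleftrightarrow> (\<exists>m\<in>UNIV. (nrm (n - m) \<le> 1 \<and> s n x \<in> K) \<and> reach K i x m)"

lemma conn_iff_reach:
  assumes x: "x \<in> space M" shows "conn K x n \<longleftrightarrow> (\<exists>i\<in>UNIV. reach K i x n)"
proof
  assume "conn K x n" then show "\<exists>i\<in>UNIV. reach K i x n"
  proof (induction rule: conn.induct)
    case conn_0 then show ?case by (auto intro!: exI[of _ 0])
  next
    case (conn_step n m)
    then obtain i where "reach K i x n" by auto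
    with conn_step have "reach K (Suc i) x m" by auto
    then show ?case by blast
  qed
next
  have "reach K i x n \<Longrightarrow> conn K x n" for i
    by (induction i arbitrary: n) (use x in \<open>auto intro: conn.intros\<close>)
  then show "\<exists>i\<in>UNIV. reach K i x n \<Longrightarrow> conn K x n" by auto
qed

lemma conn_dmeas: assumes "K \<in> sets M" shows "dmeas M (\<lambda>x. conn K x n)"
proof -
  have r: "dmeas M (\<lambda>x. reach K i x n)" for i n
  proof (induction i arbitrary: n)
    case 0
    show ?case using dmeas_mem[OF assms] by (auto intro!: dmeas_comp2[of _ _ _ "(\<and>)"] dmeas_const)
  next
    case (Suc i)
    have "dmeas M (\<lambda>x. \<exists>m\<in>UNIV. (nrm (n - m) \<le> 1 \<and> s n x \<in> K) \<and> reach K i x m)"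
      by (rule dmeas_ex, simp)
        (intro dmeas_comp2[of _ _ _ "(\<and>)"] dmeas_const Suc dmeas_shift[OF dmeas_mem[OF assms] s_meas])
    then show ?case by simp
  qed
  have "dmeas M (\<lambda>x. \<exists>i\<in>UNIV. reach K i x n)" by (rule dmeas_ex) (auto intro: r)
  from dmeas_pred[OF this] show ?thesis
    by (intro dmeas_predI) (simp add: conn_iff_reach cong: conj_cong)
qed

definition bdd :: "'a set \<Rightarrow> int \<Rightarrow> bool" where
  "bdd K \<delta> \<longleftrightarrow> (\<forall>x n. conn K x n \<longrightarrow> nrm n \<le> \<delta>)"

lemma bdd_mono: "bdd L \<delta> \<Longrightarrow> K \<subseteq> L \<Longrightarrow> bdd K \<delta>"
  unfolding bdd_def using conn_mono by blast

text \<open>To pass from one ball to another through \<open>K\<close> costs at most \<open>r\<close>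
  to leave the first ball, two connecting steps, \<delta> inside \<open>K\<close>, and
  \<open>r\<close> to the second centre. The separation forbids this, so a component meets at most
  one ball and stays within \<open>r + \<delta> + 1\<close> of its centre.\<close>

lemma bdd_Un_separated:
  assumes K: "bdd K \<delta>" and "0 \<le> \<delta>" "0 \<le> r"
    and sep: "\<And>x n. x \<in> U \<Longrightarrow> n \<noteq> 0 \<Longrightarrow> nrm n \<le> 2 * r + \<delta> + 2 \<Longrightarrow> s n x \<notin> U"
  shows "bdd (K \<union> thick r U) (2 * r + 2 * \<delta> + 2)"
  unfolding bdd_def
proof (intro allI impI)
  fix x n assume c: "conn (K \<union> thick r U) x n"
  note x = conn_space[OF c]
  \<comment> \<open>Invariant along a path: either no ball has been met, or a single centre
    \<open>c\<close> has been met and the path is now in its ball or in a component of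
    \<open>K\<close> entered at a point \<open>m\<close> next to the ball.\<close>
  define J where "J n \<longleftrightarrow> conn K x n \<or> (\<exists>c. s c x \<in> U \<and> nrm c \<le> r + \<delta> + 1 \<and>
      (nrm (n - c) \<le> r \<or> (\<exists>m. nrm (m - c) \<le> r + 1 \<and> conn K (s m x) (n - m))))" for n
  have near: "nrm (n - c) \<le> r + 1 + \<delta>"
    if "nrm (n - c) \<le> r \<or> (\<exists>m. nrm (m - c) \<le> r + 1 \<and> conn K (s m x) (n - m))" for n c
    using that
  proof
    assume "\<exists>m. nrm (m - c) \<le> r + 1 \<and> conn K (s m x) (n - m)"
    then obtain m where "nrm (m - c) \<le> r + 1" "nrm (n - m) \<le> \<delta>" using K by (auto simp: bdd_def)
    then show ?thesis using nrm_add[of "n - m" "m - c"] by simp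
  qed (use \<open>0 \<le> \<delta>\<close> in simp)
  have "J n" using c
  proof (induction rule: conn.induct)
    case conn_0
    then consider "x \<in> K" | c where "s c x \<in> U" "nrm c \<le> r" by (auto simp: thick_def)
    then show ?case
    proof cases
      case 1 then show ?thesis using conn_0 conn.conn_0 by (auto simp: J_def)
    next
      case 2 then show ?thesis using \<open>0 \<le> \<delta>\<close> unfolding J_def by (intro disjI2 exI[of _ c]) auto
    qed
  next
    case (conn_step n n')
    note Jn = conn_step(4)[unfolded J_def]
    from conn_step(3) consider "s n' x \<in> K" | c where "s c x \<in> U" "nrm (n' - c) \<le> r"
    proof -
      assume a: "s n' x \<in> K \<Longrightarrow> thesis" and b: "\<And>c. s c x \<in> U \<Longrightarrow> nrm (n' - c) \<le> r \<Longrightarrow> thesis"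
      from conn_step(3) have "s n' x \<in> K \<or> (\<exists>k. nrm k \<le> r \<and> s k (s n' x) \<in> U)"
        by (auto simp: thick_def)
      then show thesis
      proof
        assume "\<exists>k. nrm k \<le> r \<and> s k (s n' x) \<in> U"
        then obtain k where "nrm k \<le> r" "s (k + n') x \<in> U" using x by (auto simp: s_s)
        then show thesis using b[of "k + n'"] nrm_minus[of k] by simp
      qed (rule a)
    qed
    then show ?case
    proof cases
      case 1
      from Jn show ?thesis
      proof (elim disjE exE conjE)
        assume "conn K x n" then show ?thesis using conn_step(2) 1 conn.conn_step by (auto simp: J_def)
      next
        fix c assume c: "s c x \<in> U" "nrm c \<le> r + \<delta> + 1" "nrm (n - c) \<le> r"
        have "nrm (n' - c) \<le> r + 1" using nrm_add[of "n' - n" "n - c"] c conn_step(2) by simp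
        moreover have "conn K (s n' x) (n' - n')" using 1 x by (auto intro: conn_0 simp: s_space)
        ultimately show ?thesis using c unfolding J_def by blast
      next
        fix c m assume c: "s c x \<in> U" "nrm c \<le> r + \<delta> + 1" "nrm (m - c) \<le> r + 1"
          "conn K (s m x) (n - m)"
        have "conn K (s m x) (n' - m)"
          using conn.conn_step[OF c(4), of "n' - m"] conn_step(2) 1 x by (simp add: s_s)
        then show ?thesis using c unfolding J_def by blast
      qed
    next
      case (2 c)
      from Jn show ?thesis
      proof (elim disjE[of "conn K x n"] exE conjE)
        assume "conn K x n"
        then have "nrm n \<le> \<delta>" using K by (auto simp: bdd_def)
        then have "nrm n' \<le> \<delta> + 1" using nrm_add[of "n' - n" n] conn_step(2) by simp
        then have "nrm c \<le> r + \<delta> + 1" using nrm_diff[of n' "n' - c"] 2 by simp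
        then show ?thesis using 2 unfolding J_def by blast
      next
        fix c' assume c': "s c' x \<in> U" "nrm c' \<le> r + \<delta> + 1"
          and "nrm (n - c') \<le> r \<or> (\<exists>m. nrm (m - c') \<le> r + 1 \<and> conn K (s m x) (n - m))"
        then have "nrm (n - c') \<le> r + 1 + \<delta>" using near by blast
        then have "nrm (n' - c') \<le> r + 2 + \<delta>" using nrm_add[of "n' - n" "n - c'"] conn_step(2) by simp
        then have "nrm (c - c') \<le> 2 * r + \<delta> + 2"
          using nrm_diff[of "n' - c'" "n' - c"] 2 by simp
        moreover have "s (c - c') (s c' x) \<in> U" using 2 x by (simp add: s_s)
        ultimately have "c = c'" using sep[OF c'(1), of "c - c'"] by auto
        then show ?thesis using 2 c' unfolding J_def by blast
      qed
    qed
  qed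
  then show "nrm n \<le> 2 * r + 2 * \<delta> + 2" unfolding J_def
  proof (elim disjE[of "conn K x n"] exE conjE)
    assume "conn K x n" then show ?thesis using K \<open>0 \<le> r\<close> \<open>0 \<le> \<delta>\<close> by (force simp: bdd_def)
  next
    fix c assume c: "nrm c \<le> r + \<delta> + 1"
      and "nrm (n - c) \<le> r \<or> (\<exists>m. nrm (m - c) \<le> r + 1 \<and> conn K (s m x) (n - m))"
    then have "nrm (n - c) \<le> r + 1 + \<delta>" using near by blast
    then show ?thesis using nrm_add[of "n - c" c] c by simp
  qed
qed

text \<open>Components of \<open>thick 1 K\<close>, not of \<open>K\<close>, are added, so that a
  component of \<open>K\<close> is swallowed together with its surroundings: a point of
  \<open>K\<close> inside the result has all its neighbours inside, and a point of \<open>K\<close>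
  outside is not adjacent to it.\<close>

definition absorb :: "'a set \<Rightarrow> 'a set \<Rightarrow> 'a set" where
  "absorb K C = {x \<in> space M. x \<in> C \<or> (\<exists>n. conn (thick 1 K) x n \<and> s n x \<in> thick 1 C)}"

lemma absorb_sets: assumes "K \<in> sets M" "C \<in> sets M" shows "absorb K C \<in> sets M"
proof -
  have "dmeas M (\<lambda>x. x \<in> C \<or> (\<exists>n\<in>UNIV. conn (thick 1 K) x n \<and> s n x \<in> thick 1 C))"
    by (intro dmeas_comp2[of _ _ _ "(\<or>)"] dmeas_mem assms dmeas_ex countableI_type)
      (intro dmeas_comp2[of _ _ _ "(\<and>)"] conn_dmeas thick_sets assms
        dmeas_shift[OF dmeas_mem[OF thick_sets[OF assms(2)]] s_meas])
  from dmeas_pred[OF this] show ?thesis by (simp add: absorb_def)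
qed

lemma absorb_neighbour:
  assumes x: "x \<in> absorb K C" "x \<in> K" and e: "nrm e \<le> 1"
  shows "s e x \<in> absorb K C"
proof -
  have xs: "x \<in> space M" using x by (auto simp: absorb_def)
  have unshift: "s (- e) (s e x) = x" using xs by (simp add: s_s s_0)
  have xK: "x \<in> thick 1 K" using x xs by (auto intro!: thickI[of x 0] simp: s_0)
  have z: "s e x \<in> thick 1 K" using xs e x(2) by (auto intro!: thickI[of _ "- e"] simp: s_space unshift)
  consider "x \<in> C" | n where "conn (thick 1 K) x n" "s n x \<in> thick 1 C"
    using x by (auto simp: absorb_def)
  then show ?thesis
  proof cases
    case 1
    then have "s e x \<in> thick 1 C" using xs e by (auto intro!: thickI[of _ "- e"] simp: s_space unshift)
    moreover have "conn (thick 1 K) (s e x) 0" using z xs by (auto intro: conn_0 simp: s_space)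
    ultimately show ?thesis using xs s_0[of "s e x"] by (auto simp: absorb_def s_space intro!: exI[of _ 0])
  next
    case (2 n)
    have "conn (thick 1 K) (s e x) (- e)"
      by (rule conn_one) (use z xs e xK unshift in \<open>auto simp: s_space\<close>)
    then have "conn (thick 1 K) (s e x) (n + - e)" using conn_trans[of _ "- e" "s e x" n] 2 unshift by simp
    moreover have "s (n + - e) (s e x) = s n x" using xs by (simp add: s_s)
    ultimately show ?thesis using 2 xs by (auto simp: absorb_def s_space)
  qed
qed

lemma absorb_closed:
  assumes x: "x \<in> thick 1 (absorb K C)" "x \<in> K" shows "x \<in> absorb K C"
proof -
  obtain e where xs: "x \<in> space M" and e: "nrm e \<le> 1" "s e x \<in> absorb K C"
    using x by (auto simp: thick_def)
  have xK: "x \<in> thick 1 K" using x xs by (auto intro!: thickI[of x 0] simp: s_0)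
  consider "s e x \<in> C" | n where "conn (thick 1 K) (s e x) n" "s n (s e x) \<in> thick 1 C"
    using e by (auto simp: absorb_def)
  then show ?thesis
  proof cases
    case 1
    then have "x \<in> thick 1 C" using xs e by (auto intro: thickI)
    moreover have "conn (thick 1 K) x 0" using xK xs by (rule_tac conn_0)
    ultimately show ?thesis using xs s_0[of x] by (auto simp: absorb_def intro!: exI[of _ 0])
  next
    case (2 n)
    have "conn (thick 1 K) x e" by (rule conn_one) (use xK xs e conn_start[OF 2(1)] in auto)
    then have "conn (thick 1 K) x (n + e)" using 2 conn_trans by blast
    moreover have "s (n + e) x = s n (s e x)" using xs by (simp add: s_s)
    ultimately show ?thesis using 2 xs by (auto simp: absorb_def)
  qed
qed

lemma absorb_thick:
  assumes "bdd (thick 1 K) \<delta>" "0 \<le> \<delta>" shows "absorb K (thick \<rho> U) \<subseteq> thick (\<rho> + 1 + \<delta>) U"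
proof
  fix x assume x: "x \<in> absorb K (thick \<rho> U)"
  then consider "x \<in> thick \<rho> U" | n where "conn (thick 1 K) x n" "s n x \<in> thick 1 (thick \<rho> U)"
    by (auto simp: absorb_def)
  then show "x \<in> thick (\<rho> + 1 + \<delta>) U"
  proof cases
    case 1 then show ?thesis using thick_mono[of \<rho> "\<rho> + 1 + \<delta>" U U] assms by auto
  next
    case (2 n)
    then have "nrm n \<le> \<delta>" using assms by (auto simp: bdd_def)
    then have "x \<in> thick \<delta> (thick (1 + \<rho>) U)"
      using 2 conn_space[OF 2(1)] thick_thick[of 1 \<rho> U] by (blast intro: thickI)
    then show ?thesis using thick_thick[of \<delta> "1 + \<rho>" U] by (auto simp: algebra_simps)
  qed
qed

text \<open>The absorbed balls stay within \<rho> + \<delta> + 1 of \<open>U\<close>; thickening by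
  1 and by 2 gives radius \<rho> + \<delta> + 4. Both constants are those of
  \<open>bdd_Un_separated\<close> for this radius, and the hypothesis on \<open>thick 2 K\<close>
  reproduces itself.\<close>

lemma bdd_stage:
  assumes K: "bdd (thick 2 K) \<delta>" and nn: "0 \<le> \<delta>" "0 \<le> \<rho>"
    and sep: "\<And>x n. x \<in> U \<Longrightarrow> n \<noteq> 0 \<Longrightarrow> nrm n \<le> 2 * \<rho> + 3 * \<delta> + 10 \<Longrightarrow> s n x \<notin> U"
  shows "bdd (thick 2 (K \<union> thick 1 (absorb K (thick \<rho> U)))) (2 * \<rho> + 4 * \<delta> + 10)"
proof -
  have K1: "bdd (thick 1 K) \<delta>" by (rule bdd_mono[OF K thick_mono]) auto
  have "thick 2 (thick 1 (absorb K (thick \<rho> U))) \<subseteq> thick 3 (thick (\<rho> + 1 + \<delta>) U)"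
    using thick_thick[of 2 1] thick_mono[OF order_refl absorb_thick[OF K1 nn(1)], of 3] by fastforce
  also have "\<dots> \<subseteq> thick (\<rho> + \<delta> + 4) U"
    using thick_thick[of 3 "\<rho> + 1 + \<delta>" U] by (simp add: algebra_simps)
  finally have sub: "thick 2 (K \<union> thick 1 (absorb K (thick \<rho> U))) \<subseteq> thick 2 K \<union> thick (\<rho> + \<delta> + 4) U"
    by (auto simp: thick_Un)
  have "bdd (thick 2 K \<union> thick (\<rho> + \<delta> + 4) U) (2 * (\<rho> + \<delta> + 4) + 2 * \<delta> + 2)"
    by (rule bdd_Un_separated[OF K nn(1)]) (use nn sep in \<open>auto simp: algebra_simps\<close>)
  then show ?thesis using bdd_mono[OF _ sub] by (simp add: algebra_simps)
qed

text \<open>A maximal \<open>R\<close>-separated set; maximality is what yields the covering at the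
  same radius.\<close>

lemma separated_cover:
  assumes "0 \<le> R"
  obtains U where "U \<in> sets M" "\<And>x n. x \<in> U \<Longrightarrow> n \<noteq> 0 \<Longrightarrow> nrm n \<le> R \<Longrightarrow> s n x \<notin> U"
    "\<And>x. x \<in> space M \<Longrightarrow> \<exists>n. nrm n \<le> R \<and> s n x \<in> U"
proof -
  define F where "F = {n. nrm n \<le> R} - {0}"
  obtain q k where q: "dmeas M q" "\<And>x. x \<in> space M \<Longrightarrow> q x < (k::nat)"
    "\<And>x n. x \<in> space M \<Longrightarrow> n \<in> F \<Longrightarrow> q (s n x) \<noteq> q x"
    using colour[of F] finite_nrm[of R] unfolding F_def by blast
  show thesis
  proof (rule maximal_independent_set[of "s ` F" M q k])
    show "finite (s ` F)" using finite_nrm[of R] by (auto simp: F_def)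
    fix f assume "f \<in> s ` F"
    then obtain n where n: "f = s n" "n \<in> F" by auto
    then have "- n \<in> F" by (auto simp: F_def)
    then show "\<exists>g\<in>s ` F. \<forall>x\<in>space M. g (f x) = x"
      using n by (intro bexI[of _ "s (- n)"]) (auto simp: s_s s_0)
  next
    fix U assume U: "U \<in> sets M" "\<And>x f. x \<in> U \<Longrightarrow> f \<in> s ` F \<Longrightarrow> f x \<notin> U"
      "\<And>x. x \<in> space M \<Longrightarrow> x \<in> U \<or> (\<exists>f\<in>s ` F. f x \<in> U)"
    show thesis
    proof (rule that[OF U(1)])
      fix x n assume "x \<in> U" "n \<noteq> 0" "nrm n \<le> R"
      then show "s n x \<notin> U" using U(2) by (auto simp: F_def)
    next
      fix x assume "x \<in> space M"
      then consider "x \<in> U" | n where "n \<in> F" "s n x \<in> U" using U(3) by blast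
      then show "\<exists>n. nrm n \<le> R \<and> s n x \<in> U"
        by cases (use \<open>x \<in> space M\<close> assms in \<open>auto simp: F_def s_0 intro: exI[of _ 0]\<close>)
    qed
  qed (use q s_meas in auto)
qed

text \<open>At stage \<open>i\<close> the uncoloured points of \<open>D i\<close> get the second colour and the ring around \<open>D i\<close>
  gets the first one. As \<open>D i\<close> absorbs every component of earlier coloured points that it comes close to,
  the ring is uncoloured before, so it encloses components of the second colour, and components of the
  first colour inside \<open>D i\<close> are enclosed by new points of the second colour.\<close>

lemma two_colouring:
  obtains Y G where "Y \<in> sets M" "G \<in> sets M" "space M - G \<in> N" "\<And>x n. x \<in> G \<Longrightarrow> s n x \<in> G"
    "\<And>x. x \<in> G \<Longrightarrow> \<exists>\<delta>. \<forall>n. conn (if x \<in> Y then Y else space M - Y) x n \<longrightarrow> nrm n \<le> \<delta>"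
proof -
  \<comment> \<open>The recursion is the bound of \<open>bdd_stage\<close> for \<rho> =
    \<open>3 * d + 10\<close>, and this \<rho> makes the separation required there equal to
    \<open>3 * \<rho>\<close>.\<close>
  define del :: "nat \<Rightarrow> int" where "del = rec_nat 0 (\<lambda>_ d. 10 * d + 30)"
  have del: "del 0 = 0" "del (Suc i) = 10 * del i + 30" for i by (simp_all add: del_def)
  have del_nn: "0 \<le> del i" for i by (induction i) (auto simp: del)
  define \<rho> where "\<rho> i = 3 * del i + 10" for i
  have \<rho>_nn: "0 \<le> \<rho> i" for i using del_nn[of i] by (simp add: \<rho>_def)
  have "\<exists>U. U \<in> sets M \<and> (\<forall>x n. x \<in> U \<longrightarrow> n \<noteq> 0 \<longrightarrow> nrm n \<le> 3 * \<rho> i \<longrightarrow> s n x \<notin> U) \<and>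
      (\<forall>x\<in>space M. \<exists>n. nrm n \<le> 3 * \<rho> i \<and> s n x \<in> U)" for i
    using separated_cover[of "3 * \<rho> i"] \<rho>_nn[of i] by (metis mult_nonneg_nonneg zero_le_numeral)
  then obtain U where U: "\<And>i. U i \<in> sets M"
    "\<And>i x n. x \<in> U i \<Longrightarrow> n \<noteq> 0 \<Longrightarrow> nrm n \<le> 3 * \<rho> i \<Longrightarrow> s n x \<notin> U i"
    "\<And>i x. x \<in> space M \<Longrightarrow> \<exists>n. nrm n \<le> 3 * \<rho> i \<and> s n x \<in> U i" by metis
  obtain t :: "nat \<Rightarrow> nat \<Rightarrow> 'g" where t: "\<And>i n. nrm n \<le> 3 * \<rho> i \<Longrightarrow> \<exists>w<9. nrm (n - t i w) \<le> \<rho> i"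
    using doubling[OF \<rho>_nn] by metis
  \<comment> \<open>All nine translates of \<open>U i\<close> are still
    \<open>3 * \<rho>\<close>-separated. None of them needs to cover at radius \<rho> alone, but
    their \<rho>-neighbourhoods cover together, which is the input for
    \<open>choice\<close>.\<close>
  define V where "V i w = {x \<in> space M. s (t i w) x \<in> U i}" for i w
  have Vs: "V i w \<in> sets M" for i w
    unfolding V_def by (intro dmeas_pred dmeas_shift[OF dmeas_mem[OF U(1)] s_meas])
  have Vsep: "s n x \<notin> V i w" if "x \<in> V i w" "n \<noteq> 0" "nrm n \<le> 3 * \<rho> i" for i w x n
    using U(2)[of "s (t i w) x" i n] that by (auto simp: V_def s_s add.commute)
  have cover: "space M \<subseteq> (\<Union>w<9. thick (\<rho> i) (V i w))" for i
  proof
    fix x assume x: "x \<in> space M"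
    then obtain n where n: "nrm n \<le> 3 * \<rho> i" "s n x \<in> U i" using U(3) by blast
    then obtain w where w: "w < 9" "nrm (n - t i w) \<le> \<rho> i" using t by blast
    then have "s (n - t i w) x \<in> V i w" using x n by (simp add: V_def s_space s_s)
    then show "x \<in> (\<Union>w<9. thick (\<rho> i) (V i w))" using x w by (auto intro: thickI)
  qed
  obtain g where "\<And>i. g i < 9"
    and g: "{x \<in> space M. \<exists>m. \<forall>i\<ge>m. x \<notin> thick (\<rho> i) (V i (g i))} \<in> N"
    using choice[of "\<lambda>i w. thick (\<rho> i) (V i w)", OF thick_sets[OF Vs] cover] by blast
  define C where "C i = thick (\<rho> i) (V i (g i))" for i
  define bad where "bad = {x \<in> space M. \<exists>m. \<forall>i\<ge>m. x \<notin> C i}"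
  have bad: "bad \<in> N" using g by (simp add: bad_def C_def)
  have Cs: "C i \<in> sets M" and Csp: "C i \<subseteq> space M" for i
    by (auto simp: C_def thick_sets Vs thick_space)
  define K where "K = rec_nat {} (\<lambda>i K. K \<union> thick 1 (absorb K (C i)))"
  define D where "D i = absorb (K i) (C i)" for i
  have K: "K 0 = {}" "K (Suc i) = K i \<union> thick 1 (D i)" for i by (simp_all add: K_def D_def)
  have Ks: "K i \<in> sets M" for i
    by (induction i) (auto simp: K D_def intro!: thick_sets absorb_sets Cs)
  have Ds: "D i \<in> sets M" for i by (simp add: D_def absorb_sets Ks Cs)
  have Ksp: "K i \<subseteq> space M" and Dsp: "D i \<subseteq> space M" for i
    using sets.sets_into_space[OF Ks] sets.sets_into_space[OF Ds] by auto
  have bK2: "bdd (thick 2 (K i)) (del i)" for i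
  proof (induction i)
    case 0
    have "thick 2 (K 0) = {}" by (auto simp: K thick_def)
    then show ?case unfolding bdd_def using conn_start by (auto simp: del)
  next
    case (Suc i)
    have "bdd (thick 2 (K i \<union> thick 1 (absorb (K i) (thick (\<rho> i) (V i (g i))))))
        (2 * \<rho> i + 4 * del i + 10)"
      by (rule bdd_stage[OF Suc del_nn \<rho>_nn]) (rule Vsep, auto simp: \<rho>_def)
    then show ?case by (simp add: K D_def C_def \<rho>_def del add.commute)
  qed
  have bK: "bdd (K i) (del i)" for i
    by (rule bdd_mono[OF bK2 subset_thick[OF Ksp]]) simp
  have Kmono: "K i \<subseteq> K j" if "i \<le> j" for i j
    by (rule lift_Suc_mono_le[of K, OF _ that]) (auto simp: K)
  have DK: "D i \<subseteq> K (Suc i)" for i using subset_thick[OF Dsp, of 1 i] by (auto simp: K)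
  have CD: "C i \<subseteq> D i" for i using Csp by (auto simp: D_def absorb_def)
  define Y where "Y = (\<Union>i. thick 1 (D i) - D i)"
  \<comment> \<open>A ring made before stage \<open>i\<close> lies in \<open>K i\<close>; a ring
    made after it avoids \<open>K j\<close>, which contains \<open>D i\<close>; and the ring of
    stage \<open>i\<close> itself avoids \<open>D i\<close>.\<close>
  have D_not_Y: "x \<notin> Y" if x: "x \<in> D i" "x \<notin> K i" for x i
  proof
    assume "x \<in> Y"
    then obtain j where j: "x \<in> thick 1 (D j)" "x \<notin> D j" by (auto simp: Y_def)
    then have nK: "x \<notin> K j" using absorb_closed by (auto simp: D_def)
    consider "i < j" | "i = j" | "j < i" by linarith
    then show False
      by cases (use x j nK Kmono[of "Suc i" j] Kmono[of "Suc j" i] DK[of i] K(2)[of j] in auto)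
  qed
  define G where "G = {x \<in> space M. \<forall>n. s n x \<notin> bad}"
  have sG: "s n x \<in> G" if "x \<in> G" for x n using that by (auto simp: G_def s_space s_s)
  have "space M - G = (\<Union>i. {x \<in> space M. s (from_nat i) x \<in> bad})"
    using surj_from_nat[where 'a='g] by (auto simp: G_def) (metis from_nat_to_nat)
  also have "\<dots> \<in> N" by (intro N_UN N_shift bad)
  finally have GN: "space M - G \<in> N" .
  have "G = space M - (space M - G)" by (auto simp: G_def)
  then have Gs: "G \<in> sets M" using N_sets[OF GN] by (metis sets.Diff sets.top)
  show thesis
  proof (rule that[OF _ Gs GN sG])
    show "Y \<in> sets M" unfolding Y_def by (auto intro!: thick_sets Ds)
    fix x assume x: "x \<in> G"
    then have "s 0 x \<notin> bad" "x \<in> space M" by (auto simp: G_def)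
    then have io: "\<exists>i\<ge>m. x \<in> C i" for m by (auto simp: bad_def s_0)
    show "\<exists>\<delta>. \<forall>n. conn (if x \<in> Y then Y else space M - Y) x n \<longrightarrow> nrm n \<le> \<delta>"
    proof (cases "x \<in> Y")
      case True
      \<comment> \<open>The stage \<open>i\<close> is taken after \<open>x\<close> has been coloured
        and with \<open>x\<close> covered again. A path in \<open>Y\<close> cannot leave
        \<open>K i \<inter> D i\<close>: neighbours stay in \<open>D i\<close> by
        \<open>absorb_neighbour\<close>, and a point of \<open>D i\<close> outside
        \<open>K i\<close> is not in \<open>Y\<close>.\<close>
      obtain j where "x \<in> C j" using io[of 0] by auto
      then have xj: "x \<in> K (Suc j)" using CD DK by blast
      obtain i where i: "i \<ge> Suc j" "x \<in> C i" using io by blast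
      have xK: "x \<in> K i" using xj Kmono i by blast
      have "s n x \<in> K i \<inter> D i \<and> conn (K i) x n" if "conn Y x n" for n
        using that
      proof (induction rule: conn.induct)
        case conn_0
        then show ?case using xK i CD[of i] by (auto simp: s_0 intro: conn.conn_0)
      next
        case (conn_step n m)
        have "s (m - n) (s n x) \<in> D i"
          unfolding D_def by (rule absorb_neighbour) (use conn_step in \<open>auto simp: D_def\<close>)
        then have "s m x \<in> D i" using \<open>x \<in> space M\<close> by (simp add: s_s)
        then have "s m x \<in> K i" using D_not_Y conn_step(3) by blast
        then show ?case using \<open>s m x \<in> D i\<close> conn_step conn.conn_step by blast
      qed
      then show ?thesis using bK[of i] True unfolding bdd_def by auto
    next
      case False
      obtain i where i: "x \<in> C i" using io[of 0] by auto
      \<comment> \<open>The outer neighbours of \<open>D i\<close> form its ring and so lie in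
        \<open>Y\<close>; a path avoiding \<open>Y\<close> stays in \<open>D i\<close>.\<close>
      have "s n x \<in> D i \<and> conn (D i) x n" if "conn (space M - Y) x n" for n
        using that
      proof (induction rule: conn.induct)
        case conn_0
        then show ?case using i CD[of i] by (auto simp: s_0 intro: conn.conn_0)
      next
        case (conn_step n m)
        have "s m x \<in> thick 1 (D i)"
          by (rule thickI[of _ "n - m"])
            (use conn_step \<open>x \<in> space M\<close> in \<open>auto simp: s_s s_space nrm_minus_commute[of n]\<close>)
        then have "s m x \<in> D i" using conn_step(3) by (auto simp: Y_def)
        then show ?case using conn_step conn.conn_step by blast
      qed
      then show ?thesis using bdd_mono[OF bK DK, of i] False unfolding bdd_def by auto
    qed
  qed
qed

section \<open>Base points of components\<close>

lemma finite_least: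
  assumes "finite S" "S \<noteq> {}" shows "\<exists>m\<in>S. \<forall>n\<in>S. le m n"
  using assms
proof (induction rule: finite_ne_induct)
  case (singleton x) then show ?case using le_total by blast
next
  case (insert x S)
  then obtain m where "m \<in> S" "\<forall>n\<in>S. le m n" by blast
  then show ?case using le_total le_trans by (metis insert_iff)
qed

lemma free: assumes "x \<in> space M" "s m x = s n x" shows "m = n"
proof (rule ccontr)
  assume "m \<noteq> n"
  then obtain q :: "'a \<Rightarrow> nat" where "\<forall>x\<in>space M. q (s (m - n) x) \<noteq> q x"
    using colour[of "{m - n}"] by auto
  then have "q (s (m - n) (s n x)) \<noteq> q (s n x)" using assms s_space by blast
  then show False using assms by (simp add: s_s)
qed

text \<open>Off a set in the ideal the base point of \<open>x\<close> is the least point of its (finite) monochromatic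
  component; among three mutually adjacent points two have the same colour. On the exceptional set
  every orbit gets a single base point by choice, which costs nothing since all subsets of that set
  are measurable.\<close>

lemma base_offsets:
  obtains \<nu> :: "'a \<Rightarrow> 'g" where "dmeas M \<nu>"
    "\<And>x a b c. x \<in> space M \<Longrightarrow> nrm (a - b) \<le> 1 \<Longrightarrow> nrm (b - c) \<le> 1 \<Longrightarrow> nrm (a - c) \<le> 1 \<Longrightarrow>
      a + \<nu> (s a x) = b + \<nu> (s b x) \<or> b + \<nu> (s b x) = c + \<nu> (s c x) \<or> a + \<nu> (s a x) = c + \<nu> (s c x)"
proof -
  obtain Y G where Y: "Y \<in> sets M" and G: "G \<in> sets M" "space M - G \<in> N" "\<And>x n. x \<in> G \<Longrightarrow> s n x \<in> G"
    and fin: "\<And>x. x \<in> G \<Longrightarrow> \<exists>\<delta>. \<forall>n. conn (if x \<in> Y then Y else space M - Y) x n \<longrightarrow> nrm n \<le> \<delta>"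
    by (rule two_colouring) blast
  have Gsp: "G \<subseteq> space M" using sets.sets_into_space[OF G(1)] .
  define S where "S x = {n. conn (if x \<in> Y then Y else space M - Y) x n}" for x
  define L where "L x n \<longleftrightarrow> n \<in> S x \<and> (\<forall>m\<in>S x. le n m)" for x n
  define orb where "orb x = range (\<lambda>n. s n x)" for x
  \<comment> \<open>\<nu> is the displacement from a point to its base point, so
    \<open>a + \<nu> (s a x)\<close> locates that base point relative to \<open>x\<close>. Off
    \<open>G\<close> the chosen point depends only on the set \<open>orb x\<close> and is therefore
    common to the orbit.\<close>
  define \<nu> where "\<nu> x = (if x \<in> G then THE n. L x n else SOME n. s n x = (SOME y. y \<in> orb x))" for x
  have L_unique: "L x n \<Longrightarrow> L x m \<Longrightarrow> n = m" for x n m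
    unfolding L_def using le_antisym by blast
  have L_ex: "\<exists>n. L x n" if "x \<in> G" for x
  proof -
    have "finite (S x)" using fin[OF that] finite_nrm unfolding S_def
      by (metis (no_types, lifting) finite_subset mem_Collect_eq subsetI)
    moreover have "0 \<in> S x" using that Gsp by (auto simp: S_def intro: conn_0)
    ultimately show ?thesis using finite_least[of "S x"] unfolding L_def by blast
  qed
  have \<nu>L: "\<nu> x = n \<longleftrightarrow> L x n" if "x \<in> G" for x n
    using L_ex[OF that] L_unique that by (metis \<nu>_def theI)
  \<comment> \<open>Adjacent points of equal colour share a component; the two displacement sets
    differ by the translation \<open>b - a\<close>, which \<open>le\<close> respects, so the least
    points coincide.\<close>
  have same: "a + \<nu> (s a x) = b + \<nu> (s b x)"
    if x: "x \<in> G" and ab: "nrm (a - b) \<le> 1" and col: "s a x \<in> Y \<longleftrightarrow> s b x \<in> Y" for x a b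
  proof -
    define Z where "Z = (if s a x \<in> Y then Y else space M - Y)"
    have SZ: "S (s a x) = {n. conn Z (s a x) n}" "S (s b x) = {n. conn Z (s b x) n}"
      using col by (auto simp: S_def Z_def)
    have xs: "x \<in> space M" using x Gsp by auto
    have sab: "s (b - a) (s a x) = s b x" using xs by (simp add: s_s)
    have "conn Z (s a x) (b - a)"
      by (rule conn_one) (use xs ab col in \<open>auto simp: Z_def sab s_space nrm_minus_commute[of b]\<close>)
    from conn_shift[OF this] have sh: "m \<in> S (s b x) \<longleftrightarrow> m + (b - a) \<in> S (s a x)" for m
      by (simp add: SZ sab)
    have Lb: "L (s b x) (\<nu> (s b x))" using \<nu>L[OF G(3)[OF x]] by blast
    have "L (s a x) (\<nu> (s b x) + (b - a))"
      unfolding L_def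
    proof
      show "\<nu> (s b x) + (b - a) \<in> S (s a x)" using Lb sh by (auto simp: L_def)
      show "\<forall>m\<in>S (s a x). le (\<nu> (s b x) + (b - a)) m"
      proof
        fix m assume "m \<in> S (s a x)"
        then have "m - (b - a) \<in> S (s b x)" using sh[of "m - (b - a)"] by simp
        then have "le (\<nu> (s b x)) (m - (b - a))" using Lb by (auto simp: L_def)
        from le_add[OF this, of "b - a"] show "le (\<nu> (s b x) + (b - a)) m" by simp
      qed
    qed
    then have "\<nu> (s a x) = \<nu> (s b x) + (b - a)" using \<nu>L[OF G(3)[OF x]] by blast
    then show ?thesis by (simp add: algebra_simps)
  qed
  have other: "a + \<nu> (s a x) = b + \<nu> (s b x)" if x: "x \<in> space M" "x \<notin> G" for x a b
  proof -
    have out: "s n x \<notin> G" for n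
    proof
      assume "s n x \<in> G"
      from G(3)[OF this, of "- n"] show False using x by (simp add: s_s s_0)
    qed
    have orb: "orb (s n x) = orb x" for n
    proof -
      have "s m x \<in> orb (s n x)" for m
        using x by (auto simp: orb_def s_s intro!: image_eqI[of _ _ "m - n"])
      then show ?thesis using x by (auto simp: orb_def s_s)
    qed
    define r where "r = (SOME y. y \<in> orb x)"
    have r: "r \<in> orb x" unfolding r_def by (rule someI[of _ "s 0 x"]) (auto simp: orb_def)
    have "s (\<nu> (s n x)) (s n x) = r" for n
    proof -
      have "\<nu> (s n x) = (SOME m. s m (s n x) = r)" using out by (simp add: \<nu>_def orb r_def)
      moreover have "r \<in> orb (s n x)" using r orb[of n] by simp
      then have "\<exists>m. s m (s n x) = r" by (auto simp: orb_def)
      ultimately show ?thesis using someI_ex[of "\<lambda>m. s m (s n x) = r"] by simp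
    qed
    from this[of a] this[of b] have "s (\<nu> (s a x) + a) x = s (\<nu> (s b x) + b) x" using x by (simp add: s_s)
    from free[OF x(1) this] show ?thesis by (simp add: add.commute)
  qed
  show thesis
  proof (rule that[of \<nu>])
    have Sm: "dmeas M (\<lambda>x. n \<in> S x)" for n
    proof -
      have "dmeas M (\<lambda>x. if x \<in> Y then conn Y x n else conn (space M - Y) x n)"
        by (intro dmeas_comp3[of _ _ _ _ If] dmeas_mem Y conn_dmeas) (use Y in auto)
      moreover have "(n \<in> S x) = (if x \<in> Y then conn Y x n else conn (space M - Y) x n)" for x
        by (simp add: S_def)
      ultimately show ?thesis by simp
    qed
    have Lm: "dmeas M (\<lambda>x. L x n)" for n
    proof -
      have "dmeas M (\<lambda>x. n \<in> S x \<and> (\<forall>m\<in>UNIV. m \<in> S x \<longrightarrow> le n m))"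
        by (rule dmeas_comp2[of _ _ _ "(\<and>)", OF Sm], rule dmeas_all, simp)
          (rule dmeas_comp[of _ _ "\<lambda>b. b \<longrightarrow> le n _", OF Sm])
      then show ?thesis by (simp add: L_def Ball_def)
    qed
    show "dmeas M \<nu>"
    proof (rule dmeas_countable_type, rule dmeas_predI)
      fix v
      have "{x \<in> space M. \<nu> x = v} = (G \<inter> {x \<in> space M. L x v}) \<union> {x \<in> space M - G. \<nu> x = v}"
        using \<nu>L Gsp by auto
      \<comment> \<open>Here no regularity of the choice is available; the set is measurable because
        every subset of a member of \<open>N\<close> is.\<close>
      moreover have "{x \<in> space M - G. \<nu> x = v} \<in> sets M"
        by (rule N_sets, rule N_sub[OF G(2)]) auto
      ultimately show "{x \<in> space M. \<nu> x = v} \<in> sets M" using G(1) dmeas_pred[OF Lm] by auto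
    qed
  next
    fix x a b c
    assume *: "x \<in> space M" "nrm (a - b) \<le> 1" "nrm (b - c) \<le> 1" "nrm (a - c) \<le> 1"
    show "a + \<nu> (s a x) = b + \<nu> (s b x) \<or> b + \<nu> (s b x) = c + \<nu> (s c x) \<or> a + \<nu> (s a x) = c + \<nu> (s c x)"
    proof (cases "x \<in> G")
      case True
      then show ?thesis using same[of x a b] same[of x b c] same[of x a c] * by blast
    qed (use other * in blast)
  qed
qed

end

section \<open>Gluing in the plane\<close>

text \<open>The discrete antiderivative vanishing at 0, continued to negative arguments with the
  sign that makes \<open>prim_step\<close> hold on all integers.\<close>

definition prim :: "(int \<Rightarrow> real) \<Rightarrow> int \<Rightarrow> real" where
  "prim f i = (if 0 \<le> i then (\<Sum>k\<in>{1..i}. f k) else - (\<Sum>k\<in>{i+1..0}. f k))"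

lemma prim_0 [simp]: "prim f 0 = 0" by (simp add: prim_def)

lemma prim_step: "prim f i - prim f (i - 1) = f i"
proof -
  consider "i \<ge> 1" | "i = 0" | "i < 0" by linarith
  then show ?thesis
  proof cases
    case 1
    then have "{1..i} = insert i {1..i - 1}" by auto
    then show ?thesis using 1 by (simp add: prim_def)
  next
    case 2 then show ?thesis by (simp add: prim_def)
  next
    case 3
    then have "{i..0} = insert i {i + 1..0}" by auto
    then show ?thesis using 3 by (simp add: prim_def)
  qed
qed

lemma prim_measurable [measurable]:
  assumes "\<And>k. f k \<in> borel_measurable M"
  shows "(\<lambda>x. prim (\<lambda>k. f k x) i) \<in> borel_measurable M"
  unfolding prim_def using assms by (cases "0 \<le> i") auto

lemma int_const_up_to_Ints:
  fixes f :: "int \<Rightarrow> real"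
  assumes "\<And>i. f i - f (i - 1) \<in> \<int>" shows "f i - f 0 \<in> \<int>"
proof (induction i rule: int_induct[where k = 0])
  case base show ?case by simp
next
  case (step1 i)
  show ?case using Ints_add[OF assms[of "i + 1"] step1(2)] by simp
next
  case (step2 i)
  show ?case using Ints_diff[OF step2(2) assms[of i]] by simp
qed

lemma int_const:
  fixes f :: "int \<Rightarrow> real"
  assumes "\<And>i. f i = f (i - 1)" shows "f i = f 0"
proof (induction i rule: int_induct[where k = 0])
  case (step1 i) then show ?case using assms[of "i + 1"] by simp
next
  case (step2 i) then show ?case using assms[of i] by simp
qed simp

definition mixed_diff :: "(int \<times> int \<Rightarrow> real) \<Rightarrow> int \<times> int \<Rightarrow> real" where
  "mixed_diff P n = P n - P (n + (-1, 0)) - P (n + (0, -1)) + P (n + (-1, -1))"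

text \<open>Up to an exact term, \<open>area P y z\<close> is the integral of the 1-form \<open>P\<close> defines along an L-shaped path from
  \<open>y\<close> to \<open>z\<close>; only \<open>mixed_diff P\<close> matters. The function \<open>glue\<close> is the prism operator for the map \<open>p\<close>
  from points to base points: its boundary is the original 2-cochain minus the pullback along \<open>p\<close>, and
  the latter vanishes on triangles with at most two distinct base points.\<close>

definition area :: "(int \<times> int \<Rightarrow> real) \<Rightarrow> int \<times> int \<Rightarrow> int \<times> int \<Rightarrow> real" where
  "area P y z = (P z - P (fst z, snd y) - P y + P (fst y, snd z)) / 2"

definition glue :: "(int \<times> int \<Rightarrow> real) \<Rightarrow> (int \<times> int \<Rightarrow> int \<times> int) \<Rightarrow> int \<times> int \<Rightarrow> int \<times> int \<Rightarrow> real" where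
  "glue P p y z = area P y z + area P z (p z) - area P y (p y) - area P (p y) (p z)"

lemma area_antisym: "area P z y = - area P y z"
  by (simp add: area_def field_simps)

lemma area_self [simp]: "area P y y = 0"
  by (simp add: area_def)

lemma glue_triangle:
  assumes "p y = p z \<or> p z = p u \<or> p y = p u"
  shows "glue P p y z + glue P p z u - glue P p y u = area P y z + area P z u - area P y u"
  using assms area_antisym[of P "p z" "p y"] area_antisym[of P "p u" "p z"] area_antisym[of P "p u" "p y"]
  unfolding glue_def by auto

lemma mixed_diff_eq_0:
  assumes "\<And>n. mixed_diff D n = 0"
  shows "D (i, j) = D (i, 0) + D (0, j) - D (0, 0)"
proof -
  have "D (i, j) - D (i - 1, j) = D (i, 0) - D (i - 1, 0)" for i j
    by (rule int_const[of "\<lambda>j. D (i, j) - D (i - 1, j)"])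
      (use assms[of "(i, _)"] in \<open>auto simp: mixed_diff_def algebra_simps\<close>)
  then have "D (i, j) - D (i, 0) = D (0, j) - D (0, 0)"
    by (intro int_const[of "\<lambda>i. D (i, j) - D (i, 0)"]) (simp add: algebra_simps)
  then show ?thesis by simp
qed

text \<open>A function with zero mixed difference is a sum of functions of one coordinate. It
  changes \<open>area\<close> by a difference of end point values, and such differences cancel in
  \<open>glue\<close>. Hence the origin used to construct \<open>P\<close> leaves no trace.\<close>

lemma glue_cong_mixed_diff:
  assumes "\<And>n. mixed_diff P n = mixed_diff Q n" shows "glue P = glue Q"
proof (intro ext)
  fix p y z
  define D where "D n = P n - Q n" for n
  have "mixed_diff D n = 0" for n using assms[of n] by (simp add: D_def mixed_diff_def)
  then have D: "D n = D (fst n, 0) + D (0, snd n) - D (0, 0)" for n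
    using mixed_diff_eq_0[of D "fst n" "snd n"] by simp
  have "area P y z = area Q y z + D (0, snd z) - D (0, snd y)" for y z
  proof -
    have "area P y z - area Q y z = (D z - D (fst z, snd y) - D y + D (fst y, snd z)) / 2"
      by (simp add: area_def D_def field_simps)
    also have "\<dots> = D (0, snd z) - D (0, snd y)"
      using D[of z] D[of y] D[of "(fst z, snd y)"] D[of "(fst y, snd z)"] by simp
    finally show ?thesis by simp
  qed
  then show "glue P p y z = glue Q p y z" by (simp add: glue_def)
qed

lemma glue_shift: "glue (\<lambda>m. P (m + n)) (\<lambda>m. p (m + n) - n) y z = glue P p (y + n) (z + n)"
proof -
  have "area (\<lambda>m. P (m + n)) y z = area P (y + n) (z + n)" for y z
    by (cases n) (simp add: area_def)
  then show ?thesis by (simp add: glue_def)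
qed

section \<open>Bounded lifts of forms that are closed modulo 1\<close>

lemma frac_cong_Ints: "a - b \<in> \<int> \<Longrightarrow> frac a = frac (b::real)"
proof -
  assume "a - b \<in> \<int>"
  then obtain k where "a = b + of_int k" by (metis Ints_cases add_diff_cancel_left' diff_add_cancel add.commute)
  then show ?thesis by (simp add: frac_def)
qed

lemma minus_frac_Ints: "a - frac a \<in> \<int>"
  by (simp add: frac_def)

definition lexle :: "int \<times> int \<Rightarrow> int \<times> int \<Rightarrow> bool" where
  "lexle p q \<longleftrightarrow> fst p < fst q \<or> fst p = fst q \<and> snd p \<le> snd q"

lemma lexle_add: "lexle (p + n) (q + n) = lexle p q"
  by (simp add: lexle_def)

text \<open>Orienting pairs of base points lexicographically makes \<open>jump\<close> antisymmetric, hence \<open>lift\<close> is closed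
  on triangles with at most two distinct base points, while it agrees with the differences of \<open>h\<close>
  modulo 1 and stays bounded.\<close>

definition jump :: "(int \<times> int \<Rightarrow> real) \<Rightarrow> int \<times> int \<Rightarrow> int \<times> int \<Rightarrow> real" where
  "jump h p q = (if lexle p q then frac (h p - h q) else - frac (h q - h p))"

definition lift :: "(int \<times> int \<Rightarrow> real) \<Rightarrow> (int \<times> int \<Rightarrow> int \<times> int) \<Rightarrow> int \<times> int \<Rightarrow> int \<times> int \<Rightarrow> real" where
  "lift h p y z = frac (h y - h (p y)) + jump h (p y) (p z) - frac (h z - h (p z))"

lemma jump_antisym: "jump h q p = - jump h p q"
proof (cases "p = q")
  case False
  then have "lexle p q \<noteq> lexle q p" by (cases p; cases q) (auto simp: lexle_def)
  then show ?thesis by (auto simp: jump_def)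
qed (simp add: jump_def)

lemma jump_self [simp]: "jump h q q = 0"
  by (simp add: jump_def)

lemma jump_Ints: "h p - h q - jump h p q \<in> \<int>"
proof (cases "lexle p q")
  case False
  have "- (h q - h p - frac (h q - h p)) \<in> \<int>" by (rule Ints_minus[OF minus_frac_Ints])
  then show ?thesis using False by (simp add: jump_def algebra_simps)
qed (simp add: jump_def minus_frac_Ints)

lemma lift_Ints: "h y - h z - lift h p y z \<in> \<int>"
proof -
  have "((h y - h (p y)) - frac (h y - h (p y))) + (h (p y) - h (p z) - jump h (p y) (p z))
      - ((h z - h (p z)) - frac (h z - h (p z))) \<in> \<int>"
    by (intro Ints_add Ints_diff minus_frac_Ints jump_Ints)
  then show ?thesis by (simp add: lift_def algebra_simps)
qed

lemma lift_bound: "\<bar>lift h p y z\<bar> \<le> 2"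
proof -
  have "\<bar>jump h (p y) (p z)\<bar> \<le> 1"
    using frac_lt_1[of "h (p y) - h (p z)"] frac_lt_1[of "h (p z) - h (p y)"]
    by (auto simp: jump_def)
  then show ?thesis
    using frac_lt_1[of "h y - h (p y)"] frac_lt_1[of "h z - h (p z)"]
      frac_ge_0[of "h y - h (p y)"] frac_ge_0[of "h z - h (p z)"]
    unfolding lift_def by linarith
qed

lemma lift_triangle:
  assumes "p y = p z \<or> p z = p u \<or> p y = p u"
  shows "lift h p y z + lift h p z u = lift h p y u"
  using assms jump_antisym[of h "p z" "p y"] jump_antisym[of h "p u" "p z"] jump_antisym[of h "p u" "p y"]
  unfolding lift_def by auto

text \<open>Only fractional parts of differences of \<open>h\<close> enter, so a potential that is
  determined up to a constant and modulo 1 is good enough; this makes \<open>lift\<close>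
  independent of the origin on the orbit.\<close>

lemma lift_cong_Ints:
  assumes "\<And>n. h n - k n - c \<in> \<int>" shows "lift h = lift k"
proof -
  have "frac (h y - h z) = frac (k y - k z)" for y z
  proof (rule frac_cong_Ints)
    have "(h y - k y - c) - (h z - k z - c) \<in> \<int>" by (intro Ints_diff assms)
    then show "h y - h z - (k y - k z) \<in> \<int>" by (simp add: algebra_simps)
  qed
  then show ?thesis by (intro ext) (simp add: lift_def jump_def)
qed

lemma lift_shift: "lift (\<lambda>m. h (m + n)) (\<lambda>m. p (m + n) - n) y z = lift h p (y + n) (z + n)"
proof -
  have "jump (\<lambda>m. h (m + n)) (p - n) (q - n) = jump h p q" for p q
    using lexle_add[of "p - n" n "q - n"] by (simp add: jump_def)
  then show ?thesis by (simp add: lift_def)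
qed

text \<open>The diagonal from (-1,-1) to 0 cuts a unit square into two triangles with third corner
  \<open>e\<close>. The assumption \<open>bases\<close> says that each of these triangles sees at
  most two base points.\<close>

locale plane_action =
  fixes M :: "'a measure" and s :: "int \<times> int \<Rightarrow> 'a \<Rightarrow> 'a" and \<nu> :: "'a \<Rightarrow> int \<times> int"
  assumes s_meas [measurable]: "s n \<in> measurable M M"
    and s_0: "x \<in> space M \<Longrightarrow> s 0 x = x"
    and s_add: "x \<in> space M \<Longrightarrow> s (m + n) x = s m (s n x)"
    and \<nu>: "dmeas M \<nu>"
    and bases: "x \<in> space M \<Longrightarrow> e \<in> {(-1, 0), (0, -1)} \<Longrightarrow>
      (-1, -1) + \<nu> (s (-1, -1) x) = e + \<nu> (s e x) \<or> e + \<nu> (s e x) = \<nu> x \<or> (-1, -1) + \<nu> (s (-1, -1) x) = \<nu> x"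
begin

definition base :: "'a \<Rightarrow> int \<times> int \<Rightarrow> int \<times> int" where
  "base x n = n + \<nu> (s n x)"

lemma s_space: "x \<in> space M \<Longrightarrow> s n x \<in> space M"
  using measurable_space[OF s_meas] .

lemma base_shift: "x \<in> space M \<Longrightarrow> base (s n x) = (\<lambda>m. base x (m + n) - n)"
  by (intro ext) (simp add: base_def s_add[symmetric])

lemma base_corners:
  assumes "x \<in> space M" "e \<in> {(-1, 0), (0, -1)}"
  shows "base x (-1, -1) = base x e \<or> base x e = base x 0 \<or> base x (-1, -1) = base x 0"
  using bases[OF assms] assms by (simp add: base_def s_0)

lemma base_dmeas: "dmeas M (\<lambda>x. base x n)"
  unfolding base_def by (intro dmeas_comp[of _ _ "(+) n"] dmeas_shift[OF \<nu> s_meas])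

text \<open>The divergence of the rotated field is a circulation around a unit square, which is the
  sum over its two triangles. With \<open>P\<close> a double primitive of \<open>f\<close> along the
  orbit, \<open>glue_triangle\<close> reduces this circulation to \<open>mixed_diff P\<close>, that
  is, to \<open>f\<close>. No bound on the flow is obtained.\<close>

lemma plane_divergence:
  fixes f :: "'a \<Rightarrow> real"
  assumes [measurable]: "f \<in> borel_measurable M"
  obtains u v :: "'a \<Rightarrow> real" where "u \<in> borel_measurable M" "v \<in> borel_measurable M"
    "\<And>x. x \<in> space M \<Longrightarrow> u x - u (s (-1, 0) x) + (v x - v (s (0, -1) x)) = f x"
proof -
  define P where "P x n = prim (\<lambda>k. prim (\<lambda>l. f (s (k, l) x)) (snd n)) (fst n)" for x n
  have Pm [measurable]: "(\<lambda>x. P x n) \<in> borel_measurable M" for n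
    unfolding P_def by measurable
  have md: "mixed_diff (P x) n = f (s n x)" for x n
  proof -
    obtain i j where n: "n = (i, j)" by (cases n)
    have "mixed_diff (P x) n = (prim (\<lambda>k. prim (\<lambda>l. f (s (k, l) x)) j) i - prim (\<lambda>k. prim (\<lambda>l. f (s (k, l) x)) j) (i - 1))
        - (prim (\<lambda>k. prim (\<lambda>l. f (s (k, l) x)) (j - 1)) i - prim (\<lambda>k. prim (\<lambda>l. f (s (k, l) x)) (j - 1)) (i - 1))"
      by (simp add: mixed_diff_def P_def n)
    also have "\<dots> = prim (\<lambda>l. f (s (i, l) x)) j - prim (\<lambda>l. f (s (i, l) x)) (j - 1)"
      by (simp only: prim_step)
    also have "\<dots> = f (s n x)" by (simp only: prim_step n)
    finally show ?thesis .
  qed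
  \<comment> \<open>The value of \<open>glue\<close> on the edge from \<open>e\<close> to 0;
    \<open>w_shift\<close> shows that every point of the orbit, using its own \<open>P\<close>,
    computes the same cochain.\<close>
  define w where "w e x = glue (P x) (base x) e 0" for e x
  have w_shift: "w e (s n x) = glue (P x) (base x) (e + n) n" if x: "x \<in> space M" for e n x
  proof -
    have "glue (P (s n x)) = glue (\<lambda>m. P x (m + n))"
    proof (rule glue_cong_mixed_diff)
      fix m
      have "mixed_diff (\<lambda>m. P x (m + n)) m = mixed_diff (P x) (m + n)"
        by (cases n; cases m) (simp add: mixed_diff_def algebra_simps)
      then show "mixed_diff (P (s n x)) m = mixed_diff (\<lambda>m. P x (m + n)) m"
        using x by (simp add: md s_add)
    qed
    then show ?thesis unfolding w_def base_shift[OF x] by (simp add: glue_shift)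
  qed
  have wm: "w e \<in> borel_measurable M" for e
  proof -
    have d: "dmeas M (\<lambda>x. (base x e, base x 0))"
      by (rule dmeas_comp2[OF base_dmeas base_dmeas])
    have "(\<lambda>x. case (base x e, base x 0) of (p, q) \<Rightarrow>
        area (P x) e 0 + area (P x) 0 q - area (P x) e p - area (P x) p q) \<in> borel_measurable M"
      by (rule borel_measurable_dep[OF d, of "\<lambda>v x. case v of (p, q) \<Rightarrow> _ p q x"])
        (auto simp: area_def split: prod.splits)
    then show ?thesis by (simp add: w_def[abs_def] glue_def)
  qed
  show thesis
  proof (rule that[of "w (0, -1)" "\<lambda>x. - w (-1, 0) x"])
    fix x assume x: "x \<in> space M"
    note tri = glue_triangle[of "base x" "(-1, -1)" _ 0 "P x"]
    have "w (0, -1) x = glue (P x) (base x) (0, -1) 0" "w (-1, 0) x = glue (P x) (base x) (-1, 0) 0"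
      by (simp_all add: w_def)
    moreover have "w (0, -1) (s (-1, 0) x) = glue (P x) (base x) (-1, -1) (-1, 0)"
      "w (-1, 0) (s (0, -1) x) = glue (P x) (base x) (-1, -1) (0, -1)"
      using w_shift[OF x] by simp_all
    moreover have "area (P x) (-1, -1) (0, -1) + area (P x) (0, -1) 0 - area (P x) (-1, -1) (-1, 0)
        - area (P x) (-1, 0) 0 = mixed_diff (P x) 0"
      by (simp add: area_def mixed_diff_def zero_prod_def field_simps)
    ultimately show "w (0, -1) x - w (0, -1) (s (-1, 0) x) + (- w (-1, 0) x - - w (-1, 0) (s (0, -1) x)) = f x"
      using tri[of "(0, -1)"] tri[of "(-1, 0)"] base_corners[OF x] md[of x 0] s_0[OF x] by simp
  qed (use wm in auto)
qed

text \<open>An integral divergence makes the rotated field (\<open>-g\<close> in the first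
  direction, \<open>f\<close> in the second) closed modulo 1, hence a differential modulo 1 of some
  \<open>h\<close>. Then \<open>lift\<close> is a bounded real form with the same values modulo 1
  that is closed on the triangles; removing it leaves integers and does not change the
  divergence.\<close>

lemma plane_rounding:
  fixes f g :: "'a \<Rightarrow> real"
  assumes [measurable]: "f \<in> borel_measurable M" "g \<in> borel_measurable M"
    and div: "\<And>x. x \<in> space M \<Longrightarrow> f x - f (s (-1, 0) x) + (g x - g (s (0, -1) x)) \<in> \<int>"
  obtains u v :: "'a \<Rightarrow> real" where "u \<in> borel_measurable M" "v \<in> borel_measurable M"
    "\<And>x. x \<in> space M \<Longrightarrow> u x \<in> \<int>" "\<And>x. x \<in> space M \<Longrightarrow> v x \<in> \<int>"
    "\<And>x. x \<in> space M \<Longrightarrow> \<bar>u x - f x\<bar> \<le> 2" "\<And>x. x \<in> space M \<Longrightarrow> \<bar>v x - g x\<bar> \<le> 2"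
    "\<And>x. x \<in> space M \<Longrightarrow> u x - u (s (-1, 0) x) + (v x - v (s (0, -1) x))
        = f x - f (s (-1, 0) x) + (g x - g (s (0, -1) x))"
proof -
  \<comment> \<open>Integration up the column through the origin and then along the row: the row
    differences are exactly \<open>-g\<close>, the column differences agree with \<open>f\<close>
    only modulo 1.\<close>
  define h where "h x n = prim (\<lambda>l. f (s (0, l) x)) (snd n) - prim (\<lambda>k. g (s (k, snd n) x)) (fst n)" for x n
  have hm [measurable]: "(\<lambda>x. h x n) \<in> borel_measurable M" for n
    unfolding h_def by measurable
  have hg: "h x (i, j) - h x (i - 1, j) = - g (s (i, j) x)" for x i j
    using prim_step[of "\<lambda>k. g (s (k, j) x)" i] by (simp add: h_def)
  have hf: "h x (i, j) - h x (i, j - 1) - f (s (i, j) x) \<in> \<int>" if x: "x \<in> space M" for x i j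
  proof -
    \<comment> \<open>The column discrepancy. It is 0 at the origin and changes from one column to
      the next by minus a divergence, an integer.\<close>
    define e where "e i = h x (i, j) - h x (i, j - 1) - f (s (i, j) x)" for i
    have "e i - e (i - 1) \<in> \<int>" for i
    proof -
      have "e i - e (i - 1) = - (f (s (i, j) x) - f (s (-1, 0) (s (i, j) x)) + (g (s (i, j) x) - g (s (0, -1) (s (i, j) x))))"
        using hg[of x i j] hg[of x i "j - 1"] x by (simp add: e_def s_add[symmetric])
      also have "\<dots> \<in> \<int>" by (intro Ints_minus div s_space x)
      finally show ?thesis .
    qed
    then have "e i - e 0 \<in> \<int>" by (rule int_const_up_to_Ints)
    moreover have "e 0 = 0" using prim_step[of "\<lambda>l. f (s (0, l) x)" j] by (simp add: e_def h_def)
    ultimately show ?thesis by (simp add: e_def)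
  qed
  define w where "w e x = lift (h x) (base x) 0 e" for e x
  have w_shift: "w e (s n x) = lift (h x) (base x) n (e + n)" if x: "x \<in> space M" for e n x
  proof -
    \<comment> \<open>Potentials built from two origins of the same orbit differ by a constant
      modulo 1.\<close>
    define D where "D m = h (s n x) m - h x (m + n)" for m
    obtain a b where n: "n = (a, b)" by (cases n)
    have Dg: "D (i, j) - D (i - 1, j) = 0" for i j
      using hg[of "s n x" i j] hg[of x "i + a" "j + b"] x
      by (simp add: D_def n s_add[symmetric] algebra_simps)
    have Df: "D (0, j) - D (0, j - 1) \<in> \<int>" for j
    proof -
      have "(h (s n x) (0, j) - h (s n x) (0, j - 1) - f (s (0, j) (s n x)))
          - (h x (a, j + b) - h x (a, j + b - 1) - f (s (a, j + b) x)) \<in> \<int>"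
        by (intro Ints_diff hf s_space x)
      then show ?thesis using x by (simp add: D_def n s_add[symmetric] algebra_simps)
    qed
    have "h (s n x) m - h x (m + n) - D (0, 0) \<in> \<int>" for m
    proof -
      obtain i j where m: "m = (i, j)" by (cases m)
      have "D (i, j) = D (0, j)" using int_const[of "\<lambda>i. D (i, j)" i] Dg by simp
      moreover have "D (0, j) - D (0, 0) \<in> \<int>" using int_const_up_to_Ints[of "\<lambda>j. D (0, j)"] Df by blast
      ultimately show ?thesis by (simp add: D_def m)
    qed
    then have "lift (h (s n x)) = lift (\<lambda>m. h x (m + n))" by (rule lift_cong_Ints)
    then show ?thesis unfolding w_def base_shift[OF x] by (simp add: lift_shift)
  qed
  have wm [measurable]: "w e \<in> borel_measurable M" for e
  proof -
    have d: "dmeas M (\<lambda>x. (base x 0, base x e))"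
      by (rule dmeas_comp2[OF base_dmeas base_dmeas])
    have "(\<lambda>x. frac (F x)) \<in> borel_measurable M" if [measurable]: "F \<in> borel_measurable M" for F :: "'a \<Rightarrow> real"
      unfolding frac_def by measurable
    then have fr: "(\<lambda>x. frac (h x p - h x q)) \<in> borel_measurable M" for p q by measurable
    have jm: "(\<lambda>x. jump (h x) p q) \<in> borel_measurable M" for p q
      unfolding jump_def by (cases "lexle p q") (auto intro: fr)
    have "(\<lambda>x. case (base x 0, base x e) of (p, q) \<Rightarrow>
        frac (h x 0 - h x p) + jump (h x) p q - frac (h x e - h x q)) \<in> borel_measurable M"
      by (rule borel_measurable_dep[OF d, of "\<lambda>v x. case v of (p, q) \<Rightarrow> _ p q x"])
        (auto split: prod.splits intro!: borel_measurable_add borel_measurable_diff jm fr)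
    then show ?thesis by (simp add: w_def[abs_def] lift_def)
  qed
  show thesis
  proof (rule that[of "\<lambda>x. f x - w (0, -1) x" "\<lambda>x. g x + w (-1, 0) x"])
    fix x assume x: "x \<in> space M"
    have "h x 0 - h x (0, -1) - w (0, -1) x \<in> \<int>" by (simp add: w_def lift_Ints)
    moreover have "h x 0 - h x (0, -1) - f x \<in> \<int>"
      using hf[OF x, of 0 0] s_0[OF x] by (simp add: zero_prod_def)
    ultimately have "(h x 0 - h x (0, -1) - w (0, -1) x) - (h x 0 - h x (0, -1) - f x) \<in> \<int>"
      by (rule Ints_diff)
    then show "f x - w (0, -1) x \<in> \<int>" by simp
    have "- (h x 0 - h x (-1, 0) - w (-1, 0) x) \<in> \<int>"
      unfolding w_def by (rule Ints_minus[OF lift_Ints])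
    moreover have "- (h x 0 - h x (-1, 0) - w (-1, 0) x) = g x + w (-1, 0) x"
      using hg[of x 0 0] s_0[OF x] by (simp add: zero_prod_def)
    ultimately show "g x + w (-1, 0) x \<in> \<int>" by (simp only:)
    show "\<bar>f x - w (0, -1) x - f x\<bar> \<le> 2" "\<bar>g x + w (-1, 0) x - g x\<bar> \<le> 2"
      using lift_bound by (simp_all add: w_def)
    have tri: "lift (h x) (base x) 0 e + lift (h x) (base x) e (-1, -1) = lift (h x) (base x) 0 (-1, -1)"
      if "e \<in> {(-1, 0), (0, -1)}" for e
      by (rule lift_triangle) (use base_corners[OF x that] in argo)
    have "w (0, -1) (s (-1, 0) x) = lift (h x) (base x) (-1, 0) (-1, -1)"
      "w (-1, 0) (s (0, -1) x) = lift (h x) (base x) (0, -1) (-1, -1)"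
      using w_shift[OF x] by simp_all
    moreover have "w (0, -1) x = lift (h x) (base x) 0 (0, -1)" "w (-1, 0) x = lift (h x) (base x) 0 (-1, 0)"
      by (simp_all add: w_def)
    ultimately show "f x - w (0, -1) x - (f (s (-1, 0) x) - w (0, -1) (s (-1, 0) x))
        + (g x + w (-1, 0) x - (g (s (0, -1) x) + w (-1, 0) (s (0, -1) x)))
        = f x - f (s (-1, 0) x) + (g x - g (s (0, -1) x))"
      using tri[of "(0, -1)"] tri[of "(-1, 0)"] by simp
  qed auto
qed

end

section \<open>The action on the torus and integral flows\<close>

lemma tproj_nth [simp]: "tproj x $ j = frac (x $ j)"
  by (simp add: tproj_def)

lemma tproj_torus: "tproj x \<in> torus"
  by (simp add: torus_def frac_lt_1)

lemma tproj_id: "x \<in> torus \<Longrightarrow> tproj x = x"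
  by (simp add: vec_eq_iff torus_def frac_eq)

lemma tproj_cong: "(\<And>j. x $ j - y $ j \<in> \<int>) \<Longrightarrow> tproj x = tproj y"
  by (simp add: vec_eq_iff frac_cong_Ints)

lemma tproj_tproj_add: "tproj (tproj x + y) = tproj (x + y)"
proof (rule tproj_cong)
  fix j
  have "- (x $ j - frac (x $ j)) \<in> \<int>" by (rule Ints_minus[OF minus_frac_Ints])
  then show "(tproj x + y) $ j - (x + y) $ j \<in> \<int>" by simp
qed

lemma tproj_add_tproj: "tproj (x + tproj y) = tproj (x + y)"
  using tproj_tproj_add[of y x] by (simp add: add.commute)

definition unit :: "nat \<Rightarrow> nat \<Rightarrow> int" where "unit j = (\<lambda>i. if i = j then 1 else 0)"

definition plane :: "int \<times> int \<Rightarrow> nat \<Rightarrow> int" where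
  "plane p = (\<lambda>i. if i = 0 then fst p else if i = 1 then snd p else 0)"

definition supnorm :: "int \<times> int \<Rightarrow> int" where "supnorm n = max \<bar>fst n\<bar> \<bar>snd n\<bar>"

lemma plane_add: "plane (p + q) = plane p + plane q"
  by (auto simp: plane_def plus_fun_def)

lemma plane_0 [simp]: "plane 0 = 0"
  by (auto simp: plane_def zero_fun_def)

lemma plane_inj: "plane p = plane q \<Longrightarrow> p = q"
  by (auto simp: plane_def prod_eq_iff fun_eq_iff split: if_splits)

lemma plane_units: "plane (-1, 0) = - unit 0" "plane (0, -1) = - unit 1"
  by (auto simp: plane_def unit_def fun_eq_iff)

lemma lattice_0 [simp]: "0 \<in> lattice d"
  and lattice_add: "m \<in> lattice d \<Longrightarrow> n \<in> lattice d \<Longrightarrow> m + n \<in> lattice d"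
  and lattice_diff: "m \<in> lattice d \<Longrightarrow> n \<in> lattice d \<Longrightarrow> m - n \<in> lattice d"
  and lattice_minus: "n \<in> lattice d \<Longrightarrow> - n \<in> lattice d"
  and lattice_unit: "j < d \<Longrightarrow> unit j \<in> lattice d"
  by (auto simp: lattice_def unit_def)

text \<open>An interval of radius \<open>r\<close> contains \<open>2 * r + 1\<close> integers, so
  three adjacent ones reach as far as \<open>3 * r + 1\<close>. Two coordinates then give the
  \<open>9\<close> of \<open>supnorm_doubling\<close>.\<close>

lemma supnorm_cover_1d:
  fixes a r :: int
  assumes "\<bar>a\<bar> \<le> 3 * r" obtains u :: nat where "u < 3" "\<bar>a - (int u - 1) * (2 * r + 1)\<bar> \<le> r"
proof -
  consider "a < - r" | "\<bar>a\<bar> \<le> r" | "a > r" by linarith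
  then show thesis
    by cases (use assms that[of 0] that[of 1] that[of 2] in auto)
qed

lemma supnorm_doubling:
  assumes "0 \<le> r"
  shows "\<exists>t :: nat \<Rightarrow> int \<times> int. \<forall>n. supnorm n \<le> 3 * r \<longrightarrow> (\<exists>w<9. supnorm (n - t w) \<le> r)"
proof (intro exI[of _ "\<lambda>w. ((int (w mod 3) - 1) * (2 * r + 1), (int (w div 3) - 1) * (2 * r + 1))"] allI impI)
  fix n :: "int \<times> int" assume n: "supnorm n \<le> 3 * r"
  obtain u where u: "u < 3" "\<bar>fst n - (int u - 1) * (2 * r + 1)\<bar> \<le> r"
    using supnorm_cover_1d[of "fst n" r] n by (auto simp: supnorm_def)
  obtain v where v: "v < 3" "\<bar>snd n - (int v - 1) * (2 * r + 1)\<bar> \<le> r"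
    using supnorm_cover_1d[of "snd n" r] n by (auto simp: supnorm_def)
  have "(3 * v + u) mod 3 = u" "(3 * v + u) div 3 = v" using u by auto
  then show "\<exists>w<9. supnorm (n - ((int (w mod 3) - 1) * (2 * r + 1), (int (w div 3) - 1) * (2 * r + 1))) \<le> r"
    using u v by (intro exI[of _ "3 * v + u"]) (auto simp: supnorm_def)
qed

text \<open>Of \<open>M\<close> only the sigma-algebra is used. The half-spaces make the coordinates
  measurable, from which all colourings are built.\<close>

locale torus_action =
  fixes M :: "(real^'k) measure" and N :: "(real^'k) set set" and xs :: "(real^'k) list" and d :: nat
  assumes space_M: "space M = torus"
    and len: "length xs = d" and d2: "2 \<le> d" and free_xs: "free_vecs xs"
    and translate_meas: "(\<lambda>x. tadd x v) \<in> measurable M M"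
    and halfspace: "{x \<in> torus. x $ j < c} \<in> sets M"
    and N_sets: "A \<in> N \<Longrightarrow> A \<in> sets M"
    and N_sub: "A \<in> N \<Longrightarrow> B \<subseteq> A \<Longrightarrow> B \<in> N"
    and N_UN: "(\<And>i::nat. H i \<in> N) \<Longrightarrow> (\<Union>i. H i) \<in> N"
    and N_translate: "A \<in> N \<Longrightarrow> {x \<in> torus. tadd x v \<in> A} \<in> N"
    and choice: "(\<And>i w. C i w \<in> sets M) \<Longrightarrow> (\<And>i::nat. space M \<subseteq> (\<Union>w<9. C i w)) \<Longrightarrow>
      \<exists>g :: nat \<Rightarrow> nat. (\<forall>i. g i < 9) \<and> {x \<in> space M. \<exists>m. \<forall>i\<ge>m. x \<notin> C i (g i)} \<in> N"
begin

definition lin :: "(nat \<Rightarrow> int) \<Rightarrow> real^'k" where "lin n = (\<Sum>i<d. of_int (n i) *\<^sub>R (xs ! i))"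

definition act :: "(nat \<Rightarrow> int) \<Rightarrow> real^'k \<Rightarrow> real^'k" where "act n x = tadd x (tcomb xs n)"

lemma act_lin: "act n x = tproj (x + lin n)"
  by (simp add: act_def tadd_def tcomb_def len lin_def tproj_add_tproj)

lemma lin_add: "lin (m + n) = lin m + lin n"
  by (simp add: lin_def sum.distrib[symmetric] scaleR_left_distrib)

lemma lin_0 [simp]: "lin 0 = 0"
  by (simp add: lin_def)

lemma act_torus [simp]: "act n x \<in> torus"
  by (simp add: act_lin tproj_torus)

lemma act_0: "x \<in> torus \<Longrightarrow> act 0 x = x"
  by (simp add: act_lin tproj_id)

lemma act_add: "act (m + n) x = act m (act n x)"
  by (simp add: act_lin tproj_tproj_add lin_add) (simp add: ac_simps)

lemma act_meas [measurable]: "act n \<in> measurable M M"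
  unfolding act_def[abs_def] by (rule translate_meas)

lemma nonzero_coordinate:
  assumes "n \<in> lattice d" "n \<noteq> 0" obtains j where "frac (lin n $ j) \<noteq> 0"
proof -
  have "tcomb xs n \<noteq> 0"
  proof
    assume "tcomb xs n = 0"
    then have "\<forall>i<d. n i = 0" using free_xs len by (auto simp: free_vecs_def)
    then have "n i = 0" for i using assms(1) by (cases "i < d") (auto simp: lattice_def)
    then show False using assms(2) by (auto simp: fun_eq_iff)
  qed
  then have "\<exists>j. frac (lin n $ j) \<noteq> 0" by (simp add: vec_eq_iff tcomb_def len lin_def)
  then show thesis using that by blast
qed

text \<open>Some coordinate is rotated by a nonzero \<tau> modulo 1, and on the interval from 0 to 1
  such a rotation moves every number by \<tau> or by 1 - \<tau>. The displacement is thus bounded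
  below uniformly in \<open>x\<close>.\<close>

lemma act_displacement:
  assumes "n \<in> lattice d" "n \<noteq> 0"
  obtains \<epsilon> j where "0 < \<epsilon>" "\<And>x. x \<in> torus \<Longrightarrow> \<bar>act n x $ j - x $ j\<bar> \<ge> \<epsilon>"
proof -
  obtain j where j: "frac (lin n $ j) \<noteq> 0" using nonzero_coordinate[OF assms] by blast
  define \<tau> where "\<tau> = frac (lin n $ j)"
  have \<tau>: "0 < \<tau>" "\<tau> < 1" using j frac_ge_0[of "lin n $ j"] by (auto simp: \<tau>_def frac_lt_1)
  show thesis
  proof (rule that[of "min \<tau> (1 - \<tau>)" j])
    fix x :: "real^'k" assume "x \<in> torus"
    then have x: "0 \<le> x $ j" "x $ j < 1" by (auto simp: torus_def)
    have "act n x $ j = frac (x $ j + \<tau>)"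
      unfolding act_lin tproj_nth \<tau>_def
      by (rule frac_cong_Ints) (simp add: minus_frac_Ints)
    also have "\<dots> = (if x $ j + \<tau> < 1 then x $ j + \<tau> else x $ j + \<tau> - 1)"
      using x \<tau> frac_cong_Ints[of "x $ j + \<tau>" "x $ j + \<tau> - 1"]
      by (auto simp: frac_eq)
    finally show "min \<tau> (1 - \<tau>) \<le> \<bar>act n x $ j - x $ j\<bar>" using \<tau> by auto
  qed (use \<tau> in auto)
qed

lemma act_free: assumes "x \<in> torus" "m \<in> lattice d" "n \<in> lattice d" "act m x = act n x" shows "m = n"
proof (rule ccontr)
  assume "m \<noteq> n"
  then obtain \<epsilon> j where "0 < \<epsilon>" and e: "\<And>x. x \<in> torus \<Longrightarrow> \<bar>act (m - n) x $ j - x $ j\<bar> \<ge> \<epsilon>"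
    using act_displacement[of "m - n"] lattice_diff assms(2,3) by (metis right_minus_eq)
  moreover have "act (m - n) (act n x) = act n x" using assms act_add[of "m - n" n x] by simp
  ultimately show False using e[of "act n x"] by simp
qed

lemma coordinate_measurable: "(\<lambda>x. x $ j) \<in> borel_measurable M"
  by (auto simp: borel_measurable_iff_less space_M halfspace)

text \<open>Colour by the cells of a grid whose mesh is smaller than every displacement caused by
  \<open>F\<close>; no element of \<open>F\<close> can keep a point in its cell.\<close>

lemma colour:
  assumes F: "finite F" "F \<subseteq> lattice d" "0 \<notin> F"
  obtains q and k :: nat where "dmeas M q" "\<And>x. x \<in> torus \<Longrightarrow> q x < k"
    "\<And>x n. x \<in> torus \<Longrightarrow> n \<in> F \<Longrightarrow> q (act n x) \<noteq> q x"
proof -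
  have "\<forall>n\<in>F. \<exists>\<epsilon> j. 0 < \<epsilon> \<and> (\<forall>x\<in>torus. \<bar>act n x $ j - x $ j\<bar> \<ge> \<epsilon>)"
    using act_displacement F by (metis subsetD)
  then obtain eps jj where e: "\<And>n. n \<in> F \<Longrightarrow> 0 < eps n"
    "\<And>n x. n \<in> F \<Longrightarrow> x \<in> torus \<Longrightarrow> \<bar>act n x $ jj n - x $ jj n\<bar> \<ge> eps n"
    by metis
  define \<epsilon> where "\<epsilon> = Min (insert 1 (eps ` F))"
  have \<epsilon>: "0 < \<epsilon>" "\<And>n. n \<in> F \<Longrightarrow> \<epsilon> \<le> eps n" using F e by (auto simp: \<epsilon>_def)
  obtain K' where K': "inverse (real (Suc K')) < \<epsilon>" using reals_Archimedean[OF \<epsilon>(1)] by blast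
  define K where "K = real (Suc K')"
  have K: "0 < K" "1 < \<epsilon> * K" using K' by (auto simp: K_def field_simps)
  define q where "q x = (\<lambda>j. \<lfloor>K * x $ j\<rfloor>)" for x :: "real^'k"
  define W where "W = (UNIV \<rightarrow>\<^sub>E {0..int (Suc K')} :: ('k \<Rightarrow> int) set)"
  have W: "finite W" unfolding W_def by (rule finite_PiE) auto
  have qW: "q x \<in> W" if "x \<in> torus" for x
  proof -
    have "0 \<le> K * x $ j" "K * x $ j \<le> K" for j
      using that K by (auto simp: torus_def mult_left_le less_imp_le)
    then have "0 \<le> \<lfloor>K * x $ j\<rfloor>" "\<lfloor>K * x $ j\<rfloor> \<le> \<lfloor>K\<rfloor>" for j by (auto intro: floor_mono)
    then show ?thesis by (auto simp: W_def q_def K_def)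
  qed
  have qm: "dmeas M q"
    unfolding dmeas_def
  proof (intro conjI allI)
    show "countable (q ` space M)"
      using W qW by (auto simp: space_M intro!: countable_finite finite_subset[of _ W])
    fix v
    have "dmeas M (\<lambda>x. \<lfloor>K * x $ j\<rfloor> = v j)" for j
      using coordinate_measurable by (intro dmeas_comp[of _ _ "\<lambda>z. z = v j"] dmeas_floor) measurable
    then have "dmeas M (\<lambda>x. \<forall>j\<in>UNIV. \<lfloor>K * x $ j\<rfloor> = v j)"
      by (intro dmeas_all countable_finite) auto
    from dmeas_pred[OF this] show "{x \<in> space M. q x = v} \<in> sets M" by (simp add: q_def fun_eq_iff)
  qed
  obtain h :: "('k \<Rightarrow> int) \<Rightarrow> nat" and k where h: "h ` W = {i. i < k}" "inj_on h W"
    using finite_imp_inj_to_nat_seg[OF W] by blast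
  show thesis
  proof (rule that[of "\<lambda>x. h (q x)" k])
    show "dmeas M (\<lambda>x. h (q x))" by (rule dmeas_comp[OF qm])
    fix x :: "real^'k" assume x: "x \<in> torus"
    show "h (q x) < k" using h(1) qW[OF x] by blast
    fix n assume n: "n \<in> F"
    have "q (act n x) \<noteq> q x"
    proof
      assume "q (act n x) = q x"
      then have "\<lfloor>K * act n x $ jj n\<rfloor> = \<lfloor>K * x $ jj n\<rfloor>" by (auto simp: q_def fun_eq_iff)
      then have "\<bar>K * act n x $ jj n - K * x $ jj n\<bar> < 1" by linarith
      then have "\<bar>act n x $ jj n - x $ jj n\<bar> * K < 1"
        using K by (simp add: right_diff_distrib[symmetric] abs_mult mult.commute)
      moreover have "\<epsilon> \<le> \<bar>act n x $ jj n - x $ jj n\<bar>" using e(2)[OF n x] \<epsilon>(2)[OF n] by linarith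
      then have "\<epsilon> * K \<le> \<bar>act n x $ jj n - x $ jj n\<bar> * K" using K by (intro mult_right_mono) auto
      ultimately show False using K by linarith
    qed
    then show "h (q (act n x)) \<noteq> h (q x)" using h(2) qW[OF x] qW[of "act n x"] by (auto dest: inj_onD)
  qed
qed

lemma plane_lattice: "plane p \<in> lattice d"
  using d2 by (auto simp: plane_def lattice_def)

sublocale planar: normed_action M N "\<lambda>p. act (plane p)" supnorm lexle
proof
  show "finite {n. supnorm n \<le> r}" for r
    by (rule finite_subset[of _ "{-r..r} \<times> {-r..r}"]) (auto simp: supnorm_def)
  show "\<exists>q (k::nat). dmeas M q \<and> (\<forall>x\<in>space M. q x < k) \<and>
      (\<forall>x\<in>space M. \<forall>n\<in>F. q (act (plane n) x) \<noteq> q x)"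
    if F: "finite F" "0 \<notin> F" for F :: "(int \<times> int) set"
  proof -
    have "0 \<notin> plane ` F" using F plane_inj[of _ 0] plane_0 by (metis imageE)
    moreover have "finite (plane ` F)" "plane ` F \<subseteq> lattice d" using F plane_lattice by auto
    ultimately obtain q and k :: nat where "dmeas M q" "\<And>x. x \<in> torus \<Longrightarrow> q x < k"
      "\<And>x n. x \<in> torus \<Longrightarrow> n \<in> plane ` F \<Longrightarrow> q (act n x) \<noteq> q x"
      using colour by metis
    then show ?thesis by (intro exI[of _ q] exI[of _ k]) (auto simp: space_M)
  qed
  show "{x \<in> space M. act (plane n) x \<in> A} \<in> N" if "A \<in> N" for A n
    using N_translate[OF that, of "tcomb xs (plane n)"] by (simp add: act_def space_M)
next
  fix C :: "nat \<Rightarrow> nat \<Rightarrow> (real^'k) set"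
  assume "\<And>i w. C i w \<in> sets M" "\<And>i. space M \<subseteq> (\<Union>w<9. C i w)"
  then show "\<exists>g. (\<forall>i. g i < 9) \<and> {x \<in> space M. \<exists>m. \<forall>i\<ge>m. x \<notin> C i (g i)} \<in> N" by (rule choice)
next
  show "\<And>H. (\<And>i::nat. H i \<in> N) \<Longrightarrow> (\<Union>i. H i) \<in> N" by (rule N_UN)
  show "\<And>A B. A \<in> N \<Longrightarrow> B \<subseteq> A \<Longrightarrow> B \<in> N" by (rule N_sub)
  show "\<And>A. A \<in> N \<Longrightarrow> A \<in> sets M" by (rule N_sets)
  show "\<And>r. 0 \<le> r \<Longrightarrow> \<exists>t::nat \<Rightarrow> _. \<forall>n. supnorm n \<le> 3 * r \<longrightarrow> (\<exists>w<9. supnorm (n - t w) \<le> r)"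
    by (rule supnorm_doubling)
qed (auto simp: supnorm_def lexle_def prod_eq_iff plane_add act_add act_0 space_M)

text \<open>Each \<phi> \<open>j\<close> is a planar divergence of functions \<open>u j\<close>,
  \<open>v j\<close> that come with no bound, so only their fractional parts are subtracted: what
  remains is a divergence of integers. The subtracted part is rerouted through the first two
  directions, keeping the total divergence because the translations commute.\<close>

lemma integral_flow:
  fixes \<phi> :: "nat \<Rightarrow> real^'k \<Rightarrow> real"
  assumes meas: "\<And>j. j < d \<Longrightarrow> \<phi> j \<in> borel_measurable M"
    and div: "\<And>x. x \<in> torus \<Longrightarrow> (\<Sum>j<d. \<phi> j x - \<phi> j (act (- unit j) x)) \<in> \<int>"
  obtains \<psi> :: "nat \<Rightarrow> real^'k \<Rightarrow> int" where "\<And>j. j < d \<Longrightarrow> dmeas M (\<psi> j)"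
    "\<And>j x. j < d \<Longrightarrow> x \<in> torus \<Longrightarrow> \<bar>of_int (\<psi> j x) - \<phi> j x\<bar> \<le> 2 + d"
    "\<And>x. x \<in> torus \<Longrightarrow> of_int (\<Sum>j<d. \<psi> j x - \<psi> j (act (- unit j) x))
        = (\<Sum>j<d. \<phi> j x - \<phi> j (act (- unit j) x))"
proof -
  let ?a = "act (- unit 0)" and ?b = "act (- unit 1)" and ?e = "\<lambda>j. act (- unit j)"
  obtain \<nu> where \<nu>: "dmeas M \<nu>"
    "\<And>x a b c. x \<in> space M \<Longrightarrow> supnorm (a - b) \<le> 1 \<Longrightarrow> supnorm (b - c) \<le> 1 \<Longrightarrow> supnorm (a - c) \<le> 1 \<Longrightarrow>
      a + \<nu> (act (plane a) x) = b + \<nu> (act (plane b) x) \<or> b + \<nu> (act (plane b) x) = c + \<nu> (act (plane c) x)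
      \<or> a + \<nu> (act (plane a) x) = c + \<nu> (act (plane c) x)"
    using planar.base_offsets by metis
  interpret pa: plane_action M "\<lambda>p. act (plane p)" \<nu>
  proof
    fix x e assume "x \<in> space M" "e \<in> {(-1::int, 0::int), (0, -1)}"
    then show "(-1, -1) + \<nu> (act (plane (-1, -1)) x) = e + \<nu> (act (plane e) x) \<or>
        e + \<nu> (act (plane e) x) = \<nu> x \<or> (-1, -1) + \<nu> (act (plane (-1, -1)) x) = \<nu> x"
      using \<nu>(2)[of x "(-1, -1)" e 0] by (auto simp: supnorm_def space_M act_0)
  qed (use \<nu>(1) in \<open>auto simp: plane_add act_add act_0 space_M\<close>)
  have "\<exists>u v. u \<in> borel_measurable M \<and> v \<in> borel_measurable M \<and>
      (\<forall>x\<in>torus. u x - u (?a x) + (v x - v (?b x)) = \<phi> j x)" if "j < d" for j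
    using pa.plane_divergence[OF meas[OF that]] unfolding plane_units space_M by metis
  then obtain u v where u [measurable]: "\<And>j. j < d \<Longrightarrow> u j \<in> borel_measurable M"
    and v [measurable]: "\<And>j. j < d \<Longrightarrow> v j \<in> borel_measurable M"
    and uv: "\<And>j x. j < d \<Longrightarrow> x \<in> torus \<Longrightarrow> u j x - u j (?a x) + (v j x - v j (?b x)) = \<phi> j x"
    by metis
  define p q where "p j x = frac (u j x)" and "q j x = frac (v j x)" for j x
  have pm [measurable]: "p j \<in> borel_measurable M" and qm [measurable]: "q j \<in> borel_measurable M" if "j < d" for j
    using u[OF that] v[OF that] unfolding p_def[abs_def] q_def[abs_def] frac_def by measurable
  define \<theta> where "\<theta> j x = \<phi> j x - (p j x - p j (?a x) + (q j x - q j (?b x)))" for j x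
  have \<theta>_Ints: "\<theta> j x \<in> \<int>" if "j < d" "x \<in> torus" for j x
  proof -
    have "(u j x - p j x) - (u j (?a x) - p j (?a x)) + ((v j x - q j x) - (v j (?b x) - q j (?b x))) \<in> \<int>"
      unfolding p_def q_def by (intro Ints_add Ints_diff minus_frac_Ints)
    moreover have "(u j x - p j x) - (u j (?a x) - p j (?a x)) + ((v j x - q j x) - (v j (?b x) - q j (?b x))) = \<theta> j x"
      using uv[OF that] unfolding \<theta>_def by linarith
    ultimately show ?thesis by (simp only:)
  qed
  \<comment> \<open>The rerouted flow: each direction \<open>j\<close> contributes the difference of
    \<open>p j\<close> or \<open>q j\<close> along \<open>j\<close>, which is at most 1 in size.
    With the error 2 of \<open>plane_rounding\<close> this accounts for the bound
    \<open>2 + d\<close>.\<close>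
  define F where "F x = \<phi> 0 x + (\<Sum>j\<in>{2..<d}. p j x - p j (?e j x))" for x
  define G where "G x = \<phi> 1 x + (\<Sum>j\<in>{2..<d}. q j x - q j (?e j x))" for x
  have split: "(\<Sum>j<d. t j) = t 0 + t 1 + (\<Sum>j\<in>{2..<d}. t j)" for t :: "nat \<Rightarrow> 'c::comm_monoid_add"
  proof -
    have "{..<d} = insert 0 (insert 1 {2..<d})" using d2 by auto
    then show ?thesis by (simp add: add.assoc)
  qed
  have comm: "act m (act n x) = act n (act m x)" for m n x
    using act_add[of m n x] act_add[of n m x] by (simp add: add.commute)
  \<comment> \<open>A mixed difference of \<open>p j\<close> in the directions \<open>0\<close> and
    \<open>j\<close> is added once through \<open>F\<close> and removed once through \<theta>
    \<open>j\<close>; likewise for \<open>q j\<close> and \<open>G\<close>.\<close>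
  have total: "F x - F (?a x) + (G x - G (?b x)) + (\<Sum>j\<in>{2..<d}. \<theta> j x - \<theta> j (?e j x))
      = (\<Sum>j<d. \<phi> j x - \<phi> j (?e j x))" for x
  proof -
    have "(\<Sum>j\<in>{2..<d}. (p j x - p j (?e j x)) - (p j (?a x) - p j (?e j (?a x)))
          + ((q j x - q j (?e j x)) - (q j (?b x) - q j (?e j (?b x)))) + (\<theta> j x - \<theta> j (?e j x)))
        = (\<Sum>j\<in>{2..<d}. \<phi> j x - \<phi> j (?e j x))"
    proof (rule sum.cong)
      fix j assume "j \<in> {2..<d}"
      have "?a (?e j x) = ?e j (?a x)" "?b (?e j x) = ?e j (?b x)" by (rule comm)+
      then have "\<theta> j (?e j x) = \<phi> j (?e j x) - (p j (?e j x) - p j (?e j (?a x)) + (q j (?e j x) - q j (?e j (?b x))))"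
        unfolding \<theta>_def by (simp only:)
      then show "(p j x - p j (?e j x)) - (p j (?a x) - p j (?e j (?a x)))
          + ((q j x - q j (?e j x)) - (q j (?b x) - q j (?e j (?b x)))) + (\<theta> j x - \<theta> j (?e j x))
          = \<phi> j x - \<phi> j (?e j x)"
        using \<theta>_def[of j x] by linarith
    qed simp
    then show ?thesis unfolding split F_def G_def by (simp add: sum.distrib sum_subtractf)
  qed
  have \<theta>sum: "(\<Sum>j\<in>{2..<d}. \<theta> j x - \<theta> j (?e j x)) \<in> \<int>" if "x \<in> torus" for x
    using that by (intro Ints_sum Ints_diff \<theta>_Ints) auto
  have Fm: "F \<in> borel_measurable M" and Gm: "G \<in> borel_measurable M"
    unfolding F_def[abs_def] G_def[abs_def]
    by (intro borel_measurable_add borel_measurable_sum borel_measurable_diff meas pm qm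
        measurable_compose[OF act_meas]; use d2 in simp)+
  have FG: "F x - F (?a x) + (G x - G (?b x)) \<in> \<int>" if x: "x \<in> torus" for x
  proof -
    have "F x - F (?a x) + (G x - G (?b x))
        = (\<Sum>j<d. \<phi> j x - \<phi> j (?e j x)) - (\<Sum>j\<in>{2..<d}. \<theta> j x - \<theta> j (?e j x))"
      using total[of x] by simp
    then show ?thesis by (simp only: Ints_diff[OF div[OF x] \<theta>sum[OF x]])
  qed
  obtain U V where UV: "U \<in> borel_measurable M" "V \<in> borel_measurable M"
    "\<And>x. x \<in> torus \<Longrightarrow> U x \<in> \<int>" "\<And>x. x \<in> torus \<Longrightarrow> V x \<in> \<int>"
    "\<And>x. x \<in> torus \<Longrightarrow> \<bar>U x - F x\<bar> \<le> 2" "\<And>x. x \<in> torus \<Longrightarrow> \<bar>V x - G x\<bar> \<le> 2"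
    "\<And>x. x \<in> torus \<Longrightarrow> U x - U (?a x) + (V x - V (?b x)) = F x - F (?a x) + (G x - G (?b x))"
    using pa.plane_rounding[OF Fm Gm, unfolded plane_units space_M, OF FG] by blast
  have frac_diff: "\<bar>frac a - frac b\<bar> \<le> 1" for a b :: real
    using frac_lt_1[of a] frac_lt_1[of b] frac_ge_0[of a] frac_ge_0[of b] by linarith
  have near: "\<bar>\<Sum>j\<in>{2..<d}. p j x - p j (?e j x)\<bar> \<le> d" "\<bar>\<Sum>j\<in>{2..<d}. q j x - q j (?e j x)\<bar> \<le> d" for x
  proof -
    have "\<bar>\<Sum>j\<in>{2..<d}. t j\<bar> \<le> d" if "\<And>j. \<bar>t j\<bar> \<le> 1" for t :: "nat \<Rightarrow> real"
    proof -
      have "(\<Sum>j\<in>{2..<d}. \<bar>t j\<bar>) \<le> real (card {2..<d}) * 1" by (rule sum_bounded_above) (rule that)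
      moreover have "real (card {2..<d}) \<le> d" by simp
      ultimately show ?thesis using sum_abs[of t "{2..<d}"] by linarith
    qed
    note bound = this
    show "\<bar>\<Sum>j\<in>{2..<d}. p j x - p j (?e j x)\<bar> \<le> d" unfolding p_def by (rule bound) (rule frac_diff)
    show "\<bar>\<Sum>j\<in>{2..<d}. q j x - q j (?e j x)\<bar> \<le> d" unfolding q_def by (rule bound) (rule frac_diff)
  qed
  define R where "R j = (if j = 0 then U else if j = 1 then V else \<theta> j)" for j
  have R_Ints: "R j x \<in> \<int>" if "j < d" "x \<in> torus" for j x
    using UV(3)[OF that(2)] UV(4)[OF that(2)] \<theta>_Ints[OF that] by (auto simp: R_def)
  show thesis
  proof (rule that[of "\<lambda>j x. \<lfloor>R j x\<rfloor>"])
    fix j assume j: "j < d"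
    have "R j \<in> borel_measurable M"
    proof -
      have "\<theta> j \<in> borel_measurable M"
        unfolding \<theta>_def[abs_def]
        by (intro borel_measurable_add borel_measurable_diff meas pm qm measurable_compose[OF act_meas] j)
      then show ?thesis using UV(1,2) by (simp add: R_def)
    qed
    then show "dmeas M (\<lambda>x. \<lfloor>R j x\<rfloor>)" by (rule dmeas_floor)
    fix x :: "real^'k" assume x: "x \<in> torus"
    have "\<bar>R j x - \<phi> j x\<bar> \<le> 2 + d"
    proof -
      have "\<bar>\<theta> j x - \<phi> j x\<bar> \<le> 2"
        using frac_diff[of "u j x" "u j (?a x)"] frac_diff[of "v j x" "v j (?b x)"]
        unfolding \<theta>_def p_def q_def by linarith
      moreover have "\<bar>U x - \<phi> 0 x\<bar> \<le> 2 + d" "\<bar>V x - \<phi> 1 x\<bar> \<le> 2 + d"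
        using UV(5,6)[OF x] near[of x] unfolding F_def G_def by linarith+
      ultimately show ?thesis by (auto simp: R_def)
    qed
    then show "\<bar>of_int \<lfloor>R j x\<rfloor> - \<phi> j x\<bar> \<le> 2 + d" using R_Ints[OF j x] by simp
  next
    fix x :: "real^'k" assume x: "x \<in> torus"
    have "of_int (\<Sum>j<d. \<lfloor>R j x\<rfloor> - \<lfloor>R j (?e j x)\<rfloor>) = (\<Sum>j<d. R j x - R j (?e j x))"
      using R_Ints x by (auto intro!: sum.cong)
    also have "\<dots> = U x - U (?a x) + (V x - V (?b x)) + (\<Sum>j\<in>{2..<d}. \<theta> j x - \<theta> j (?e j x))"
      unfolding split by (auto simp: R_def intro!: sum.cong)
    also have "\<dots> = (\<Sum>j<d. \<phi> j x - \<phi> j (?e j x))" using UV(7)[OF x] total[of x] by simp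
    finally show "of_int (\<Sum>j<d. \<lfloor>R j x\<rfloor> - \<lfloor>R j (?e j x)\<rfloor>) = (\<Sum>j<d. \<phi> j x - \<phi> j (?e j x))" .
  qed
qed

end

section \<open>A bounded real flow\<close>

definition lbox :: "nat \<Rightarrow> (nat \<Rightarrow> int set) \<Rightarrow> (nat \<Rightarrow> int) set" where
  "lbox d S = {n \<in> lattice d. \<forall>i<d. n i \<in> S i}"

lemma lbox_bij: "bij_betw (\<lambda>f i. if i < d then f i else 0) (PiE {..<d} S) (lbox d S)"
proof (rule bij_betw_byWitness[where f' = "\<lambda>n. restrict n {..<d}"])
  show "\<forall>f\<in>PiE {..<d} S. restrict (\<lambda>i. if i < d then f i else 0) {..<d} = f"
    by (auto simp: fun_eq_iff PiE_def extensional_def restrict_def)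
  show "\<forall>n\<in>lbox d S. (\<lambda>i. if i < d then restrict n {..<d} i else 0) = n"
    by (auto simp: lbox_def lattice_def fun_eq_iff)
  show "(\<lambda>f i. if i < d then f i else 0) ` PiE {..<d} S \<subseteq> lbox d S"
    by (auto simp: lbox_def lattice_def PiE_def Pi_def)
  show "(\<lambda>n. restrict n {..<d}) ` lbox d S \<subseteq> PiE {..<d} S"
    by (auto simp: lbox_def split: if_splits)
qed

lemma finite_lbox: "(\<And>i. i < d \<Longrightarrow> finite (S i)) \<Longrightarrow> finite (lbox d S)"
  using bij_betw_finite[OF lbox_bij[of d S]] finite_PiE[of "{..<d}" S] by simp

lemma card_lbox: "card (lbox d S) = (\<Prod>i<d. card (S i))"
  using bij_betw_same_card[OF lbox_bij[of d S]] card_PiE[of "{..<d}" S] by simp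

lemma cube_lbox: "cube e a s = lbox e (\<lambda>i. {a i..<a i + int s})"
  by (auto simp: cube_def lbox_def)

lemma finite_cube: "finite (cube e a s)"
  by (simp add: cube_lbox finite_lbox)

lemma card_cube: "card (cube e a s) = s ^ e"
  by (simp add: cube_lbox card_lbox)

definition steps :: "nat \<Rightarrow> nat \<Rightarrow> nat \<Rightarrow> int" where "steps j t = (\<lambda>i. if i = j then int t else 0)"

lemma steps_simps: "steps j 0 = 0" "steps j (Suc t) = steps j t + unit j"
  by (auto simp: steps_def unit_def fun_eq_iff)

context torus_action
begin

definition bsum :: "(real^'k \<Rightarrow> real) \<Rightarrow> (nat \<Rightarrow> nat) \<Rightarrow> real^'k \<Rightarrow> real" where
  "bsum f L x = (\<Sum>n\<in>lbox d (\<lambda>i. {0..<int (L i)}). f (act n x))"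

lemma bsum_double:
  assumes j: "j < d"
  shows "bsum f (L(j := 2 * L j)) x = bsum f L x + bsum f L (act (steps j (L j)) x)"
proof -
  let ?B = "lbox d (\<lambda>i. {0..<int (L i)})" and ?k = "steps j (L j)"
  have "lbox d (\<lambda>i. {0..<int ((L(j := 2 * L j)) i)}) = ?B \<union> (\<lambda>n. n + ?k) ` ?B" (is "?C = _")
  proof (intro equalityI subsetI)
    fix n assume n: "n \<in> ?C"
    show "n \<in> ?B \<union> (\<lambda>n. n + ?k) ` ?B"
    proof (cases "n j < int (L j)")
      case True
      then show ?thesis using n by (auto simp: lbox_def split: if_splits)
    next
      case False
      then have "n - ?k \<in> ?B" using n j by (auto simp: lbox_def lattice_def steps_def split: if_splits)
      then show ?thesis by (intro UnI2 image_eqI[of _ _ "n - ?k"]) auto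
    qed
  next
    fix n assume "n \<in> ?B \<union> (\<lambda>n. n + ?k) ` ?B"
    then show "n \<in> ?C" using j by (fastforce simp: lbox_def lattice_def steps_def split: if_splits)
  qed
  moreover have "?B \<inter> (\<lambda>n. n + ?k) ` ?B = {}"
    using j by (force simp: lbox_def steps_def)
  moreover have "finite ?B" by (simp add: finite_lbox)
  moreover have "(\<Sum>n\<in>(\<lambda>n. n + ?k) ` ?B. f (act n x)) = bsum f L (act ?k x)"
    by (subst sum.reindex) (auto simp: bsum_def act_add inj_on_def)
  ultimately show ?thesis by (simp add: bsum_def sum.union_disjoint)
qed

text \<open>Boxes are doubled one direction at a time. Averages over a box and over its doubling
  differ by half of a displacement by \<open>2 ^ i\<close> steps, which is the divergence of a flow
  summing \<open>2 ^ i\<close> averages, each at most \<open>B i / 2 ^ (d * i)\<close>. The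
  divergences telescope to \<open>f\<close>.\<close>

lemma real_flow:
  fixes f :: "real^'k \<Rightarrow> real" and B :: "nat \<Rightarrow> real"
  assumes f: "f \<in> borel_measurable M"
    and bound: "\<And>i x. x \<in> torus \<Longrightarrow> \<bar>\<Sum>n\<in>cube d 0 (2 ^ i). f (act n x)\<bar> \<le> B i"
    and sB: "summable (\<lambda>i. B i / 2 ^ ((d - 1) * i))"
  obtains \<phi> :: "nat \<Rightarrow> real^'k \<Rightarrow> real" and C :: real where "\<And>j. \<phi> j \<in> borel_measurable M"
    "\<And>j x. x \<in> torus \<Longrightarrow> \<bar>\<phi> j x\<bar> \<le> C"
    "\<And>x. x \<in> torus \<Longrightarrow> (\<Sum>j<d. \<phi> j x - \<phi> j (act (- unit j) x)) = f x"
proof -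
  \<comment> \<open>Between scales \<open>i\<close> and \<open>i + 1\<close>, the first
    \<open>j\<close> sides have been doubled already.\<close>
  define side :: "nat \<Rightarrow> nat \<Rightarrow> nat \<Rightarrow> nat" where "side i j l = (if l < j then 2 ^ Suc i else 2 ^ i)" for i j l
  define g where "g i j x = bsum f (side i j) x / 2 ^ (d * i + j)" for i j x
  \<comment> \<open>One backward step in direction \<open>j\<close> telescopes this sum to its two
    ends, so its divergence is half of \<open>g i j\<close> at \<open>x\<close> minus half of it at
    distance \<open>2 ^ i\<close>.\<close>
  define F where "F i j x = - (\<Sum>t\<in>{1..2 ^ i}. g i j (act (steps j t) x)) / 2" for i j x
  define b where "b i = B i / 2 ^ ((d - 1) * i)" for i
  have B_nn: "0 \<le> B i" for i
    using bound[of "tproj 0" i] tproj_torus by (meson abs_ge_zero order_trans)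
  have g_Suc: "g i (Suc j) x = (g i j x + g i j (act (steps j (2 ^ i)) x)) / 2" if "j < d" for i j x
  proof -
    have "side i (Suc j) = (side i j)(j := 2 * side i j j)" "side i j j = 2 ^ i"
      by (auto simp: side_def fun_eq_iff)
    then have "bsum f (side i (Suc j)) x = bsum f (side i j) x + bsum f (side i j) (act (steps j (2 ^ i)) x)"
      using bsum_double[OF that, of f "side i j" x] by simp
    then show ?thesis by (simp add: g_def field_simps)
  qed
  have g_d: "g i d = g (Suc i) 0" for i
  proof -
    have "lbox d (\<lambda>l. {0..<int (side i d l)}) = lbox d (\<lambda>l. {0..<int (side (Suc i) 0 l)})"
      by (auto simp: lbox_def side_def)
    then have "bsum f (side i d) = bsum f (side (Suc i) 0)" by (auto simp: bsum_def)
    then show ?thesis by (auto simp: g_def fun_eq_iff algebra_simps)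
  qed
  have g_bound: "\<bar>g i j x\<bar> \<le> B i / 2 ^ (d * i)" if "x \<in> torus" "j \<le> d" for i j x
    using that
  proof (induction j arbitrary: x)
    case 0
    have "cube d 0 (2 ^ i) = lbox d (\<lambda>l. {0..<int (side i 0 l)})"
      by (simp add: cube_lbox side_def)
    then show ?case using bound[OF 0(1), of i] by (simp add: g_def bsum_def divide_right_mono)
  next
    case (Suc j)
    then have "\<bar>g i j x\<bar> \<le> B i / 2 ^ (d * i)" "\<bar>g i j (act (steps j (2 ^ i)) x)\<bar> \<le> B i / 2 ^ (d * i)"
      by auto
    moreover have "g i (Suc j) x = (g i j x + g i j (act (steps j (2 ^ i)) x)) / 2"
      using g_Suc[of j i x] Suc by simp
    moreover have "\<bar>(a + b) / 2\<bar> \<le> c" if "\<bar>a\<bar> \<le> c" "\<bar>b\<bar> \<le> c" for a b c :: real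
      using that by (auto simp: abs_le_iff)
    ultimately show ?case by (simp only:)
  qed
  have F_bound: "\<bar>F i j x\<bar> \<le> b i" if "x \<in> torus" "j < d" for i j x
  proof -
    have "\<bar>\<Sum>t\<in>{1..2 ^ i}. g i j (act (steps j t) x)\<bar> \<le> (\<Sum>t\<in>{1..2 ^ i::nat}. B i / 2 ^ (d * i))"
      by (rule order_trans[OF sum_abs sum_mono]) (use that in \<open>auto intro: g_bound\<close>)
    also have "\<dots> = 2 ^ i * (B i / 2 ^ (d * i))" by simp
    also have "\<dots> = b i"
    proof -
      have "d * i = (d - 1) * i + i" using d2 by (cases d) auto
      then show ?thesis by (simp add: b_def power_add)
    qed
    finally have "\<bar>\<Sum>t\<in>{1..2 ^ i}. g i j (act (steps j t) x)\<bar> \<le> b i" .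
    moreover have "\<bar>F i j x\<bar> = \<bar>\<Sum>t\<in>{1..2 ^ i}. g i j (act (steps j t) x)\<bar> / 2" by (simp add: F_def)
    ultimately show ?thesis by linarith
  qed
  have F_div: "F i j x - F i j (act (- unit j) x) = g i j x - g i (Suc j) x" if "x \<in> torus" "j < d" for i j x
  proof -
    define y where "y = act (- unit j) x"
    have shift: "act (steps j (Suc t)) y = act (steps j t) x" for t
      by (simp add: y_def act_add[symmetric] steps_simps)
    have "(\<Sum>t\<in>{1..m}. g i j (act (steps j t) x)) - (\<Sum>t\<in>{1..m}. g i j (act (steps j t) y))
        = g i j (act (steps j m) x) - g i j x" for m
    proof (induction m)
      case 0 show ?case unfolding steps_simps act_0[OF that(1)] by simp
    next
      case (Suc m)
      then show ?case by (simp add: shift)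
    qed
    from this[of "2 ^ i"] show ?thesis
      using g_Suc[OF that(2), of i x] unfolding y_def[symmetric] by (simp add: F_def field_simps)
  qed
  have sb: "summable b" using sB by (simp add: b_def[abs_def])
  have sF: "summable (\<lambda>i. F i j x)" if "x \<in> torus" "j < d" for j x
    by (rule summable_comparison_test'[OF sb, of 0]) (use F_bound[OF that] in auto)
  define \<phi> where "\<phi> j x = (if j < d then \<Sum>i. F i j x else 0)" for j x
  show thesis
  proof (rule that[of \<phi> "suminf b"])
    have "b i \<ge> 0" for i using B_nn by (simp add: b_def)
    then have C: "0 \<le> suminf b" by (intro suminf_nonneg[OF sb])
    fix j
    have bm: "bsum f L \<in> borel_measurable M" for L
      unfolding bsum_def[abs_def] by (intro borel_measurable_sum measurable_compose[OF act_meas f])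
    have gm: "g i j \<in> borel_measurable M" for i j
      unfolding g_def[abs_def] by (intro borel_measurable_divide bm borel_measurable_const)
    have "(\<lambda>x. F i j x) \<in> borel_measurable M" for i j
      unfolding F_def by (intro borel_measurable_divide borel_measurable_uminus borel_measurable_sum
          measurable_compose[OF act_meas gm] borel_measurable_const)
    then show "\<phi> j \<in> borel_measurable M"
      unfolding \<phi>_def[abs_def] by (cases "j < d") auto
    fix x :: "real^'k" assume x: "x \<in> torus"
    show "\<bar>\<phi> j x\<bar> \<le> suminf b"
    proof (cases "j < d")
      case True
      have "norm (\<Sum>i. F i j x) \<le> suminf b"
        by (rule norm_suminf_le) (use F_bound[OF x True] sb in auto)
      then show ?thesis using True by (simp add: \<phi>_def)
    qed (simp add: \<phi>_def C)
  next
    fix x :: "real^'k" assume x: "x \<in> torus"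
    have "(\<lambda>i. F i j x - F i j (act (- unit j) x)) sums (\<phi> j x - \<phi> j (act (- unit j) x))" if "j < d" for j
      unfolding \<phi>_def using that x by (auto intro!: sums_diff summable_sums sF)
    then have "(\<lambda>i. g i j x - g i (Suc j) x) sums (\<phi> j x - \<phi> j (act (- unit j) x))" if "j < d" for j
      using that x by (simp add: F_div)
    then have "(\<lambda>i. \<Sum>j<d. g i j x - g i (Suc j) x) sums (\<Sum>j<d. \<phi> j x - \<phi> j (act (- unit j) x))"
      by (intro sums_sum) auto
    moreover have "(\<Sum>j<d. g i j x - g i (Suc j) x) = g i 0 x - g (Suc i) 0 x" for i
      using sum_lessThan_telescope'[of "\<lambda>j. g i j x" d] by (simp add: g_d)
    ultimately have 1: "(\<lambda>i. g i 0 x - g (Suc i) 0 x) sums (\<Sum>j<d. \<phi> j x - \<phi> j (act (- unit j) x))"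
      by simp
    have "(\<lambda>i. g i 0 x) \<longlonglongrightarrow> 0"
    proof (rule Lim_null_comparison[OF _ summable_LIMSEQ_zero[OF sb]])
      have "\<bar>g i 0 x\<bar> \<le> b i" for i
      proof -
        have "B i / 2 ^ (d * i) \<le> B i / 2 ^ ((d - 1) * i)"
          using B_nn[of i] by (intro divide_left_mono power_increasing) auto
        then show ?thesis using g_bound[OF x, of 0 i] by (simp add: b_def)
      qed
      then show "\<forall>\<^sub>F i in sequentially. norm (g i 0 x) \<le> b i" by simp
    qed
    from telescope_sums'[OF this] have "(\<lambda>i. g i 0 x - g (Suc i) 0 x) sums g 0 0 x" by simp
    moreover have "g 0 0 x = f x"
    proof -
      have "lbox d (\<lambda>i. {0..<int (side 0 0 i)}) = {0}"
      proof (intro equalityI subsetI)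
        fix n assume n: "n \<in> lbox d (\<lambda>i. {0..<int (side 0 0 i)})"
        have "n i = 0" for i
          using n by (cases "i < d") (auto simp: lbox_def side_def lattice_def)
        then show "n \<in> {0}" by (auto simp: fun_eq_iff)
      qed (auto simp: lbox_def side_def)
      then have "bsum f (side 0 0) x = f (act 0 x)" by (simp only: bsum_def sum.insert sum.empty) simp
      then show ?thesis unfolding act_0[OF x] by (simp add: g_def)
    qed
    ultimately show "(\<Sum>j<d. \<phi> j x - \<phi> j (act (- unit j) x)) = f x" using sums_unique2[OF 1] by simp
  qed
qed

end

section \<open>Voronoi cells\<close>

text \<open>\<open>U\<close> is \<open>R\<close>-separated and \<open>R\<close>-covering in the
  Euclidean norm, for which the comparison of the distances to two centres is linear in the point;
  squares keep it in the integers. \<open>col\<close> separates points at distance less than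
  \<open>2 * R\<close>, enough for two centres competing for a point.\<close>

locale voronoi = torus_action M N xs d for M :: "(real^'k) measure" and N xs d +
  fixes U :: "(real^'k) set" and col :: "real^'k \<Rightarrow> nat" and K R :: int
  assumes U_sets: "U \<in> sets M" and R_pos: "0 < R"
    and U_sep: "c \<in> U \<Longrightarrow> w \<in> lattice d \<Longrightarrow> act w c \<in> U \<Longrightarrow> w \<noteq> 0 \<Longrightarrow> R\<^sup>2 \<le> (\<Sum>i<d. (w i)\<^sup>2)"
    and U_cover: "x \<in> torus \<Longrightarrow> \<exists>n\<in>lattice d. (\<Sum>i<d. (n i)\<^sup>2) < R\<^sup>2 \<and> act n x \<in> U"
    and col_meas: "dmeas M col" and col_less: "x \<in> torus \<Longrightarrow> int (col x) < K"
    and col_sep: "x \<in> torus \<Longrightarrow> n \<in> lattice d \<Longrightarrow> n \<noteq> 0 \<Longrightarrow> (\<Sum>i<d. (n i)\<^sup>2) < 4 * R\<^sup>2 \<Longrightarrow>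
      col (act n x) \<noteq> col x"
begin

definition sq :: "(nat \<Rightarrow> int) \<Rightarrow> int" where "sq n = (\<Sum>i<d. (n i)\<^sup>2)"

definition dot :: "(nat \<Rightarrow> int) \<Rightarrow> (nat \<Rightarrow> int) \<Rightarrow> int" where "dot m n = (\<Sum>i<d. m i * n i)"

lemma sq_minus [simp]: "sq (- n) = sq n"
  by (simp add: sq_def)

lemma sq_nonneg [simp]: "0 \<le> sq n"
  by (simp add: sq_def sum_nonneg)

lemma sq_diff: "sq (m - n) = sq m - 2 * dot m n + sq n"
  by (simp add: sq_def dot_def power2_diff sum.distrib sum_subtractf sum_distrib_left algebra_simps)

lemma dot_bound: "4 * dot m n \<le> sq m + 4 * sq n"
proof -
  have "4 * (a * b) \<le> a\<^sup>2 + 4 * b\<^sup>2" for a b :: int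
    using zero_le_power2[of "a - 2 * b"] by (simp add: power2_eq_square algebra_simps)
  then have "(\<Sum>i<d. 4 * (m i * n i)) \<le> (\<Sum>i<d. (m i)\<^sup>2 + 4 * (n i)\<^sup>2)" by (intro sum_mono) auto
  then show ?thesis by (simp add: sq_def dot_def sum.distrib sum_distrib_left)
qed

lemma sq_diff_le: "sq (m - n) \<le> 2 * sq m + 2 * sq n"
proof -
  have "- 2 * (a * b) \<le> a\<^sup>2 + b\<^sup>2" for a b :: int
    using zero_le_power2[of "a + b"] by (simp add: power2_eq_square algebra_simps)
  then have "(\<Sum>i<d. - 2 * (m i * n i)) \<le> (\<Sum>i<d. (m i)\<^sup>2 + (n i)\<^sup>2)" by (intro sum_mono) auto
  then have "- 2 * dot m n \<le> sq m + sq n"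
    unfolding sq_def dot_def sum.distrib sum_distrib_left by simp
  then show ?thesis unfolding sq_diff by simp
qed

lemma sq_coordinate: assumes "sq n < R\<^sup>2" "i < d" shows "\<bar>n i\<bar> < R"
proof -
  have "(n i)\<^sup>2 \<le> sq n" unfolding sq_def using assms(2) by (intro member_le_sum) auto
  then have "\<bar>n i\<bar>\<^sup>2 < R\<^sup>2" using assms(1) by simp
  then show ?thesis using R_pos power2_less_imp_less by (metis less_imp_le)
qed

text \<open>Since \<open>col\<close> takes values below \<open>K\<close> and separates nearby centres, \<open>key\<close> orders centres by distance with
  ties broken by colour; as the colour belongs to the centre, membership in a cell is a system of
  linear inequalities and cells are convex along the coordinate axes.\<close>

definition key :: "real^'k \<Rightarrow> (nat \<Rightarrow> int) \<Rightarrow> int" where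
  "key x n = K * sq n + int (col (act n x))"

definition ctrs :: "real^'k \<Rightarrow> (nat \<Rightarrow> int) set" where
  "ctrs x = {n \<in> lattice d. act n x \<in> U}"

definition nearest :: "real^'k \<Rightarrow> (nat \<Rightarrow> int) \<Rightarrow> bool" where
  "nearest x n \<longleftrightarrow> n \<in> ctrs x \<and> (\<forall>m\<in>ctrs x. key x n \<le> key x m)"

definition \<kappa> :: "real^'k \<Rightarrow> nat \<Rightarrow> int" where
  "\<kappa> x = (THE n. nearest x n)"

lemma U_torus: "U \<subseteq> torus"
  using sets.sets_into_space[OF U_sets] space_M by simp

lemma K_pos: "0 < K"
  using col_less[of "tproj 0"] tproj_torus[of 0] by (meson of_nat_0_le_iff order_le_less_trans)

lemma nearest_sq: assumes x: "x \<in> torus" and n: "nearest x n" shows "sq n < R\<^sup>2"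
proof -
  obtain m where m: "m \<in> lattice d" "sq m < R\<^sup>2" "act m x \<in> U"
    using U_cover[OF x] by (auto simp: sq_def)
  then have "key x n \<le> key x m" using n by (auto simp: nearest_def ctrs_def)
  then have "K * sq n < K * (sq m + 1)"
    using col_less[of "act m x"] by (simp add: key_def distrib_left)
  then have "sq n < sq m + 1" using K_pos mult_less_cancel_left_pos by blast
  then show ?thesis using m by simp
qed

text \<open>Equal keys make the difference of the two colours a multiple of \<open>K\<close>, hence
  0; but the two centres lie within \<open>2 * R\<close> of each other and would then have to
  coincide.\<close>

lemma nearest_unique:
  assumes x: "x \<in> torus" and m: "nearest x m" and n: "nearest x n" shows "m = n"
proof (rule ccontr)
  assume "m \<noteq> n"
  have "key x m = key x n" using m n by (auto simp: nearest_def intro: antisym)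
  then have eq: "K * (sq m - sq n) = int (col (act n x)) - int (col (act m x))"
    by (simp add: key_def right_diff_distrib)
  then have "\<bar>K * (sq m - sq n)\<bar> < K" using col_less[of "act n x"] col_less[of "act m x"] by simp
  then have "\<bar>sq m - sq n\<bar> < 1" using K_pos by (simp add: abs_mult)
  then have c: "col (act n x) = col (act m x)" using eq by simp
  have lat: "m - n \<in> lattice d" using m n by (auto simp: nearest_def ctrs_def lattice_diff)
  have "sq (m - n) < 4 * R\<^sup>2"
    using sq_diff_le[of m n] nearest_sq[OF x m] nearest_sq[OF x n] by simp
  moreover have "m - n \<noteq> 0" using \<open>m \<noteq> n\<close> by simp
  ultimately have "col (act (m - n) (act n x)) \<noteq> col (act n x)"
    using col_sep[of "act n x" "m - n"] lat unfolding sq_def by simp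
  moreover have "act (m - n) (act n x) = act m x" by (simp add: act_add[symmetric])
  ultimately show False using c by simp
qed

lemma nearest_ex: assumes x: "x \<in> torus" shows "\<exists>n. nearest x n"
proof -
  obtain m where "m \<in> ctrs x" using U_cover[OF x] by (auto simp: ctrs_def)
  then obtain n where "n \<in> ctrs x" "\<forall>m. m \<in> ctrs x \<longrightarrow> nat (key x n) \<le> nat (key x m)"
    using ex_has_least_nat[of "\<lambda>n. n \<in> ctrs x" m "\<lambda>n. nat (key x n)"] by blast
  moreover have "0 \<le> key x n" for n using K_pos by (simp add: key_def)
  ultimately show ?thesis by (auto simp: nearest_def nat_le_eq_zle)
qed

lemma \<kappa>_iff: "x \<in> torus \<Longrightarrow> \<kappa> x = n \<longleftrightarrow> nearest x n"
  unfolding \<kappa>_def using nearest_ex nearest_unique by (metis the_equality)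

lemma \<kappa>_nearest: "x \<in> torus \<Longrightarrow> nearest x (\<kappa> x)"
  using \<kappa>_iff by blast

lemma \<kappa>_lattice: "x \<in> torus \<Longrightarrow> \<kappa> x \<in> lattice d"
  and \<kappa>_U: "x \<in> torus \<Longrightarrow> act (\<kappa> x) x \<in> U"
  using \<kappa>_nearest by (auto simp: nearest_def ctrs_def)

text \<open>Cells are stored as displacements from the centre. The cell is empty if \<open>c\<close>
  is not in \<open>U\<close>, so later statements may range over all points of the torus.\<close>

definition cell :: "real^'k \<Rightarrow> (nat \<Rightarrow> int) set" where
  "cell c = {n \<in> lattice d. \<kappa> (act n c) = - n}"

lemma act_cancel: "x \<in> torus \<Longrightarrow> act (- n) (act n x) = x" "x \<in> torus \<Longrightarrow> act n (act (- n) x) = x"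
  by (simp_all add: act_add[symmetric] act_0)

lemma cell_U: "c \<in> torus \<Longrightarrow> n \<in> cell c \<Longrightarrow> c \<in> U"
  using \<kappa>_U[of "act n c"] by (auto simp: cell_def act_cancel)

lemma cell_lattice: "n \<in> cell c \<Longrightarrow> n \<in> lattice d"
  by (simp add: cell_def)

lemma cell_sq: "n \<in> cell c \<Longrightarrow> sq n < R\<^sup>2"
  using nearest_sq[OF act_torus \<kappa>_nearest[OF act_torus], of n c] by (simp add: cell_def)

text \<open>Expanding the square in the key of the competitor \<open>w - n\<close>, the term
  \<open>sq n\<close> occurs on both sides and cancels; an inequality linear in \<open>n\<close>
  remains for every centre.\<close>

lemma cell_iff:
  assumes c: "c \<in> U"
  shows "n \<in> cell c \<longleftrightarrow> n \<in> lattice d \<and> (\<forall>w\<in>ctrs c. K * (2 * dot w n - sq w) \<le> int (col (act w c)) - int (col c))"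
proof -
  have ct: "c \<in> torus" using c U_torus by auto
  have "\<kappa> (act n c) = - n \<longleftrightarrow> (\<forall>w\<in>ctrs c. K * (2 * dot w n - sq w) \<le> int (col (act w c)) - int (col c))"
    if n: "n \<in> lattice d"
  proof -
    have "\<kappa> (act n c) = - n \<longleftrightarrow> (\<forall>m\<in>ctrs (act n c). key (act n c) (- n) \<le> key (act n c) m)"
      using \<kappa>_iff[of "act n c" "- n"] c ct n by (auto simp: nearest_def ctrs_def act_cancel lattice_minus)
    also have "ctrs (act n c) = (\<lambda>w. w - n) ` ctrs c"
    proof (intro equalityI subsetI)
      fix m assume "m \<in> ctrs (act n c)"
      then have "m + n \<in> ctrs c" using n by (auto simp: ctrs_def act_add lattice_add)
      then show "m \<in> (\<lambda>w. w - n) ` ctrs c" by (intro image_eqI[of _ _ "m + n"]) auto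
    next
      fix m assume "m \<in> (\<lambda>w. w - n) ` ctrs c"
      then show "m \<in> ctrs (act n c)" using n by (auto simp: ctrs_def act_add[symmetric] lattice_diff)
    qed
    also have "(\<forall>m\<in>(\<lambda>w. w - n) ` ctrs c. key (act n c) (- n) \<le> key (act n c) m)
        \<longleftrightarrow> (\<forall>w\<in>ctrs c. K * (2 * dot w n - sq w) \<le> int (col (act w c)) - int (col c))"
      by (simp add: key_def act_cancel act_0[OF ct] ct act_add[symmetric] sq_diff algebra_simps)
    finally show ?thesis .
  qed
  then show ?thesis by (auto simp: cell_def)
qed

text \<open>A linear function on a segment is bounded by its value at one of the ends, so each
  inequality of \<open>cell_iff\<close> is inherited. Convexity is used only along coordinate
  axes.\<close>

lemma cell_convex:
  assumes ct: "c \<in> torus" and p: "p \<in> cell c" and r: "r \<in> cell c" and j: "j < d"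
    and same: "\<And>i. i \<noteq> j \<Longrightarrow> p i = r i" and v: "p j \<le> v" "v \<le> r j"
  shows "p(j := v) \<in> cell c"
proof -
  have c: "c \<in> U" using cell_U[OF ct p] .
  note iff = cell_iff[OF c]
  have "K * (2 * dot w (p(j := v)) - sq w) \<le> int (col (act w c)) - int (col c)" if w: "w \<in> ctrs c" for w
  proof -
    have dot: "dot w n = w j * n j + (\<Sum>i\<in>{..<d} - {j}. w i * n i)" for n
      unfolding dot_def using j by (simp add: sum.remove)
    have rest: "(\<Sum>i\<in>{..<d} - {j}. w i * (p(j := v)) i) = (\<Sum>i\<in>{..<d} - {j}. w i * p i)"
      "(\<Sum>i\<in>{..<d} - {j}. w i * r i) = (\<Sum>i\<in>{..<d} - {j}. w i * p i)"
      using same by (auto intro!: sum.cong)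
    have "w j * v \<le> w j * p j \<or> w j * v \<le> w j * r j"
    proof (cases "0 \<le> w j")
      case True then show ?thesis using v(2) mult_left_mono by blast
    next
      case False then show ?thesis using v(1) by (simp add: mult_left_mono_neg)
    qed
    then have "dot w (p(j := v)) \<le> dot w p \<or> dot w (p(j := v)) \<le> dot w r"
      unfolding dot rest by auto
    then have "K * (2 * dot w (p(j := v)) - sq w) \<le> K * (2 * dot w p - sq w) \<or>
        K * (2 * dot w (p(j := v)) - sq w) \<le> K * (2 * dot w r - sq w)"
      using K_pos by auto
    moreover have "K * (2 * dot w p - sq w) \<le> int (col (act w c)) - int (col c)"
      "K * (2 * dot w r - sq w) \<le> int (col (act w c)) - int (col c)"
      using p r w iff by blast+
    ultimately show ?thesis by linarith
  qed
  moreover have "p(j := v) \<in> lattice d" using cell_lattice[OF p] j by (auto simp: lattice_def)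
  ultimately show ?thesis using iff by blast
qed

text \<open>Every competitor is at distance at least \<open>R\<close>, so points within
  \<open>R / 2\<close> of the centre lie strictly on its side of each bisector; by integrality the
  margin is at least \<open>K\<close>, which outweighs the colours.\<close>

lemma cell_contains:
  assumes c: "c \<in> U" and n: "n \<in> lattice d" "4 * sq n < R\<^sup>2" shows "n \<in> cell c"
proof -
  have "K * (2 * dot w n - sq w) \<le> int (col (act w c)) - int (col c)" if w: "w \<in> ctrs c" for w
  proof (cases "w = 0")
    case True
    have "c \<in> torus" using c U_torus by auto
    then have "act w c = c" unfolding True by (rule act_0)
    then show ?thesis by (simp add: True dot_def sq_def)
  next
    case False
    then have "R\<^sup>2 \<le> sq w" using U_sep[OF c] w by (auto simp: ctrs_def sq_def)
    then have "2 * dot w n - sq w < 0" using dot_bound[of w n] n(2) by simp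
    then have "2 * dot w n - sq w \<le> - 1" by simp
    then have "K * (2 * dot w n - sq w) \<le> K * (- 1)" using K_pos by (intro mult_left_mono) auto
    moreover have "c \<in> torus" using c U_torus by auto
    ultimately show ?thesis using col_less[of c] by simp
  qed
  then show ?thesis using cell_iff[OF c] n by blast
qed

lemma cell_window: "cell c \<subseteq> lbox d (\<lambda>_. {- R..R})"
proof
  fix n assume n: "n \<in> cell c"
  have "- R \<le> n i \<and> n i \<le> R" if "i < d" for i
    using sq_coordinate[OF cell_sq[OF n] that] by linarith
  then show "n \<in> lbox d (\<lambda>_. {- R..R})" using cell_lattice[OF n] by (auto simp: lbox_def)
qed

lemma finite_cell: "finite (cell c)"
  by (rule finite_subset[OF cell_window]) (simp add: finite_lbox)

section \<open>Flux through the boundary of a cell\<close>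

definition exits :: "real^'k \<Rightarrow> nat \<Rightarrow> (nat \<Rightarrow> int) set" where
  "exits c j = {n \<in> cell c. n + unit j \<notin> cell c}"

text \<open>The edge from \<open>n\<close> to \<open>n + unit j\<close> is named by its lower end,
  where \<psi> \<open>j\<close> stores its flow. An entry is therefore a point outside the
  cell.\<close>

definition entries :: "real^'k \<Rightarrow> nat \<Rightarrow> (nat \<Rightarrow> int) set" where
  "entries c j = {n. n \<notin> cell c \<and> n + unit j \<in> cell c}"

lemma entries_eq: "entries c j = (\<lambda>n. n - unit j) ` cell c - cell c"
  by (auto simp: entries_def intro!: image_eqI[of _ _ "_ + unit j"])

lemma exits_eq: "exits c j = cell c - (\<lambda>n. n - unit j) ` cell c"
  by (auto simp: exits_def intro!: image_eqI[of _ _ "_ + unit j"])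

lemma finite_exits: "finite (exits c j)" and finite_entries: "finite (entries c j)"
  by (simp_all add: exits_eq entries_eq finite_cell)

lemma entries_lattice: "j < d \<Longrightarrow> n \<in> entries c j \<Longrightarrow> n \<in> lattice d"
  by (auto simp: entries_eq cell_lattice lattice_diff lattice_unit)

text \<open>A set meeting every line parallel to axis \<open>j\<close> at most once injects into a
  box of dimension \<open>d - 1\<close>. By \<open>cell_convex\<close> the boundary edges of either
  kind have this property.\<close>

lemma card_line_injective:
  assumes j: "j < d" and E: "finite E" "E \<subseteq> lattice d" "\<And>n i. n \<in> E \<Longrightarrow> i < d \<Longrightarrow> i \<noteq> j \<Longrightarrow> \<bar>n i\<bar> \<le> R"
    and line: "\<And>m n. m \<in> E \<Longrightarrow> n \<in> E \<Longrightarrow> (\<And>i. i \<noteq> j \<Longrightarrow> m i = n i) \<Longrightarrow> \<not> m j < n j"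
  shows "int (card E) \<le> (2 * R + 1) ^ (d - 1)"
proof -
  let ?L = "lbox d (\<lambda>i. if i = j then {0} else {- R..R})"
  have fin: "finite ?L" by (rule finite_lbox) simp
  have "inj_on (\<lambda>n. n(j := 0)) E"
  proof (rule inj_onI)
    fix m n assume mn: "m \<in> E" "n \<in> E" "m(j := 0) = n(j := 0)"
    then have eq: "m i = n i" if "i \<noteq> j" for i using that by (metis fun_upd_other)
    moreover have "m j = n j" using line[OF mn(1,2)] line[OF mn(2,1)] eq by force
    ultimately show "m = n" by (metis ext)
  qed
  moreover have "(\<lambda>n. n(j := 0)) ` E \<subseteq> ?L"
  proof
    fix n' assume "n' \<in> (\<lambda>n. n(j := 0)) ` E"
    then obtain n where n: "n \<in> E" "n' = n(j := 0)" by blast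
    have "- R \<le> n i \<and> n i \<le> R" if "i < d" "i \<noteq> j" for i
      using E(3)[OF n(1) that] by linarith
    then show "n' \<in> ?L" using n E(2) by (auto simp: lbox_def lattice_def)
  qed
  ultimately have "card E \<le> card ?L" using card_inj_on_le fin by blast
  also have "card ?L = (\<Prod>i<d. if i = j then 1 else nat (2 * R + 1))"
    unfolding card_lbox by (rule prod.cong) (use R_pos in auto)
  also have "\<dots> = nat (2 * R + 1) ^ (d - 1)"
  proof -
    have "(\<Prod>i<d. if i = j then 1 else nat (2 * R + 1))
        = (if j = j then 1 else nat (2 * R + 1)) * (\<Prod>i\<in>{..<d} - {j}. if i = j then 1 else nat (2 * R + 1))"
      by (rule prod.remove) (use j in auto)
    also have "(\<Prod>i\<in>{..<d} - {j}. if i = j then 1 else nat (2 * R + 1)) = (\<Prod>i\<in>{..<d} - {j}. nat (2 * R + 1))"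
      by (rule prod.cong) auto
    finally show ?thesis using j by simp
  qed
  finally show ?thesis using R_pos by (simp add: nat_power_eq[symmetric] le_nat_iff)
qed

lemma card_exits: assumes "c \<in> torus" "j < d" shows "int (card (exits c j)) \<le> (2 * R + 1) ^ (d - 1)"
proof (rule card_line_injective[OF assms(2) finite_exits])
  show "exits c j \<subseteq> lattice d" by (auto simp: exits_def cell_lattice)
  show "\<bar>n i\<bar> \<le> R" if "n \<in> exits c j" "i < d" "i \<noteq> j" for n i
    using sq_coordinate[OF cell_sq, of n c i] that by (simp add: exits_def)
  fix m n assume mn: "m \<in> exits c j" "n \<in> exits c j" "\<And>i. i \<noteq> j \<Longrightarrow> m i = n i"
  show "\<not> m j < n j"
  proof
    assume "m j < n j"
    then have "m(j := m j + 1) \<in> cell c"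
      using mn by (intro cell_convex[OF assms(1) _ _ assms(2)]) (auto simp: exits_def)
    moreover have "m(j := m j + 1) = m + unit j" by (auto simp: unit_def fun_eq_iff)
    ultimately show False using mn(1) by (auto simp: exits_def)
  qed
qed

lemma card_entries: assumes "c \<in> torus" "j < d" shows "int (card (entries c j)) \<le> (2 * R + 1) ^ (d - 1)"
proof (rule card_line_injective[OF assms(2) finite_entries])
  show "entries c j \<subseteq> lattice d" using entries_lattice[OF assms(2)] by auto
  show "\<bar>n i\<bar> \<le> R" if "n \<in> entries c j" "i < d" "i \<noteq> j" for n i
    using sq_coordinate[OF cell_sq, of "n + unit j" c i] that by (simp add: entries_def unit_def)
  fix m n assume mn: "m \<in> entries c j" "n \<in> entries c j" "\<And>i. i \<noteq> j \<Longrightarrow> m i = n i"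
  show "\<not> m j < n j"
  proof
    assume lt: "m j < n j"
    have "(m + unit j)(j := n j) \<in> cell c"
      using mn lt by (intro cell_convex[OF assms(1) _ _ assms(2), where r = "n + unit j"])
        (auto simp: entries_def unit_def)
    moreover have "(m + unit j)(j := n j) = n" using mn(3) by (auto simp: unit_def fun_eq_iff)
    ultimately show False using mn(2) by (auto simp: entries_def)
  qed
qed

text \<open>One token for each unit of flow leaving the cell: positive flow over an exit or negative
  flow over an entry. With the negative of \<psi> one gets the units coming in.\<close>

definition outs :: "(nat \<Rightarrow> real^'k \<Rightarrow> int) \<Rightarrow> real^'k \<Rightarrow> (nat \<times> (nat \<Rightarrow> int) \<times> nat) set" where
  "outs \<psi> c = (SIGMA j:{..<d}. SIGMA n:exits c j \<union> entries c j.
     {..<nat (if n \<in> cell c then \<psi> j (act n c) else - \<psi> j (act n c))})"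

definition points :: "(real^'k) set \<Rightarrow> real^'k \<Rightarrow> (nat \<Rightarrow> int) set" where
  "points A c = {n \<in> cell c. act n c \<in> A}"

lemma finite_outs: "finite (outs \<psi> c)"
  unfolding outs_def by (intro finite_SigmaI) (auto simp: finite_exits finite_entries)

lemma finite_points: "finite (points A c)"
  by (rule finite_subset[OF _ finite_cell]) (auto simp: points_def)

lemma card_outs: "card (outs \<psi> c) = (\<Sum>j<d. (\<Sum>n\<in>exits c j. nat (\<psi> j (act n c))) + (\<Sum>n\<in>entries c j. nat (- \<psi> j (act n c))))"
proof -
  have "card (outs \<psi> c) = (\<Sum>j<d. \<Sum>n\<in>exits c j \<union> entries c j.
      nat (if n \<in> cell c then \<psi> j (act n c) else - \<psi> j (act n c)))"
    unfolding outs_def by (simp add: card_SigmaI finite_exits finite_entries finite_SigmaI)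
  also have "\<dots> = (\<Sum>j<d. (\<Sum>n\<in>exits c j. nat (\<psi> j (act n c))) + (\<Sum>n\<in>entries c j. nat (- \<psi> j (act n c))))"
  proof (rule sum.cong[OF refl])
    fix j
    have "exits c j \<inter> entries c j = {}" by (auto simp: exits_def entries_def)
    then have "(\<Sum>n\<in>exits c j \<union> entries c j. nat (if n \<in> cell c then \<psi> j (act n c) else - \<psi> j (act n c)))
      = (\<Sum>n\<in>exits c j. nat (if n \<in> cell c then \<psi> j (act n c) else - \<psi> j (act n c)))
      + (\<Sum>n\<in>entries c j. nat (if n \<in> cell c then \<psi> j (act n c) else - \<psi> j (act n c)))"
      by (intro sum.union_disjoint finite_exits finite_entries)
    also have "\<dots> = (\<Sum>n\<in>exits c j. nat (\<psi> j (act n c))) + (\<Sum>n\<in>entries c j. nat (- \<psi> j (act n c)))"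
      by (intro arg_cong2[of _ _ _ _ "(+)"] sum.cong) (auto simp: exits_def entries_def)
    finally show "(\<Sum>n\<in>exits c j \<union> entries c j. nat (if n \<in> cell c then \<psi> j (act n c) else - \<psi> j (act n c)))
      = (\<Sum>n\<in>exits c j. nat (\<psi> j (act n c))) + (\<Sum>n\<in>entries c j. nat (- \<psi> j (act n c)))" .
  qed
  finally show ?thesis .
qed

lemma card_outs_le:
  assumes c: "c \<in> torus" and m: "\<And>j x. j < d \<Longrightarrow> x \<in> torus \<Longrightarrow> \<bar>\<psi> j x\<bar> \<le> m"
  shows "int (card (outs \<psi> c)) \<le> int d * (2 * (2 * R + 1) ^ (d - 1) * m)"
proof -
  have m0: "0 \<le> m" using m[of 0 c] c d2 by linarith
  have "int (card (outs \<psi> c)) = (\<Sum>j<d. (\<Sum>n\<in>exits c j. int (nat (\<psi> j (act n c)))) + (\<Sum>n\<in>entries c j. int (nat (- \<psi> j (act n c)))))"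
    unfolding card_outs by simp
  also have "\<dots> \<le> (\<Sum>j<d. 2 * (2 * R + 1) ^ (d - 1) * m)"
  proof (rule sum_mono)
    fix j assume "j \<in> {..<d}"
    then have j: "j < d" by simp
    have "(\<Sum>n\<in>exits c j. int (nat (\<psi> j (act n c)))) \<le> int (card (exits c j)) * m"
      by (rule sum_bounded_above) (use m[OF j act_torus] m0 in \<open>auto simp: abs_le_iff\<close>)
    also have "\<dots> \<le> (2 * R + 1) ^ (d - 1) * m" using card_exits[OF c j] m0 by (rule mult_right_mono)
    finally have 1: "(\<Sum>n\<in>exits c j. int (nat (\<psi> j (act n c)))) \<le> (2 * R + 1) ^ (d - 1) * m" .
    have "(\<Sum>n\<in>entries c j. int (nat (- \<psi> j (act n c)))) \<le> int (card (entries c j)) * m"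
      by (rule sum_bounded_above) (use m[OF j act_torus] m0 in \<open>auto simp: abs_le_iff\<close>)
    also have "\<dots> \<le> (2 * R + 1) ^ (d - 1) * m" using card_entries[OF c j] m0 by (rule mult_right_mono)
    finally show "(\<Sum>n\<in>exits c j. int (nat (\<psi> j (act n c)))) + (\<Sum>n\<in>entries c j. int (nat (- \<psi> j (act n c))))
        \<le> 2 * (2 * R + 1) ^ (d - 1) * m" using 1 by simp
  qed
  finally show ?thesis by simp
qed

text \<open>The discrete divergence theorem on one cell, with the boundary flux split into positive
  and negative parts.\<close>

lemma cell_balance:
  assumes c: "c \<in> torus"
    and div: "\<And>x. x \<in> torus \<Longrightarrow> (\<Sum>j<d. \<psi> j x - \<psi> j (act (- unit j) x)) = of_bool (x \<in> A) - of_bool (x \<in> B)"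
  shows "card (points A c) + card (outs (\<lambda>j x. - \<psi> j x) c) = card (points B c) + card (outs \<psi> c)"
proof -
  have pts: "(\<Sum>n\<in>cell c. of_bool (act n c \<in> S)) = int (card (points S c))" for S
    by (simp add: points_def sum_of_bool_eq finite_cell Int_def)
  have flux: "(\<Sum>n\<in>cell c. \<psi> j (act n c) - \<psi> j (act (- unit j) (act n c)))
      = (\<Sum>n\<in>exits c j. \<psi> j (act n c)) - (\<Sum>n\<in>entries c j. \<psi> j (act n c))" for j
  proof -
    let ?T = "(\<lambda>n. n - unit j) ` cell c"
    have "(\<Sum>n\<in>cell c. \<psi> j (act (- unit j) (act n c))) = (\<Sum>n\<in>?T. \<psi> j (act n c))"
      by (subst sum.reindex) (auto simp: inj_on_def act_add[symmetric])
    moreover have "(\<Sum>n\<in>cell c. \<psi> j (act n c)) = (\<Sum>n\<in>cell c \<inter> ?T. \<psi> j (act n c)) + (\<Sum>n\<in>exits c j. \<psi> j (act n c))"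
      unfolding exits_eq by (rule sum.Int_Diff[OF finite_cell])
    moreover have "(\<Sum>n\<in>?T. \<psi> j (act n c)) = (\<Sum>n\<in>?T \<inter> cell c. \<psi> j (act n c)) + (\<Sum>n\<in>entries c j. \<psi> j (act n c))"
      unfolding entries_eq by (rule sum.Int_Diff) (simp add: finite_cell)
    ultimately show ?thesis by (simp add: sum_subtractf Int_commute)
  qed
  have "int (card (points A c)) - int (card (points B c))
      = (\<Sum>n\<in>cell c. \<Sum>j<d. \<psi> j (act n c) - \<psi> j (act (- unit j) (act n c)))"
    unfolding pts[symmetric] sum_subtractf[symmetric] by (rule sum.cong) (simp_all only: div[OF act_torus])
  also have "\<dots> = (\<Sum>j<d. (\<Sum>n\<in>exits c j. \<psi> j (act n c)) - (\<Sum>n\<in>entries c j. \<psi> j (act n c)))"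
    by (subst sum.swap) (simp only: flux)
  also have "\<dots> = int (card (outs \<psi> c)) - int (card (outs (\<lambda>j x. - \<psi> j x) c))"
  proof -
    have split: "(\<Sum>n\<in>E. a n) = (\<Sum>n\<in>E. int (nat (a n))) - (\<Sum>n\<in>E. int (nat (- a n)))"
      for E and a :: "(nat \<Rightarrow> int) \<Rightarrow> int"
      unfolding sum_subtractf[symmetric] by (rule sum.cong) auto
    show ?thesis
      unfolding card_outs of_nat_sum of_nat_add sum_subtractf[symmetric]
      by (rule sum.cong) (simp_all add: split[of "\<lambda>n. \<psi> _ (act n c)"])
  qed
  finally show ?thesis by simp
qed

end

section \<open>From flows to bijections\<close>

text \<open>The choice is made once for each pair of sets and not for each point, so it is a
  function of countably valued data and keeps measurability.\<close>

definition sel :: "'a set \<Rightarrow> 'b set \<Rightarrow> 'b \<Rightarrow> 'a" where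
  "sel S Z = (SOME g. inj_on g Z \<and> g ` Z \<subseteq> S)"

definition bsel :: "'a set \<Rightarrow> 'b set \<Rightarrow> 'a \<Rightarrow> 'b" where
  "bsel S T = (SOME h. bij_betw h S T)"

lemma sel:
  assumes "finite S" "finite Z" "card Z \<le> card S"
  shows "inj_on (sel S Z) Z" "sel S Z ` Z \<subseteq> S"
proof -
  obtain g where "inj_on g Z \<and> g ` Z \<subseteq> S" using card_le_inj[OF assms(2,1,3)] by blast
  then have "inj_on (sel S Z) Z \<and> sel S Z ` Z \<subseteq> S"
    unfolding sel_def by (rule someI[where P = "\<lambda>g. inj_on g Z \<and> g ` Z \<subseteq> S"])
  then show "inj_on (sel S Z) Z" "sel S Z ` Z \<subseteq> S" by auto
qed

lemma bsel:
  assumes "finite S" "finite T" "card S = card T" shows "bij_betw (bsel S T) S T"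
proof -
  obtain h where "bij_betw h S T" using finite_same_card_bij[OF assms] by blast
  then show ?thesis unfolding bsel_def by (rule someI[where P = "\<lambda>h. bij_betw h S T"])
qed

context voronoi
begin

text \<open>The displacement from the lower end of the edge to the centre of the cell that the flow
  leaves: the cell of \<open>y\<close> for positive flow, that of the upper end otherwise.\<close>

definition ctr_shift :: "(nat \<Rightarrow> real^'k \<Rightarrow> int) \<Rightarrow> nat \<Rightarrow> real^'k \<Rightarrow> nat \<Rightarrow> int" where
  "ctr_shift \<psi> j y = (if 0 < \<psi> j y then \<kappa> y else \<kappa> (act (unit j) y) + unit j)"

definition crossing :: "nat \<Rightarrow> real^'k \<Rightarrow> bool" where
  "crossing j y \<longleftrightarrow> \<kappa> y \<noteq> \<kappa> (act (unit j) y) + unit j"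

definition units :: "(nat \<Rightarrow> real^'k \<Rightarrow> int) \<Rightarrow> (nat \<times> (real^'k) \<times> nat) set" where
  "units \<psi> = {(j, y, k). j < d \<and> y \<in> torus \<and> crossing j y \<and> int k < \<bar>\<psi> j y\<bar>}"

text \<open>The displacement from the edge to the point of \<open>A\<close> that serves unit
  \<open>k\<close> on it.\<close>

definition slot :: "(real^'k) set \<Rightarrow> (nat \<Rightarrow> real^'k \<Rightarrow> int) \<Rightarrow> nat \<Rightarrow> nat \<Rightarrow> real^'k \<Rightarrow> nat \<Rightarrow> int" where
  "slot A \<psi> j k y = (let v = ctr_shift \<psi> j y; c = act v y in sel (points A c) (outs \<psi> c) (j, - v, k) + v)"

definition place :: "(real^'k) set \<Rightarrow> (nat \<Rightarrow> real^'k \<Rightarrow> int) \<Rightarrow> nat \<times> (real^'k) \<times> nat \<Rightarrow> real^'k" where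
  "place A \<psi> z = (case z of (j, y, k) \<Rightarrow> act (slot A \<psi> j k y) y)"

definition rest :: "(real^'k) set \<Rightarrow> (nat \<Rightarrow> real^'k \<Rightarrow> int) \<Rightarrow> real^'k \<Rightarrow> (nat \<Rightarrow> int) set" where
  "rest A \<psi> c = points A c - sel (points A c) (outs \<psi> c) ` outs \<psi> c"

text \<open>Senders and receivers are indexed by the same units: a sign change of \<psi> only
  switches \<open>ctr_shift\<close> to the other side of the edge. So composing \<open>place\<close>
  for \<open>A\<close> with \<open>place\<close> for \<open>B\<close> transports points across one
  boundary.\<close>

lemma units_neg: "units (\<lambda>j x. - \<psi> j x) = units \<psi>"
  by (simp add: units_def)

lemma ctr_shift_lattice: "y \<in> torus \<Longrightarrow> j < d \<Longrightarrow> ctr_shift \<psi> j y \<in> lattice d"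
  by (auto simp: ctr_shift_def \<kappa>_lattice lattice_add lattice_unit)

lemma act_step: "act (n + unit j) c = act (unit j) (act n c)"
  by (metis act_add add.commute)

text \<open>Together with \<open>outs_units\<close>: the units whose source cell has centre
  \<open>c\<close> are exactly the tokens in \<open>outs \<psi> c\<close>.\<close>

lemma units_outs:
  assumes "(j, y, k) \<in> units \<psi>" shows "(j, - ctr_shift \<psi> j y, k) \<in> outs \<psi> (act (ctr_shift \<psi> j y) y)"
proof -
  define v where "v = ctr_shift \<psi> j y"
  define c where "c = act v y"
  have y: "j < d" "y \<in> torus" "crossing j y" "int k < \<bar>\<psi> j y\<bar>" using assms by (auto simp: units_def)
  have yc: "act (- v) c = y" "act (- v + unit j) c = act (unit j) y"
    unfolding c_def act_step by (simp_all only: act_cancel[OF y(2)])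
  have v: "- v \<in> lattice d" using ctr_shift_lattice[OF y(2,1)] by (simp only: v_def lattice_minus)
  moreover have "- v + unit j \<in> lattice d" by (rule lattice_add[OF v lattice_unit[OF y(1)]])
  ultimately have v: "- v \<in> lattice d" "- v + unit j \<in> lattice d" .
  have cells: "- v \<in> cell c \<longleftrightarrow> \<kappa> y = v" "- v + unit j \<in> cell c \<longleftrightarrow> \<kappa> (act (unit j) y) + unit j = v"
    unfolding cell_def mem_Collect_eq yc using v by (auto simp: algebra_simps)
  have "- v \<in> exits c j \<union> entries c j \<and> k < nat (if - v \<in> cell c then \<psi> j (act (- v) c) else - \<psi> j (act (- v) c))"
    unfolding yc exits_def entries_def Un_iff mem_Collect_eq cells using y(3,4)
    by (auto simp: v_def ctr_shift_def crossing_def split: if_splits)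
  then show ?thesis using y(1) by (simp add: outs_def v_def[symmetric] c_def[symmetric])
qed

lemma outs_units:
  assumes "c \<in> torus" "(j, n, k) \<in> outs \<psi> c"
  shows "(j, act n c, k) \<in> units \<psi>" "ctr_shift \<psi> j (act n c) = - n"
proof -
  have j: "j < d" and n: "n \<in> exits c j \<union> entries c j"
    and k: "k < nat (if n \<in> cell c then \<psi> j (act n c) else - \<psi> j (act n c))"
    using assms(2) by (auto simp: outs_def)
  have lat: "n \<in> lattice d" using n entries_lattice[OF j] cell_lattice by (auto simp: exits_def)
  have "n + unit j \<in> lattice d" using lat j by (simp add: lattice_add lattice_unit)
  then have cells: "n \<in> cell c \<longleftrightarrow> \<kappa> (act n c) = - n"
    "n + unit j \<in> cell c \<longleftrightarrow> \<kappa> (act (unit j) (act n c)) + unit j = - n"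
    unfolding cell_def mem_Collect_eq act_step using lat by (auto simp: algebra_simps)
  then have "crossing j (act n c)" using n by (auto simp: crossing_def exits_def entries_def)
  then show "(j, act n c, k) \<in> units \<psi>" using j k by (auto simp: units_def split: if_splits)
  show "ctr_shift \<psi> j (act n c) = - n" using n k cells by (auto simp: ctr_shift_def exits_def entries_def split: if_splits)
qed

lemma points_ctr:
  assumes "c \<in> torus" "n \<in> points A c"
  shows "act n c \<in> A" "\<kappa> (act n c) = - n" "act (\<kappa> (act n c)) (act n c) = c" "n \<in> lattice d"
proof -
  have n: "n \<in> lattice d" "\<kappa> (act n c) = - n" "act n c \<in> A" using assms by (auto simp: points_def cell_def)
  then show "act n c \<in> A" "\<kappa> (act n c) = - n" "n \<in> lattice d" by blast+
  show "act (\<kappa> (act n c)) (act n c) = c" unfolding n(2) by (rule act_cancel(1)[OF assms(1)])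
qed

lemma ctr_points:
  assumes "A \<subseteq> torus" "a \<in> A" shows "- \<kappa> a \<in> points A (act (\<kappa> a) a)" "act (- \<kappa> a) (act (\<kappa> a) a) = a"
proof -
  have a: "a \<in> torus" using assms by blast
  show eq: "act (- \<kappa> a) (act (\<kappa> a) a) = a" by (rule act_cancel(1)[OF a])
  show "- \<kappa> a \<in> points A (act (\<kappa> a) a)"
    unfolding points_def cell_def mem_Collect_eq eq
    using assms(2) lattice_minus[OF \<kappa>_lattice[OF a]] by (simp only: minus_minus simp_thms)
qed

context
  fixes A :: "(real^'k) set" and \<psi> :: "nat \<Rightarrow> real^'k \<Rightarrow> int"
  assumes A: "A \<subseteq> torus"
    and enough: "\<And>c. c \<in> torus \<Longrightarrow> card (outs \<psi> c) \<le> card (points A c)"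
begin

lemma slot_sel:
  assumes z: "(j, y, k) \<in> units \<psi>"
  obtains n c where "c \<in> torus" "c = act (ctr_shift \<psi> j y) y" "n = sel (points A c) (outs \<psi> c) (j, - ctr_shift \<psi> j y, k)"
    "n \<in> points A c" "place A \<psi> (j, y, k) = act n c" "slot A \<psi> j k y = n + ctr_shift \<psi> j y"
proof -
  define c where "c = act (ctr_shift \<psi> j y) y"
  define n where "n = sel (points A c) (outs \<psi> c) (j, - ctr_shift \<psi> j y, k)"
  have c: "c \<in> torus" by (simp add: c_def)
  have "(j, - ctr_shift \<psi> j y, k) \<in> outs \<psi> c" unfolding c_def by (rule units_outs[OF z])
  then have "n \<in> points A c"
    unfolding n_def using sel(2)[OF finite_points finite_outs enough[OF c]] by blast
  moreover have "slot A \<psi> j k y = n + ctr_shift \<psi> j y" by (simp add: slot_def n_def c_def Let_def)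
  moreover from this have "place A \<psi> (j, y, k) = act n c" by (simp add: place_def act_add c_def)
  ultimately show thesis using that c c_def n_def by blast
qed

text \<open>The serving point determines its centre, injectivity of \<open>sel\<close> at that
  centre recovers the token, and the token with the centre gives back the edge.\<close>

lemma place_inj: "inj_on (place A \<psi>) (units \<psi>)"
proof (rule inj_onI)
  fix z z' assume z: "z \<in> units \<psi>" "z' \<in> units \<psi>" and eq: "place A \<psi> z = place A \<psi> z'"
  obtain j y k j' y' k' where zz: "z = (j, y, k)" "z' = (j', y', k')" by (cases z; cases z') auto
  have u: "(j, y, k) \<in> units \<psi>" "(j', y', k') \<in> units \<psi>" using z zz by auto
  obtain n c where n: "c \<in> torus" "c = act (ctr_shift \<psi> j y) y" "n = sel (points A c) (outs \<psi> c) (j, - ctr_shift \<psi> j y, k)"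
    "n \<in> points A c" "place A \<psi> (j, y, k) = act n c" "slot A \<psi> j k y = n + ctr_shift \<psi> j y"
    by (rule slot_sel[OF u(1)])
  obtain n' c' where n': "c' \<in> torus" "c' = act (ctr_shift \<psi> j' y') y'" "n' = sel (points A c') (outs \<psi> c') (j', - ctr_shift \<psi> j' y', k')"
    "n' \<in> points A c'" "place A \<psi> (j', y', k') = act n' c'" "slot A \<psi> j' k' y' = n' + ctr_shift \<psi> j' y'"
    by (rule slot_sel[OF u(2)])
  have "act n c = act n' c'" using eq n(5) n'(5) zz by simp
  then have "- n = - n'" "c = c'"
    using points_ctr(2,3)[OF n(1,4)] points_ctr(2,3)[OF n'(1,4)] by (simp_all only:)
  then have nn: "n = n'" "c = c'" by (simp_all only: neg_equal_iff_equal)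
  have "(j, - ctr_shift \<psi> j y, k) \<in> outs \<psi> c" "(j', - ctr_shift \<psi> j' y', k') \<in> outs \<psi> c"
    using units_outs[OF u(1)] units_outs[OF u(2)] unfolding n(2)[symmetric] n'(2)[symmetric] nn by blast+
  moreover have "sel (points A c) (outs \<psi> c) (j, - ctr_shift \<psi> j y, k) = sel (points A c) (outs \<psi> c) (j', - ctr_shift \<psi> j' y', k')"
    using n(3) n'(3) nn by simp
  ultimately have "(j, - ctr_shift \<psi> j y, k) = (j', - ctr_shift \<psi> j' y', k')"
    using sel(1)[OF finite_points finite_outs enough[OF n(1)]] by (meson inj_onD)
  then have jk: "j = j'" "k = k'" "ctr_shift \<psi> j y = ctr_shift \<psi> j' y'"
    unfolding prod.inject neg_equal_iff_equal by blast+
  moreover have "y = y'"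
  proof -
    have "y \<in> torus" "y' \<in> torus" using u by (auto simp: units_def)
    then have "y = act (- ctr_shift \<psi> j y) c" "y' = act (- ctr_shift \<psi> j' y') c'"
      unfolding n(2) n'(2) by (simp_all only: act_cancel(1))
    then show ?thesis unfolding nn(2) jk(3) by (simp only:)
  qed
  ultimately show "z = z'" using zz by simp
qed

lemma place_mem: assumes "z \<in> units \<psi>" shows "place A \<psi> z \<in> A"
proof -
  obtain j y k where z: "z = (j, y, k)" by (cases z) auto
  obtain n c where n: "c \<in> torus" "c = act (ctr_shift \<psi> j y) y" "n = sel (points A c) (outs \<psi> c) (j, - ctr_shift \<psi> j y, k)"
    "n \<in> points A c" "place A \<psi> (j, y, k) = act n c" "slot A \<psi> j k y = n + ctr_shift \<psi> j y"
    by (rule slot_sel[OF assms[unfolded z]])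
  show ?thesis unfolding z n(5) by (rule points_ctr(1)[OF n(1,4)])
qed

text \<open>Whether a point serves a unit is decided inside its own cell.\<close>

lemma place_iff:
  assumes a: "a \<in> A"
  shows "a \<in> place A \<psi> ` units \<psi> \<longleftrightarrow> - \<kappa> a \<notin> rest A \<psi> (act (\<kappa> a) a)"
proof -
  define c where "c = act (\<kappa> a) a"
  have c: "c \<in> torus" by (simp add: c_def)
  have pa: "- \<kappa> a \<in> points A c" "act (- \<kappa> a) c = a" using ctr_points[OF A a] by (auto simp: c_def)
  have "a \<in> place A \<psi> ` units \<psi> \<longleftrightarrow> - \<kappa> a \<in> sel (points A c) (outs \<psi> c) ` outs \<psi> c"
  proof
    assume "a \<in> place A \<psi> ` units \<psi>"
    then obtain j y k where z: "(j, y, k) \<in> units \<psi>" "a = place A \<psi> (j, y, k)" by auto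
    obtain n c' where n: "c' \<in> torus" "c' = act (ctr_shift \<psi> j y) y" "n = sel (points A c') (outs \<psi> c') (j, - ctr_shift \<psi> j y, k)"
      "n \<in> points A c'" "place A \<psi> (j, y, k) = act n c'" "slot A \<psi> j k y = n + ctr_shift \<psi> j y"
      by (rule slot_sel[OF z(1)])
    have "a = act n c'" using z(2) n(5) by simp
    then have "\<kappa> a = - n" "c' = c" using points_ctr(2,3)[OF n(1,4)] by (auto simp only: c_def)
    then have "- \<kappa> a = sel (points A c) (outs \<psi> c) (j, - ctr_shift \<psi> j y, k)" using n(3) by (simp only: minus_minus)
    moreover have "(j, - ctr_shift \<psi> j y, k) \<in> outs \<psi> c" using units_outs[OF z(1)] n(2) \<open>c' = c\<close> by (simp only:)
    ultimately show "- \<kappa> a \<in> sel (points A c) (outs \<psi> c) ` outs \<psi> c" by (rule image_eqI)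
  next
    assume "- \<kappa> a \<in> sel (points A c) (outs \<psi> c) ` outs \<psi> c"
    then obtain j n k where o: "(j, n, k) \<in> outs \<psi> c" "- \<kappa> a = sel (points A c) (outs \<psi> c) (j, n, k)" by auto
    note u = outs_units[OF c o(1)]
    have "place A \<psi> (j, act n c, k) = act (sel (points A c) (outs \<psi> c) (j, n, k)) c"
      unfolding place_def slot_def Let_def prod.case act_add u(2) act_cancel(1)[OF c] by simp
    then have "place A \<psi> (j, act n c, k) = a" using o(2) pa(2) by simp
    then show "a \<in> place A \<psi> ` units \<psi>" using u(1) by force
  qed
  then show ?thesis using pa(1) by (auto simp: rest_def c_def)
qed

lemma card_rest: "c \<in> torus \<Longrightarrow> card (rest A \<psi> c) = card (points A c) - card (outs \<psi> c)"
  using sel[OF finite_points finite_outs enough, of c] unfolding rest_def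
  by (simp add: card_Diff_subset card_image finite_outs)

lemma slot_bound:
  assumes z: "(j, y, k) \<in> units \<psi>"
  shows "slot A \<psi> j k y \<in> lbox d (\<lambda>_. {- (2 * R + 1)..2 * R + 1})"
proof -
  have jy: "j < d" "y \<in> torus" using z by (auto simp: units_def)
  obtain n c where "c \<in> torus" "c = act (ctr_shift \<psi> j y) y" "n = sel (points A c) (outs \<psi> c) (j, - ctr_shift \<psi> j y, k)"
    and n': "n \<in> points A c" "place A \<psi> (j, y, k) = act n c" "slot A \<psi> j k y = n + ctr_shift \<psi> j y"
    by (rule slot_sel[OF z])
  note n = this(1) n'(1,3)
  have nc: "n \<in> cell c" using n by (simp add: points_def)
  have \<kappa>b: "\<bar>\<kappa> x i\<bar> < R" if "x \<in> torus" "i < d" for x i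
    using sq_coordinate[OF nearest_sq[OF that(1) \<kappa>_nearest[OF that(1)]] that(2)] .
  have "- (2 * R + 1) \<le> slot A \<psi> j k y i \<and> slot A \<psi> j k y i \<le> 2 * R + 1" if i: "i < d" for i
  proof -
    have "\<bar>ctr_shift \<psi> j y i\<bar> \<le> R + 1"
      using \<kappa>b[OF jy(2) i] \<kappa>b[OF act_torus i, of "unit j" y] by (auto simp: ctr_shift_def unit_def)
    moreover have "\<bar>n i\<bar> < R" by (rule sq_coordinate[OF cell_sq[OF nc] i])
    moreover have "slot A \<psi> j k y i = n i + ctr_shift \<psi> j y i" using n(3) by simp
    ultimately show ?thesis by linarith
  qed
  moreover have "slot A \<psi> j k y \<in> lattice d"
    using n cell_lattice[OF nc] ctr_shift_lattice[OF jy(2,1)] by (simp add: lattice_add)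
  ultimately show ?thesis by (auto simp: lbox_def)
qed

end

section \<open>Measurability of the cell data\<close>

lemma countable_lattice: "countable (lattice e)"
proof -
  have "countable (PiE {..<e} (\<lambda>_. UNIV :: int set))" by (rule countable_PiE) auto
  moreover have "lattice e = lbox e (\<lambda>_. UNIV)" by (auto simp: lbox_def)
  ultimately show ?thesis
    unfolding bij_betw_imp_surj_on[OF lbox_bij[of e "\<lambda>_. UNIV"], symmetric] by simp
qed

lemma \<kappa>_dmeas: "dmeas M \<kappa>"
proof -
  have ctrs: "dmeas M (\<lambda>x. n \<in> ctrs x)" for n
    unfolding ctrs_def mem_Collect_eq
    by (intro dmeas_comp2[of _ _ _ "(\<and>)"] dmeas_const dmeas_shift[OF dmeas_mem[OF U_sets] act_meas])
  have key: "dmeas M (\<lambda>x. key x n)" for n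
    unfolding key_def
    by (rule dmeas_comp[of _ _ "\<lambda>t. K * sq n + int t"]) (rule dmeas_shift[OF col_meas act_meas])
  have near: "dmeas M (\<lambda>x. nearest x n)" for n
  proof -
    have "dmeas M (\<lambda>x. n \<in> ctrs x \<and> (\<forall>m\<in>lattice d. m \<in> ctrs x \<longrightarrow> key x n \<le> key x m))"
      by (intro dmeas_comp2[of _ _ _ "(\<and>)"] dmeas_all countable_lattice ctrs
          dmeas_comp3[of _ _ _ _ "\<lambda>a b c. a \<longrightarrow> b \<le> c"] key)
    moreover have "(\<lambda>x. nearest x n) = (\<lambda>x. n \<in> ctrs x \<and> (\<forall>m\<in>lattice d. m \<in> ctrs x \<longrightarrow> key x n \<le> key x m))"
      by (auto simp: nearest_def ctrs_def)
    ultimately show ?thesis by simp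
  qed
  show ?thesis
    unfolding dmeas_def
  proof (intro conjI allI)
    show "countable (\<kappa> ` space M)"
      using \<kappa>_lattice by (auto simp: space_M intro!: countable_subset[OF _ countable_lattice[of d]])
    fix v
    have "{x \<in> space M. \<kappa> x = v} = {x \<in> space M. nearest x v}" using \<kappa>_iff by (auto simp: space_M)
    then show "{x \<in> space M. \<kappa> x = v} \<in> sets M" using dmeas_pred[OF near] by simp
  qed
qed

lemma cell_dmeas: "dmeas M cell"
proof (rule dmeas_finite_set)
  show "finite (lbox d (\<lambda>_. {- R..R}))" by (simp add: finite_lbox)
  show "dmeas M (\<lambda>x. n \<in> cell x)" for n
    unfolding cell_def mem_Collect_eq
    by (intro dmeas_comp2[of _ _ _ "(\<and>)"] dmeas_const dmeas_comp[of _ _ "\<lambda>a. a = - n"] dmeas_shift[OF \<kappa>_dmeas act_meas])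
qed (rule cell_window)

lemma points_dmeas: assumes "A \<in> sets M" shows "dmeas M (points A)"
proof (rule dmeas_finite_set)
  show "finite (lbox d (\<lambda>_. {- R..R}))" by (simp add: finite_lbox)
  show "points A x \<subseteq> lbox d (\<lambda>_. {- R..R})" for x using cell_window by (auto simp: points_def)
  show "dmeas M (\<lambda>x. n \<in> points A x)" for n
    unfolding points_def mem_Collect_eq
    by (intro dmeas_comp2[of _ _ _ "(\<and>)"] dmeas_comp[of _ _ "\<lambda>C. n \<in> C", OF cell_dmeas]
        dmeas_shift[OF dmeas_mem[OF assms] act_meas])
qed

lemma outs_dmeas:
  assumes \<psi>: "\<And>j. j < d \<Longrightarrow> dmeas M (\<psi> j)" and m: "\<And>j x. j < d \<Longrightarrow> x \<in> torus \<Longrightarrow> \<bar>\<psi> j x\<bar> \<le> m"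
  shows "dmeas M (outs \<psi>)"
proof (rule dmeas_finite_set)
  \<comment> \<open>Entries lie one step outside the cell, hence the translated windows.\<close>
  let ?W = "{..<d} \<times> (\<Union>j<d. lbox d (\<lambda>_. {- R..R}) \<union> (\<lambda>n. n - unit j) ` lbox d (\<lambda>_. {- R..R})) \<times> {..<nat m}"
  show "finite ?W" by (simp add: finite_lbox)
  show "outs \<psi> x \<subseteq> ?W" if x: "x \<in> space M" for x
  proof
    fix z assume "z \<in> outs \<psi> x"
    then obtain j n k where z: "z = (j, n, k)" "j < d" "n \<in> exits x j \<union> entries x j"
      "k < nat (if n \<in> cell x then \<psi> j (act n x) else - \<psi> j (act n x))" by (auto simp: outs_def)
    have "n \<in> lbox d (\<lambda>_. {- R..R}) \<union> (\<lambda>n. n - unit j) ` lbox d (\<lambda>_. {- R..R})"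
      using z(3) cell_window[of x] by (auto simp: exits_eq entries_eq)
    moreover have "k < nat m" using z(4) m[OF z(2) act_torus, of n x] by (auto split: if_splits)
    ultimately show "z \<in> ?W" using z(1,2) by auto
  qed
  fix w assume "w \<in> ?W"
  then obtain j n k where w: "w = (j, n, k)" "j < d" by auto
  have "dmeas M (\<lambda>x. (\<lambda>C v. (n \<in> C \<and> n + unit j \<notin> C \<or> n \<notin> C \<and> n + unit j \<in> C) \<and>
      k < nat (if n \<in> C then v else - v)) (cell x) (\<psi> j (act n x)))"
    by (rule dmeas_comp2[OF cell_dmeas dmeas_shift[OF \<psi>[OF w(2)] act_meas]])
  then show "dmeas M (\<lambda>x. w \<in> outs \<psi> x)"
    using w by (simp add: outs_def exits_def entries_def)
qed

lemma ctr_shift_dmeas: assumes "dmeas M (\<psi> j)" shows "dmeas M (ctr_shift \<psi> j)"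
proof -
  have "dmeas M (\<lambda>y. (\<lambda>a b c. if 0 < a then b else c + unit j) (\<psi> j y) (\<kappa> y) (\<kappa> (act (unit j) y)))"
    by (rule dmeas_comp3[OF assms \<kappa>_dmeas dmeas_shift[OF \<kappa>_dmeas act_meas]])
  then show ?thesis by (simp add: ctr_shift_def[abs_def])
qed

lemma slot_dmeas:
  assumes A: "A \<in> sets M" and \<psi>: "\<And>j. j < d \<Longrightarrow> dmeas M (\<psi> j)"
    and m: "\<And>j x. j < d \<Longrightarrow> x \<in> torus \<Longrightarrow> \<bar>\<psi> j x\<bar> \<le> m" and j: "j < d"
  shows "dmeas M (slot A \<psi> j k)"
proof -
  have "dmeas M (\<lambda>y. (\<lambda>v y. sel (points A (act v y)) (outs \<psi> (act v y)) (j, - v, k) + v) (ctr_shift \<psi> j y) y)"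
  proof (rule dmeas_dep[OF ctr_shift_dmeas[of \<psi>, OF \<psi>[OF j]]])
    fix v
    show "dmeas M (\<lambda>y. sel (points A (act v y)) (outs \<psi> (act v y)) (j, - v, k) + v)"
      by (rule dmeas_comp2[where h = "\<lambda>S Z. sel S Z (j, - v, k) + v"])
        (intro dmeas_shift[OF _ act_meas] points_dmeas A outs_dmeas[OF \<psi> m]; assumption)+
  qed
  then show ?thesis by (simp add: slot_def[abs_def] Let_def)
qed

lemma rest_dmeas:
  assumes A: "A \<in> sets M" and \<psi>: "\<And>j. j < d \<Longrightarrow> dmeas M (\<psi> j)"
    and m: "\<And>j x. j < d \<Longrightarrow> x \<in> torus \<Longrightarrow> \<bar>\<psi> j x\<bar> \<le> m"
  shows "dmeas M (rest A \<psi>)"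
  unfolding rest_def[abs_def]
  by (rule dmeas_comp2[OF points_dmeas[OF A] outs_dmeas[of \<psi>, OF \<psi> m]]) auto

text \<open>Every unit of flow leaving a cell is served by its own point of \<open>A\<close> in that cell, and every
  unit entering a cell by its own point of \<open>B\<close>; the remaining points of \<open>A\<close> and \<open>B\<close> in a cell are
  equinumerous. Following each unit of flow across one cell boundary gives the bijection.\<close>

lemma bounded_bijection:
  assumes AB: "A \<in> sets M" "B \<in> sets M" and \<psi>: "\<And>j. j < d \<Longrightarrow> dmeas M (\<psi> j)"
    and m: "\<And>j x. j < d \<Longrightarrow> x \<in> torus \<Longrightarrow> \<bar>\<psi> j x\<bar> \<le> m"
    and div: "\<And>x. x \<in> torus \<Longrightarrow> (\<Sum>j<d. \<psi> j x - \<psi> j (act (- unit j) x)) = of_bool (x \<in> A) - of_bool (x \<in> B)"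
    and enoughA: "\<And>c. c \<in> torus \<Longrightarrow> card (outs \<psi> c) \<le> card (points A c)"
    and enoughB: "\<And>c. c \<in> torus \<Longrightarrow> card (outs (\<lambda>j x. - \<psi> j x) c) \<le> card (points B c)"
  obtains \<Theta> W where "bij_betw \<Theta> A B" "finite W" "W \<subseteq> lattice d" "\<And>a. a \<in> A \<Longrightarrow> \<exists>v\<in>W. \<Theta> a = act v a"
    "\<And>v. v \<in> lattice d \<Longrightarrow> {a \<in> A. \<Theta> a = act v a} \<in> sets M"
proof -
  let ?\<psi>' = "\<lambda>j x. - \<psi> j x"
  have At: "A \<subseteq> torus" and Bt: "B \<subseteq> torus"
    using sets.sets_into_space[OF AB(1)] sets.sets_into_space[OF AB(2)] by (auto simp: space_M)
  have \<psi>': "\<And>j. j < d \<Longrightarrow> dmeas M (?\<psi>' j)" by (rule dmeas_comp[OF \<psi>])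
  have m': "\<And>j x. j < d \<Longrightarrow> x \<in> torus \<Longrightarrow> \<bar>?\<psi>' j x\<bar> \<le> m" using m by simp
  define F where "F = place A \<psi>"
  define G where "G = place B ?\<psi>'"
  have F_inj: "inj_on F (units \<psi>)" unfolding F_def by (rule place_inj[OF At enoughA])
  have G_inj: "inj_on G (units \<psi>)" unfolding G_def using place_inj[OF Bt enoughB] by (simp add: units_neg)
  have F_A: "F ` units \<psi> \<subseteq> A" using place_mem[OF At enoughA] by (auto simp: F_def)
  have G_B: "G ` units \<psi> \<subseteq> B" using place_mem[OF Bt enoughB] by (auto simp: G_def units_neg)
  have F_iff: "a \<in> F ` units \<psi> \<longleftrightarrow> - \<kappa> a \<notin> rest A \<psi> (act (\<kappa> a) a)" if "a \<in> A" for a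
    unfolding F_def by (rule place_iff[OF At enoughA that])
  have G_iff: "b \<in> G ` units \<psi> \<longleftrightarrow> - \<kappa> b \<notin> rest B ?\<psi>' (act (\<kappa> b) b)" if "b \<in> B" for b
    unfolding G_def using place_iff[OF Bt enoughB that] by (simp only: units_neg)
  define \<beta> where "\<beta> c = bsel (rest A \<psi> c) (rest B ?\<psi>' c)" for c
  have \<beta>: "bij_betw (\<beta> c) (rest A \<psi> c) (rest B ?\<psi>' c)" if c: "c \<in> torus" for c
    unfolding \<beta>_def
  proof (rule bsel)
    show "card (rest A \<psi> c) = card (rest B ?\<psi>' c)"
      using cell_balance[OF c div] card_rest[OF At enoughA c] card_rest[OF Bt enoughB c]
        enoughA[OF c] enoughB[OF c] by linarith
  qed (auto simp: rest_def finite_points)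
  define disp where "disp a = \<beta> (act (\<kappa> a) a) (- \<kappa> a) + \<kappa> a" for a
  define h where "h a = act (disp a) a" for a
  have h_eq: "h a = act (\<beta> (act (\<kappa> a) a) (- \<kappa> a)) (act (\<kappa> a) a)" for a
    by (simp add: h_def disp_def act_add)
  have h_ctr: "\<beta> (act (\<kappa> a) a) (- \<kappa> a) \<in> rest B ?\<psi>' (act (\<kappa> a) a)" "h a \<in> B"
      "\<kappa> (h a) = - \<beta> (act (\<kappa> a) a) (- \<kappa> a)" "act (\<kappa> (h a)) (h a) = act (\<kappa> a) a"
    if a: "a \<in> A - F ` units \<psi>" for a
  proof -
    let ?c = "act (\<kappa> a) a"
    have "- \<kappa> a \<in> rest A \<psi> ?c" using F_iff[of a] a by blast
    then show r: "\<beta> ?c (- \<kappa> a) \<in> rest B ?\<psi>' ?c"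
      using bij_betwE[OF \<beta>[OF act_torus]] by blast
    then have "\<beta> ?c (- \<kappa> a) \<in> points B ?c" by (simp add: rest_def)
    note p = points_ctr[OF act_torus this]
    show "h a \<in> B" "\<kappa> (h a) = - \<beta> ?c (- \<kappa> a)" "act (\<kappa> (h a)) (h a) = ?c"
      unfolding h_eq using p by blast+
  qed
  have h_bij: "bij_betw h (A - F ` units \<psi>) (B - G ` units \<psi>)"
    unfolding bij_betw_def
  proof
    show "inj_on h (A - F ` units \<psi>)"
    proof (rule inj_onI)
      fix a a' assume a: "a \<in> A - F ` units \<psi>" "a' \<in> A - F ` units \<psi>" "h a = h a'"
      have c: "act (\<kappa> a) a = act (\<kappa> a') a'" using h_ctr(4)[OF a(1)] h_ctr(4)[OF a(2)] a(3) by simp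
      have "- \<beta> (act (\<kappa> a) a) (- \<kappa> a) = - \<beta> (act (\<kappa> a') a') (- \<kappa> a')"
        unfolding h_ctr(3)[OF a(1), symmetric] h_ctr(3)[OF a(2), symmetric] a(3) ..
      then have "\<beta> (act (\<kappa> a) a) (- \<kappa> a) = \<beta> (act (\<kappa> a) a) (- \<kappa> a')"
        unfolding c by (simp only: neg_equal_iff_equal)
      moreover have "- \<kappa> a \<in> rest A \<psi> (act (\<kappa> a) a)" "- \<kappa> a' \<in> rest A \<psi> (act (\<kappa> a) a)"
        using F_iff[of a] F_iff[of a'] a c by auto
      ultimately have k: "- \<kappa> a = - \<kappa> a'"
        by (rule inj_onD[OF bij_betw_imp_inj_on[OF \<beta>[OF act_torus]]])
      have "a = act (- \<kappa> a) (act (\<kappa> a) a)" by (rule ctr_points(2)[OF At, symmetric]) (use a in blast)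
      also have "\<dots> = act (- \<kappa> a') (act (\<kappa> a') a')" unfolding c k ..
      also have "\<dots> = a'" by (rule ctr_points(2)[OF At]) (use a in blast)
      finally show "a = a'" .
    qed
    show "h ` (A - F ` units \<psi>) = B - G ` units \<psi>"
    proof (intro equalityI subsetI)
      fix b assume "b \<in> h ` (A - F ` units \<psi>)"
      then obtain a where a: "a \<in> A - F ` units \<psi>" "b = h a" by blast
      have "- \<kappa> b \<in> rest B ?\<psi>' (act (\<kappa> b) b)" using h_ctr[OF a(1)] a(2) by simp
      moreover have "b \<in> B" using h_ctr(2)[OF a(1)] a(2) by simp
      ultimately show "b \<in> B - G ` units \<psi>" using G_iff[of b] by blast
    next
      fix b assume b: "b \<in> B - G ` units \<psi>"
      let ?c = "act (\<kappa> b) b"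
      have "- \<kappa> b \<in> rest B ?\<psi>' ?c" using G_iff[of b] b by blast
      then have "- \<kappa> b \<in> \<beta> ?c ` rest A \<psi> ?c"
        using bij_betw_imp_surj_on[OF \<beta>[OF act_torus[of "\<kappa> b" b]]] by simp
      then obtain n where n: "n \<in> rest A \<psi> ?c" "\<beta> ?c n = - \<kappa> b" by (metis imageE)
      have "n \<in> points A ?c" using n by (simp add: rest_def)
      note p = points_ctr[OF act_torus this]
      have "act n ?c \<notin> F ` units \<psi>" using F_iff[OF p(1)] n(1) p(2,3) by simp
      moreover have "h (act n ?c) = b"
        unfolding h_eq p(3) using p(2) n(2) ctr_points(2)[OF Bt] b by simp
      ultimately show "b \<in> h ` (A - F ` units \<psi>)" using p(1) by force
    qed
  qed
  define \<Theta> where "\<Theta> a = (if a \<in> F ` units \<psi> then G (inv_into (units \<psi>) F a) else h a)" for a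
  have \<Theta>F: "\<Theta> (F z) = G z" if "z \<in> units \<psi>" for z
    using that F_inj by (auto simp: \<Theta>_def)
  have "bij_betw \<Theta> (F ` units \<psi>) (G ` units \<psi>)"
    unfolding bij_betw_def
  proof
    show "inj_on \<Theta> (F ` units \<psi>)" using G_inj by (auto simp: inj_on_def \<Theta>F)
    show "\<Theta> ` F ` units \<psi> = G ` units \<psi>" by (auto simp: \<Theta>F image_image)
  qed
  moreover have "bij_betw \<Theta> (A - F ` units \<psi>) (B - G ` units \<psi>)"
    using h_bij by (rule bij_betw_cong[THEN iffD1, rotated]) (auto simp: \<Theta>_def)
  ultimately have "bij_betw \<Theta> (F ` units \<psi> \<union> (A - F ` units \<psi>)) (G ` units \<psi> \<union> (B - G ` units \<psi>))"
    by (rule bij_betw_combine) auto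
  then have bij: "bij_betw \<Theta> A B" using F_A G_B by (simp add: Un_absorb1)
  \<comment> \<open>For measurability the unit served by \<open>a\<close> is described by the
    displacement \<open>p\<close> from \<open>a\<close> to its edge, of which there are countably
    many; \<open>slot A \<psi> j k (act p a) + p = 0\<close> says that the place of that unit is
    \<open>a\<close>. Then \<open>fin\<close> leads from \<open>a\<close> to the edge and on to the
    receiving point of \<open>B\<close>.\<close>
  define cond where "cond t a = (case t of (p, j, k) \<Rightarrow> crossing j (act p a) \<and> int k < \<bar>\<psi> j (act p a)\<bar> \<and>
      slot A \<psi> j k (act p a) + p = 0)" for t a
  define fin where "fin t a = (case t of (p, j, k) \<Rightarrow> slot B ?\<psi>' j k (act p a) + p)" for t a
  define T where "T = lattice d \<times> {..<d} \<times> (UNIV :: nat set)"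
  have T: "countable T" unfolding T_def by (intro countable_SIGMA countable_lattice) auto
  have slotA: "slot A \<psi> j k y \<in> lbox d (\<lambda>_. {- (2 * R + 1)..2 * R + 1})" if "(j, y, k) \<in> units \<psi>" for j y k
    by (rule slot_bound[OF At enoughA that])
  have slotB: "slot B ?\<psi>' j k y \<in> lbox d (\<lambda>_. {- (2 * R + 1)..2 * R + 1})" if "(j, y, k) \<in> units \<psi>" for j y k
    using slot_bound[OF Bt enoughB, of j y k] that unfolding units_neg by blast
  have cond: "(j, act p a, k) \<in> units \<psi> \<and> F (j, act p a, k) = a \<and> \<Theta> a = act (fin (p, j, k) a) a"
    if a: "a \<in> A" and c: "(p, j, k) \<in> T" "cond (p, j, k) a" for a p j k
  proof -
    have u: "(j, act p a, k) \<in> units \<psi>" using c by (auto simp: cond_def T_def units_def)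
    have "F (j, act p a, k) = act (slot A \<psi> j k (act p a) + p) a" by (simp add: F_def place_def act_add)
    also have "\<dots> = a" using c(2) a At act_0 by (auto simp: cond_def)
    finally have Fa: "F (j, act p a, k) = a" .
    then have "\<Theta> a = G (j, act p a, k)" using \<Theta>F[OF u] by simp
    then show ?thesis using u Fa by (simp add: G_def place_def fin_def act_add)
  qed
  have cond_ex: "\<exists>t\<in>T. cond t a" if a: "a \<in> F ` units \<psi>" for a
  proof -
    obtain j y k where z: "(j, y, k) \<in> units \<psi>" "a = F (j, y, k)" using a by auto
    have y: "y \<in> torus" "j < d" using z by (auto simp: units_def)
    let ?p = "- slot A \<psi> j k y"
    have "act ?p a = y" using act_cancel(1)[OF y(1)] z(2) by (simp add: F_def place_def)
    then have "cond (?p, j, k) a" using z(1) by (auto simp: cond_def units_def)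
    moreover have "(?p, j, k) \<in> T" using slotA[OF z(1)] y by (auto simp: T_def lbox_def lattice_minus)
    ultimately show ?thesis by blast
  qed
  \<comment> \<open>The total displacement is a difference of two slots, each bounded by
    \<open>2 * R + 1\<close> in every coordinate.\<close>
  define W where "W = lbox d (\<lambda>_. {- (4 * R + 2)..4 * R + 2})"
  have fin_W: "fin t a \<in> W" if a: "a \<in> A" and t: "t \<in> T" "cond t a" for a t
  proof -
    obtain p j k where tt: "t = (p, j, k)" by (cases t) auto
    have u: "(j, act p a, k) \<in> units \<psi>" using cond[OF a] t tt by blast
    have p: "p = - slot A \<psi> j k (act p a)" using t(2) by (auto simp: tt cond_def eq_neg_iff_add_eq_0 add.commute)
    note sA = slotA[OF u] and sB = slotB[OF u]
    have "fin t a i = slot B ?\<psi>' j k (act p a) i + p i" for i by (simp add: tt fin_def)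
    moreover have "p i = - slot A \<psi> j k (act p a) i" for i using fun_cong[OF p, of i] by simp
    ultimately have e: "fin t a i = slot B ?\<psi>' j k (act p a) i - slot A \<psi> j k (act p a) i" for i
      by (metis add_uminus_conv_diff)
    have "- (4 * R + 2) \<le> fin t a i \<and> fin t a i \<le> 4 * R + 2" if "i < d" for i
      using sA sB that unfolding e lbox_def by fastforce
    moreover have "fin t a \<in> lattice d"
      using sA sB unfolding lattice_def lbox_def by (auto simp: e)
    ultimately show ?thesis by (auto simp: W_def lbox_def)
  qed
  have disp_W: "disp a \<in> W" if a: "a \<in> A - F ` units \<psi>" for a
  proof -
    have at: "a \<in> torus" using a At by auto
    have b: "\<beta> (act (\<kappa> a) a) (- \<kappa> a) \<in> cell (act (\<kappa> a) a)"
      using h_ctr(1)[OF a] by (auto simp: rest_def points_def)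
    have "- (4 * R + 2) \<le> disp a i \<and> disp a i \<le> 4 * R + 2" if "i < d" for i
    proof -
      have "\<bar>\<kappa> a i\<bar> < R" by (rule sq_coordinate[OF nearest_sq[OF at \<kappa>_nearest[OF at]] that])
      moreover have "\<bar>\<beta> (act (\<kappa> a) a) (- \<kappa> a) i\<bar> < R" by (rule sq_coordinate[OF cell_sq[OF b] that])
      moreover have "disp a i = \<beta> (act (\<kappa> a) a) (- \<kappa> a) i + \<kappa> a i" by (simp add: disp_def)
      ultimately show ?thesis using R_pos by linarith
    qed
    moreover have "disp a \<in> lattice d"
      unfolding disp_def by (intro lattice_add cell_lattice[OF b] \<kappa>_lattice at)
    ultimately show ?thesis by (auto simp: W_def lbox_def)
  qed
  have Wl: "W \<subseteq> lattice d" by (auto simp: W_def lbox_def)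
  \<comment> \<open>Freeness makes the displacement unique, so an equation between points of the
    torus becomes one between countably valued functions.\<close>
  have \<Theta>_iff: "\<Theta> a = act v a \<longleftrightarrow> (\<exists>t\<in>T. cond t a \<and> fin t a = v) \<or> \<not> (\<exists>t\<in>T. cond t a) \<and> disp a = v"
    if a: "a \<in> A" and v: "v \<in> lattice d" for a v
  proof (cases "\<exists>t\<in>T. cond t a")
    case True
    have "\<Theta> a = act v a \<longleftrightarrow> fin t a = v" if t: "t \<in> T" "cond t a" for t
    proof -
      obtain p j k where tt: "t = (p, j, k)" by (cases t) auto
      have "\<Theta> a = act (fin t a) a" using cond[OF a] t tt by blast
      then show ?thesis using act_free[of a "fin t a" v] fin_W[OF a t] Wl v a At by auto
    qed
    then show ?thesis using True by blast
  next
    case False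
    then have aF: "a \<notin> F ` units \<psi>" using cond_ex by blast
    then have "\<Theta> a = act (disp a) a" by (simp add: \<Theta>_def h_def)
    then show ?thesis using False act_free[of a "disp a" v] disp_W[of a] aF Wl v a At by auto
  qed
  show thesis
  proof (rule that[OF bij _ Wl])
    show "finite W" by (simp add: W_def finite_lbox)
    fix a assume a: "a \<in> A"
    show "\<exists>v\<in>W. \<Theta> a = act v a"
    proof (cases "\<exists>t\<in>T. cond t a")
      case True
      then obtain t where t: "t \<in> T" "cond t a" by blast
      then have "fin t a \<in> W" using fin_W a by blast
      then show ?thesis using \<Theta>_iff[OF a, of "fin t a"] t Wl by blast
    next
      case False
      then have "disp a \<in> W" using disp_W a cond_ex by blast
      then show ?thesis using \<Theta>_iff[OF a, of "disp a"] False Wl by blast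
    qed
  next
    fix v assume v: "v \<in> lattice d"
    have cm: "dmeas M (cond t)" if "t \<in> T" for t
    proof -
      obtain p j k where tt: "t = (p, j, k)" by (cases t) auto
      have j: "j < d" using that by (simp add: T_def tt)
      have "dmeas M (crossing j)"
        unfolding crossing_def[abs_def]
        by (rule dmeas_comp2[where h = "\<lambda>a b. a \<noteq> b + unit j"], rule \<kappa>_dmeas, rule dmeas_shift[OF \<kappa>_dmeas act_meas])
      then have "dmeas M (\<lambda>y. crossing j y \<and> int k < \<bar>\<psi> j y\<bar> \<and> slot A \<psi> j k y + p = 0)"
        by (rule dmeas_comp3[where h = "\<lambda>a b c. a \<and> int k < \<bar>b\<bar> \<and> c + p = 0", OF _ \<psi>[OF j] slot_dmeas[OF AB(1) \<psi> m j]])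
      from dmeas_shift[OF this act_meas[of p]] show ?thesis by (simp add: cond_def[abs_def] tt)
    qed
    have fm: "dmeas M (fin t)" if "t \<in> T" for t
    proof -
      obtain p j k where tt: "t = (p, j, k)" by (cases t) auto
      have j: "j < d" using that by (simp add: T_def tt)
      have "dmeas M (\<lambda>y. slot B ?\<psi>' j k y + p)"
        by (rule dmeas_comp[OF slot_dmeas[OF AB(2) \<psi>' m' j]])
      from dmeas_shift[OF this act_meas[of p]] show ?thesis by (simp add: fin_def[abs_def] tt)
    qed
    have hm: "dmeas M disp"
    proof -
      have "dmeas M (\<lambda>a. (\<lambda>n a. bsel (rest A \<psi> (act n a)) (rest B ?\<psi>' (act n a)) (- n) + n) (\<kappa> a) a)"
      proof (rule dmeas_dep[OF \<kappa>_dmeas])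
        fix n
        show "dmeas M (\<lambda>a. bsel (rest A \<psi> (act n a)) (rest B ?\<psi>' (act n a)) (- n) + n)"
          by (rule dmeas_comp2[where h = "\<lambda>S T. bsel S T (- n) + n"])
            (rule dmeas_shift[OF rest_dmeas[OF AB(1) \<psi> m] act_meas], assumption+,
             rule dmeas_shift[OF rest_dmeas[OF AB(2) \<psi>' m'] act_meas], assumption+)
      qed
      then show ?thesis by (simp add: disp_def[abs_def] \<beta>_def)
    qed
    have "dmeas M (\<lambda>a. a \<in> A \<and> ((\<exists>t\<in>T. cond t a \<and> fin t a = v) \<or> \<not> (\<exists>t\<in>T. cond t a) \<and> disp a = v))"
      by (intro dmeas_comp2[of _ _ _ "(\<and>)"] dmeas_comp2[of _ _ _ "(\<or>)"] dmeas_mem AB dmeas_ex T cm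
          dmeas_comp[of _ _ "\<lambda>b. b = v"] dmeas_comp[of _ _ Not] fm hm)
    from dmeas_pred[OF this]
    have "{a \<in> space M. a \<in> A \<and> ((\<exists>t\<in>T. cond t a \<and> fin t a = v) \<or> \<not> (\<exists>t\<in>T. cond t a) \<and> disp a = v)} \<in> sets M" .
    also have "{a \<in> space M. a \<in> A \<and> ((\<exists>t\<in>T. cond t a \<and> fin t a = v) \<or> \<not> (\<exists>t\<in>T. cond t a) \<and> disp a = v)}
        = {a \<in> A. \<Theta> a = act v a}"
      using \<Theta>_iff[OF _ v] At by (auto simp: space_M)
    finally show "{a \<in> A. \<Theta> a = act v a} \<in> sets M" .
  qed
qed

end

section \<open>Equidecompositions\<close>

context torus_action
begin

lemma equidecomposition:
  assumes AB: "A \<in> sets M" "B \<in> sets M" and \<delta>: "0 < \<delta>"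
    and uA: "uniform_T Phi \<delta> xs A" and uB: "uniform_T Phi \<delta> xs B"
    and sP: "summable (\<lambda>i. Phi i / 2 ^ ((d - 1) * i))"
  shows "equidecomposable (\<lambda>S. S \<in> sets M) xs A B"
proof -
  have count: "\<bar>real (card {n \<in> cube d a (2 ^ i). act n x \<in> S}) - \<delta> * 2 ^ (d * i)\<bar> \<le> Phi i"
    if "uniform_T Phi \<delta> xs S" "x \<in> torus" for S x i a
  proof -
    have "\<bar>real (card (tsection x xs S \<inter> cube d a (2 ^ i))) - \<delta> * real (card (cube d a (2 ^ i)))\<bar> \<le> Phi i"
      using that by (auto simp: uniform_T_def uniform_Z_def len)
    moreover have "tsection x xs S \<inter> cube d a (2 ^ i) = {n \<in> cube d a (2 ^ i). act n x \<in> S}"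
      by (auto simp: tsection_def act_def cube_def len)
    moreover have "real (card (cube d a (2 ^ i))) = 2 ^ (d * i)"
      by (simp add: card_cube power_mult[symmetric] mult.commute)
    ultimately show ?thesis by simp
  qed
  define f :: "real^'k \<Rightarrow> real" where "f x = of_bool (x \<in> A) - of_bool (x \<in> B)" for x
  have fm: "f \<in> borel_measurable M"
  proof -
    have "(\<lambda>x. indicator A x - indicator B x :: real) \<in> borel_measurable M"
      using AB by (intro borel_measurable_diff borel_measurable_indicator)
    then show ?thesis by (simp add: f_def[abs_def] indicator_def of_bool_def)
  qed
  have fb: "\<bar>\<Sum>n\<in>cube d 0 (2 ^ i). f (act n x)\<bar> \<le> 2 * Phi i" if "x \<in> torus" for i x
  proof -
    have "(\<Sum>n\<in>cube d 0 (2 ^ i). of_bool (act n x \<in> S)) = real (card {n \<in> cube d 0 (2 ^ i). act n x \<in> S})" for S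
      by (simp add: sum_of_bool_eq finite_cube Int_def)
    then have "(\<Sum>n\<in>cube d 0 (2 ^ i). f (act n x)) = real (card {n \<in> cube d 0 (2 ^ i). act n x \<in> A})
        - real (card {n \<in> cube d 0 (2 ^ i). act n x \<in> B})"
      by (simp add: f_def sum_subtractf)
    then show ?thesis using count[OF uA that, of 0 i] count[OF uB that, of 0 i] by linarith
  qed
  have "summable (\<lambda>i. 2 * Phi i / 2 ^ ((d - 1) * i))" using summable_mult[OF sP, of 2] by simp
  then obtain \<phi> C where \<phi>: "\<And>j. \<phi> j \<in> borel_measurable M" "\<And>j x. x \<in> torus \<Longrightarrow> \<bar>\<phi> j x\<bar> \<le> C"
    "\<And>x. x \<in> torus \<Longrightarrow> (\<Sum>j<d. \<phi> j x - \<phi> j (act (- unit j) x)) = f x"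
    using real_flow[OF fm fb] by blast
  have f_Ints: "(\<Sum>j<d. \<phi> j x - \<phi> j (act (- unit j) x)) \<in> \<int>" if "x \<in> torus" for x
    unfolding \<phi>(3)[OF that] by (simp add: f_def)
  obtain \<psi> where \<psi>: "\<And>j. j < d \<Longrightarrow> dmeas M (\<psi> j)"
    "\<And>j x. j < d \<Longrightarrow> x \<in> torus \<Longrightarrow> \<bar>of_int (\<psi> j x) - \<phi> j x\<bar> \<le> real (2 + d)"
    "\<And>x. x \<in> torus \<Longrightarrow> of_int (\<Sum>j<d. \<psi> j x - \<psi> j (act (- unit j) x))
        = (\<Sum>j<d. \<phi> j x - \<phi> j (act (- unit j) x))"
  proof (rule integral_flow[OF \<phi>(1) f_Ints])
    fix \<psi> :: "nat \<Rightarrow> real^'k \<Rightarrow> int"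
    assume "\<And>j. j < d \<Longrightarrow> dmeas M (\<psi> j)"
      "\<And>j x. j < d \<Longrightarrow> x \<in> torus \<Longrightarrow> \<bar>of_int (\<psi> j x) - \<phi> j x\<bar> \<le> real (2 + d)"
      "\<And>x. x \<in> torus \<Longrightarrow> of_int (\<Sum>j<d. \<psi> j x - \<psi> j (act (- unit j) x))
        = (\<Sum>j<d. \<phi> j x - \<phi> j (act (- unit j) x))"
    then show thesis by (rule that)
  qed
  have div: "(\<Sum>j<d. \<psi> j x - \<psi> j (act (- unit j) x)) = of_bool (x \<in> A) - of_bool (x \<in> B)"
    if "x \<in> torus" for x
  proof -
    have "real_of_int (\<Sum>j<d. \<psi> j x - \<psi> j (act (- unit j) x)) = of_int (of_bool (x \<in> A) - of_bool (x \<in> B))"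
      unfolding \<psi>(3)[OF that] \<phi>(3)[OF that] by (simp add: f_def)
    then show ?thesis by (simp only: of_int_eq_iff)
  qed
  define m where "m = \<lceil>C + 2 + real d\<rceil>"
  have \<psi>_bound: "\<bar>\<psi> j x\<bar> \<le> m" if "j < d" "x \<in> torus" for j x
  proof -
    have "real_of_int \<bar>\<psi> j x\<bar> \<le> C + 2 + real d"
      using \<psi>(2)[OF that] \<phi>(2)[OF that(2), of j] by simp
    then show ?thesis unfolding m_def by linarith
  qed
  have "0 < d" using d2 by simp
  then have m0: "0 \<le> m" using \<psi>_bound[OF _ tproj_torus[of 0], of 0] by linarith
  \<comment> \<open>With \<open>2 * R + 1 \<le> (4 * d + 3) * 2 ^ i\<close> a cell has at most
    \<open>E * (2 ^ i) ^ (d - 1)\<close> outgoing units. A cube of side \<open>2 ^ i\<close> has at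
    least \<open>(\<delta> * 2 ^ i - 1) * (2 ^ i) ^ (d - 1)\<close> points of either set once
    \<open>Phi i\<close> is below \<open>2 ^ ((d - 1) * i)\<close>; hence the demand
    \<open>(E + 1) / \<delta> \<le> 2 ^ i\<close>.\<close>
  define E where "E = 2 * real d * real_of_int m * (4 * real d + 3) ^ (d - 1)"
  have "\<forall>\<^sub>F i in sequentially. Phi i / 2 ^ ((d - 1) * i) < 1"
    using summable_LIMSEQ_zero[OF sP] by (rule order_tendstoD) simp
  moreover have "\<forall>\<^sub>F i in sequentially. (E + 1) / \<delta> \<le> 2 ^ i"
  proof -
    obtain n where n: "(E + 1) / \<delta> < 2 ^ n" using real_arch_pow[of 2 "(E + 1) / \<delta>"] by auto
    show ?thesis
    proof (rule eventually_sequentiallyI[of n])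
      fix i assume "n \<le> i"
      then have "(2::real) ^ n \<le> 2 ^ i" by (rule power_increasing) simp
      then show "(E + 1) / \<delta> \<le> 2 ^ i" using n by linarith
    qed
  qed
  ultimately have "\<forall>\<^sub>F i in sequentially. Phi i / 2 ^ ((d - 1) * i) < 1 \<and> (E + 1) / \<delta> \<le> 2 ^ i"
    by (rule eventually_conj)
  then obtain i where i: "Phi i / 2 ^ ((d - 1) * i) < 1" "(E + 1) / \<delta> \<le> 2 ^ i"
    by (auto simp: eventually_sequentially)
  \<comment> \<open>Large enough that a cube of side \<open>2 ^ i\<close> with a corner at the
    centre satisfies \<open>4 * sq n < R\<^sup>2\<close>, as \<open>cell_contains\<close>
    requires.\<close>
  define R :: int where "R = 2 * int d * 2 ^ i + 1"
  have R_pos: "0 < R" by (simp add: R_def add_nonneg_pos)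
  have large: "real d * (2 * (2 * real_of_int R + 1) ^ (d - 1) * real_of_int m) \<le> \<delta> * 2 ^ (d * i) - Phi i"
  proof -
    have p: "(2::real) ^ ((d - 1) * i) = (2 ^ i) ^ (d - 1)" by (simp add: power_mult[symmetric] mult.commute)
    have di: "(2::real) ^ (d * i) = 2 ^ i * (2 ^ i) ^ (d - 1)"
      using d2 by (cases d) (auto simp: power_mult[symmetric] power_add[symmetric] mult.commute)
    have one: "(1::real) \<le> 2 ^ i" by simp
    have "2 * real_of_int R + 1 \<le> (4 * real d + 3) * 2 ^ i"
      using one by (simp add: R_def algebra_simps)
    then have "(2 * real_of_int R + 1) ^ (d - 1) \<le> ((4 * real d + 3) * 2 ^ i) ^ (d - 1)"
      using R_pos by (intro power_mono) auto
    then have "real d * (2 * (2 * real_of_int R + 1) ^ (d - 1) * real_of_int m)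
        \<le> real d * (2 * ((4 * real d + 3) * 2 ^ i) ^ (d - 1) * real_of_int m)"
      using m0 by (intro mult_left_mono mult_right_mono) auto
    also have "\<dots> = E * (2 ^ i) ^ (d - 1)" by (simp add: E_def power_mult_distrib)
    also have "\<dots> \<le> (\<delta> * 2 ^ i - 1) * (2 ^ i) ^ (d - 1)"
      using i(2) \<delta> by (intro mult_right_mono) (auto simp: field_simps)
    also have "\<dots> \<le> \<delta> * 2 ^ (d * i) - Phi i"
    proof -
      define X where "X = ((2::real) ^ i) ^ (d - 1)"
      have "0 < X" by (simp add: X_def)
      then have "Phi i < X" using i(1) unfolding p X_def[symmetric] by (simp add: divide_less_eq)
      then show ?thesis unfolding di X_def[symmetric] by (simp add: algebra_simps)
    qed
    finally show ?thesis .
  qed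
  define sq where "sq n = (\<Sum>i<d. (n i)\<^sup>2)" for n :: "nat \<Rightarrow> int"
  have sq_fin: "finite {n \<in> lattice d. n \<noteq> 0 \<and> sq n < b}" for b
  proof (rule finite_subset)
    show "{n \<in> lattice d. n \<noteq> 0 \<and> sq n < b} \<subseteq> lbox d (\<lambda>_. {- b..b})"
    proof
      fix n assume n: "n \<in> {n \<in> lattice d. n \<noteq> 0 \<and> sq n < b}"
      have "n l \<in> {- b..b}" if "l < d" for l
      proof -
        have "(n l)\<^sup>2 \<le> sq n" unfolding sq_def using that by (intro member_le_sum) auto
        moreover have "\<bar>n l\<bar> \<le> (n l)\<^sup>2"
        proof (cases "n l = 0")
          case False
          then have "\<bar>n l\<bar> \<le> \<bar>n l\<bar>\<^sup>2" by (intro self_le_power) auto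
          then show ?thesis by simp
        qed simp
        ultimately show ?thesis using n by auto
      qed
      then show "n \<in> lbox d (\<lambda>_. {- b..b})" using n by (simp add: lbox_def)
    qed
  qed (simp add: finite_lbox)
  \<comment> \<open>One colouring serves twice: for the greedy choice of centres, which needs it up
    to distance \<open>R\<close>, and for breaking ties, which needs \<open>2 * R\<close>.\<close>
  obtain col k where col: "dmeas M col" "\<And>x. x \<in> torus \<Longrightarrow> col x < (k::nat)"
    "\<And>x n. x \<in> torus \<Longrightarrow> n \<in> {n \<in> lattice d. n \<noteq> 0 \<and> sq n < 4 * R\<^sup>2} \<Longrightarrow> col (act n x) \<noteq> col x"
    using colour[OF sq_fin[of "4 * R\<^sup>2"]] by auto
  define \<FF> where "\<FF> = act ` {n \<in> lattice d. n \<noteq> 0 \<and> sq n < R\<^sup>2}"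
  obtain U where U: "U \<in> sets M" "\<And>x f. x \<in> U \<Longrightarrow> f \<in> \<FF> \<Longrightarrow> f x \<notin> U"
    "\<And>x. x \<in> space M \<Longrightarrow> x \<in> U \<or> (\<exists>f\<in>\<FF>. f x \<in> U)"
  proof (rule maximal_independent_set[of \<FF> M col k])
    show "finite \<FF>" unfolding \<FF>_def by (intro finite_imageI sq_fin)
    show "f \<in> measurable M M" if "f \<in> \<FF>" for f using that by (auto simp: \<FF>_def)
    show "\<exists>g\<in>\<FF>. \<forall>x\<in>space M. g (f x) = x" if "f \<in> \<FF>" for f
    proof -
      obtain n where n: "f = act n" "n \<in> lattice d" "n \<noteq> 0" "sq n < R\<^sup>2" using \<open>f \<in> \<FF>\<close> by (auto simp: \<FF>_def)
      then have "act (- n) \<in> \<FF>" by (auto simp: \<FF>_def lattice_minus sq_def intro!: imageI)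
      moreover have "\<forall>x\<in>space M. act (- n) (f x) = x"
        unfolding n(1) by (auto simp: act_add[symmetric] act_0 space_M)
      ultimately show ?thesis by blast
    qed
    have "sq n < 4 * R\<^sup>2" if "sq n < R\<^sup>2" for n using that zero_le_power2[of R] by linarith
    then show "col (f x) \<noteq> col x" if "x \<in> space M" "f \<in> \<FF>" for x f
      using that col(3)[of x] by (auto simp: \<FF>_def space_M)
  qed (use col in \<open>auto simp: space_M\<close>)
  interpret v: voronoi M N xs d U col "int k" R
  proof
    show "R\<^sup>2 \<le> (\<Sum>i<d. (w i)\<^sup>2)" if "c \<in> U" "w \<in> lattice d" "act w c \<in> U" "w \<noteq> 0" for c w
      using U(2)[of c "act w"] that unfolding \<FF>_def sq_def by force
    show "\<exists>n\<in>lattice d. (\<Sum>i<d. (n i)\<^sup>2) < R\<^sup>2 \<and> act n x \<in> U" if "x \<in> torus" for x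
    proof -
      have "x \<in> U \<or> (\<exists>f\<in>\<FF>. f x \<in> U)" using U(3)[of x] that by (simp add: space_M)
      then consider "x \<in> U" | n where "n \<in> lattice d" "sq n < R\<^sup>2" "act n x \<in> U"
        by (auto simp: \<FF>_def)
      then show ?thesis
      proof cases
        case 1
        then have "act 0 x \<in> U" using act_0[OF that] by simp
        then show ?thesis using R_pos by (intro bexI[of _ 0]) auto
      qed (auto simp: sq_def)
    qed
    show "col (act n x) \<noteq> col x" if "x \<in> torus" "n \<in> lattice d" "n \<noteq> 0" "(\<Sum>i<d. (n i)\<^sup>2) < 4 * R\<^sup>2" for x n
      using col(3)[of x n] that by (simp add: sq_def)
  qed (use U(1) R_pos col in auto)
  \<comment> \<open>Volume beats surface: at a centre the cell contains a cube of side
    \<open>2 ^ i\<close>, whose points are counted by uniformity, while \<open>card_outs_le\<close>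
    bounds the tokens.\<close>
  have enough: "card (v.outs \<chi>' c) \<le> card (v.points S c)"
    if \<chi>': "\<And>j x. j < d \<Longrightarrow> x \<in> torus \<Longrightarrow> \<bar>\<chi>' j x\<bar> \<le> m" and S: "uniform_T Phi \<delta> xs S" and c: "c \<in> torus" for \<chi>' S c
  proof (cases "c \<in> U")
    case False
    then have "v.cell c = {}" using v.cell_U[OF c] by blast
    then have "v.outs \<chi>' c = {}" by (auto simp: v.outs_def v.exits_def v.entries_def)
    then show ?thesis by simp
  next
    case True
    have "{n \<in> cube d 0 (2 ^ i). act n c \<in> S} \<subseteq> v.points S c"
    proof clarify
      fix n assume n: "n \<in> cube d 0 (2 ^ i)" "act n c \<in> S"
      have "4 * v.sq n < R\<^sup>2"
      proof -
        have "v.sq n \<le> (\<Sum>l<d. (2 ^ i)\<^sup>2)" unfolding v.sq_def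
          using n(1) by (intro sum_mono power_mono) (auto simp: cube_def)
        then have "4 * v.sq n \<le> 4 * (int d * (2 ^ i)\<^sup>2)" by simp
        also have "\<dots> \<le> 4 * ((int d)\<^sup>2 * (2 ^ i)\<^sup>2)"
          using d2 by (intro mult_left_mono mult_right_mono self_le_power) auto
        also have "\<dots> = (2 * int d * 2 ^ i)\<^sup>2" by (simp add: power_mult_distrib)
        also have "\<dots> < R\<^sup>2" unfolding R_def by (intro power_strict_mono) auto
        finally show ?thesis .
      qed
      then have "n \<in> v.cell c" using v.cell_contains[OF True] n by (auto simp: cube_def)
      then show "n \<in> v.points S c" using n(2) by (simp add: v.points_def)
    qed
    then have 1: "card {n \<in> cube d 0 (2 ^ i). act n c \<in> S} \<le> card (v.points S c)"
      by (rule card_mono[OF v.finite_points])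
    have "real (card (v.outs \<chi>' c)) = real_of_int (int (card (v.outs \<chi>' c)))" by simp
    also have "\<dots> \<le> real_of_int (int d * (2 * (2 * R + 1) ^ (d - 1) * m))"
      using v.card_outs_le[OF c \<chi>'] by (simp only: of_int_le_iff)
    also have "\<dots> \<le> \<delta> * 2 ^ (d * i) - Phi i" using large by simp
    also have "\<dots> \<le> real (card {n \<in> cube d 0 (2 ^ i). act n c \<in> S})"
      using count[OF S c, of 0 i] by linarith
    finally show ?thesis using 1 by linarith
  qed
  obtain \<Theta> W where \<Theta>: "bij_betw \<Theta> A B" "finite W" "W \<subseteq> lattice d" "\<And>a. a \<in> A \<Longrightarrow> \<exists>v\<in>W. \<Theta> a = act v a"
    "\<And>v. v \<in> lattice d \<Longrightarrow> {a \<in> A. \<Theta> a = act v a} \<in> sets M"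
  proof (rule v.bounded_bijection[OF AB \<psi>(1) \<psi>_bound div enough[OF \<psi>_bound uA] enough[OF _ uB]])
    show "\<bar>- \<psi> j x\<bar> \<le> m" if "j < d" "x \<in> torus" for j x using \<psi>_bound[OF that] by simp
    fix \<Theta> :: "real^'k \<Rightarrow> real^'k" and W
    assume "bij_betw \<Theta> A B" "finite W" "W \<subseteq> lattice d" "\<And>a. a \<in> A \<Longrightarrow> \<exists>v\<in>W. \<Theta> a = act v a"
      "\<And>v. v \<in> lattice d \<Longrightarrow> {a \<in> A. \<Theta> a = act v a} \<in> sets M"
    then show thesis by (rule that)
  qed
  obtain w where w: "bij_betw w {0..<card W} W" using ex_bij_betw_nat_finite[OF \<Theta>(2)] by blast
  have wW: "w l \<in> W" if "l < card W" for l using bij_betwE[OF w] that by simp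
  have wl: "w l \<in> lattice d" if "l < card W" for l using wW[OF that] \<Theta>(3) by auto
  have At: "A \<subseteq> torus" using sets.sets_into_space[OF AB(1)] by (simp add: space_M)
  define AA where "AA l = {a \<in> A. \<Theta> a = act (w l) a}" for l
  define BB where "BB l = \<Theta> ` AA l" for l
  have AAm: "AA l \<in> sets M" if "l < card W" for l
    unfolding AA_def by (rule \<Theta>(5)[OF wl[OF that]])
  have cover: "A = (\<Union>l<card W. AA l)"
  proof (intro equalityI subsetI)
    fix a assume a: "a \<in> A"
    then obtain v where v: "v \<in> W" "\<Theta> a = act v a" using \<Theta>(4) by blast
    then have "v \<in> w ` {0..<card W}" using bij_betw_imp_surj_on[OF w] by simp
    then obtain l where "l < card W" "v = w l" by auto
    then show "a \<in> (\<Union>l<card W. AA l)" using a v(2) by (auto simp: AA_def)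
  qed (auto simp: AA_def)
  have disj: "AA l \<inter> AA l' = {}" if "l < card W" "l' < card W" "l \<noteq> l'" for l l'
  proof (rule ccontr)
    assume "AA l \<inter> AA l' \<noteq> {}"
    then obtain a where "a \<in> AA l" "a \<in> AA l'" by blast
    then have a: "a \<in> A" "act (w l) a = act (w l') a" by (auto simp: AA_def)
    then have "w l = w l'" using act_free[of a "w l" "w l'"] wl that At by blast
    then show False using bij_betw_imp_inj_on[OF w] that by (auto dest: inj_onD)
  qed
  have inj: "inj_on \<Theta> A" and surj: "\<Theta> ` A = B" using \<Theta>(1) by (auto simp: bij_betw_def)
  have BB_eq: "BB l = (\<lambda>a. tadd a (tcomb xs (w l))) ` AA l" for l
    unfolding BB_def by (rule image_cong) (auto simp: AA_def act_def)
  have BBm: "BB l \<in> sets M" if l: "l < card W" for l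
  proof -
    \<comment> \<open>The image is rewritten as a preimage under the inverse translation, which is
      measurable.\<close>
    have "BB l = {y \<in> space M. act (- w l) y \<in> AA l}"
    proof (intro equalityI subsetI)
      fix y assume "y \<in> BB l"
      then obtain a where a: "a \<in> AA l" "y = act (w l) a" by (auto simp: BB_def AA_def)
      then have "act (- w l) y = a" using At by (auto simp: AA_def act_add[symmetric] act_0)
      then show "y \<in> {y \<in> space M. act (- w l) y \<in> AA l}" using a by (simp add: space_M)
    next
      fix y assume y: "y \<in> {y \<in> space M. act (- w l) y \<in> AA l}"
      then have "\<Theta> (act (- w l) y) = act (w l) (act (- w l) y)" by (simp add: AA_def)
      also have "\<dots> = y" using y by (simp add: act_add[symmetric] act_0 space_M)
      finally show "y \<in> BB l" using y unfolding BB_def by (metis (no_types, lifting) image_eqI mem_Collect_eq)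
    qed
    then show ?thesis using dmeas_pred[OF dmeas_shift[OF dmeas_mem[OF AAm[OF l]] act_meas]] by simp
  qed
  show ?thesis
    unfolding equidecomposable_def
  proof (intro exI conjI)
    show "A = (\<Union>l<card W. AA l)" by (rule cover)
    show "B = (\<Union>l<card W. BB l)" unfolding BB_def image_UN[symmetric] cover[symmetric] surj ..
    have "BB l \<inter> BB l' = {}" if "l < card W" "l' < card W" "l \<noteq> l'" for l l'
    proof -
      have "\<Theta> ` (AA l \<inter> AA l') = \<Theta> ` AA l \<inter> \<Theta> ` AA l'"
        by (rule inj_on_image_Int[OF inj]) (auto simp: AA_def)
      then show ?thesis using disj[OF that] by (simp add: BB_def)
    qed
    then show "\<forall>l<card W. \<forall>l'<card W. l \<noteq> l' \<longrightarrow> AA l \<inter> AA l' = {} \<and> BB l \<inter> BB l' = {}"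
      using disj by blast
    show "\<forall>l<card W. AA l \<in> sets M \<and> BB l \<in> sets M" using AAm BBm by blast
    show "\<forall>l<card W. \<exists>n. tcomb xs (w l) = tcomb xs n" by blast
    show "\<forall>l<card W. BB l = (\<lambda>a. tadd a (tcomb xs (w l))) ` AA l" using BB_eq by blast
  qed
qed

end

text \<open>Two equal entries would give the relation with coefficients 1 and -1. Distinctness lets
  part (1) of the theorem apply its hypothesis to the first \<open>d - 1\<close> vectors.\<close>

lemma free_vecs_distinct: assumes "free_vecs xs" shows "distinct xs"
proof (rule ccontr)
  assume "\<not> distinct xs"
  then obtain i j where ij: "i < length xs" "j < length xs" "i \<noteq> j" "xs ! i = xs ! j"
    by (auto simp: distinct_conv_nth)
  define n where "n l = (if l = i then 1 else if l = j then -1 else 0 :: int)" for l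
  have "(\<Sum>l<length xs. of_int (n l) *\<^sub>R (xs ! l)) = (\<Sum>l\<in>{i, j}. of_int (n l) *\<^sub>R (xs ! l))"
    by (rule sum.mono_neutral_right) (use ij in \<open>auto simp: n_def\<close>)
  also have "\<dots> = 0" using ij by (simp add: n_def)
  finally have "tcomb xs n = 0" by (simp add: tcomb_def vec_eq_iff)
  then have "n i = 0" using assms ij by (auto simp: free_vecs_def)
  then show False by (simp add: n_def)
qed

text \<open>A cube of side \<open>2 ^ i\<close> in dimension \<open>e + 1\<close> is a union of \<open>2 ^ i\<close> cubes in dimension \<open>e\<close>.\<close>

lemma uniform_T_slices:
  fixes xs :: "(real^'k) list"
  assumes len: "length xs = Suc e" and u: "uniform_T Psi \<delta> (take e xs) A"
  shows "uniform_T (\<lambda>i. 2 ^ i * Psi i) \<delta> xs A"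
  unfolding uniform_T_def uniform_Z_def
proof (intro ballI allI)
  fix u :: "real^'k" and i a assume ut: "u \<in> torus"
  define s where "s = (2::nat) ^ i"
  define T where "T = {a e..<a e + int s}"
  define S where "S = tsection u xs A \<inter> cube (Suc e) a s"
  \<comment> \<open>In the slice with last coordinate \<open>t\<close>, the last vector only moves
    the base point \<open>u\<close>; uniformity holds for every base point.\<close>
  define w where "w t = tadd u (tproj (of_int t *\<^sub>R (xs ! e)))" for t :: int
  define Q where "Q t = tsection (w t) (take e xs) A \<inter> cube e a s" for t
  have S_fin: "finite S" by (simp add: S_def finite_cube)
  have comb: "tadd u (tcomb xs (n(e := t))) = tadd (w t) (tcomb (take e xs) n)" for n t
  proof -
    have "(\<Sum>l<Suc e. of_int ((n(e := t)) l) *\<^sub>R (xs ! l)) = (\<Sum>l<e. of_int (n l) *\<^sub>R (take e xs ! l)) + of_int t *\<^sub>R (xs ! e)"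
      by (simp add: sum.lessThan_Suc)
    then show ?thesis
      using len by (simp add: tadd_def tcomb_def w_def tproj_add_tproj tproj_tproj_add ac_simps)
  qed
  have slice: "card {n \<in> S. n e = t} = card (Q t)" if t: "t \<in> T" for t
  proof (rule bij_betw_same_card[OF bij_betw_byWitness[where f = "\<lambda>n. n(e := 0)" and f' = "\<lambda>n. n(e := t)"]])
    show "\<forall>n\<in>{n \<in> S. n e = t}. (n(e := 0))(e := t) = n" by auto
    show "\<forall>n\<in>Q t. (n(e := t))(e := 0) = n" by (auto simp: Q_def cube_def lattice_def fun_eq_iff)
    show "(\<lambda>n. n(e := 0)) ` {n \<in> S. n e = t} \<subseteq> Q t"
    proof clarify
      fix n assume n: "n \<in> S" "t = n e"
      have "tadd (w (n e)) (tcomb (take e xs) (n(e := 0))) = tadd u (tcomb xs n)"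
        using comb[of "n(e := 0)" "n e"] by simp
      then show "n(e := 0) \<in> Q (n e)"
        using n len by (auto simp: S_def Q_def tsection_def cube_def lattice_def)
    qed
    show "(\<lambda>n. n(e := t)) ` Q t \<subseteq> {n \<in> S. n e = t}"
    proof clarify
      fix n assume n: "n \<in> Q t"
      then show "n(e := t) \<in> S \<and> (n(e := t)) e = t"
        using t len comb[of n t]
        by (auto simp: S_def Q_def T_def tsection_def cube_def lattice_def less_Suc_eq)
    qed
  qed
  have "S = (\<Union>t\<in>T. {n \<in> S. n e = t})" by (auto simp: S_def T_def cube_def)
  then have "card S = card (\<Union>t\<in>T. {n \<in> S. n e = t})" by simp
  also have "\<dots> = (\<Sum>t\<in>T. card {n \<in> S. n e = t})"
    by (rule card_UN_disjoint) (use S_fin in \<open>auto simp: T_def\<close>)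
  also have "\<dots> = (\<Sum>t\<in>T. card (Q t))" by (rule sum.cong) (auto simp: slice)
  finally have cS: "card S = (\<Sum>t\<in>T. card (Q t))" .
  have Qb: "\<bar>real (card (Q t)) - \<delta> * real s ^ e\<bar> \<le> Psi i" for t
  proof -
    have "w t \<in> torus" by (simp add: w_def tadd_def tproj_torus)
    then have "\<bar>real (card (tsection (w t) (take e xs) A \<inter> cube (length (take e xs)) a (2 ^ i)))
        - \<delta> * real (card (cube (length (take e xs)) a (2 ^ i)))\<bar> \<le> Psi i"
      using u unfolding uniform_T_def uniform_Z_def by blast
    then show ?thesis using len by (simp add: Q_def s_def card_cube)
  qed
  have cT: "card T = s" by (simp add: T_def)
  have "\<bar>real (card S) - \<delta> * real s ^ Suc e\<bar> = \<bar>\<Sum>t\<in>T. (real (card (Q t)) - \<delta> * real s ^ e)\<bar>"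
    by (simp add: cS sum_subtractf cT algebra_simps)
  also have "\<dots> \<le> (\<Sum>t\<in>T. Psi i)" by (rule order_trans[OF sum_abs sum_mono]) (rule Qb)
  also have "\<dots> = 2 ^ i * Psi i" by (simp add: cT) (simp add: s_def)
  finally show "\<bar>real (card (tsection u xs A \<inter> cube (length xs) a (2 ^ i)))
      - \<delta> * real (card (cube (length xs) a (2 ^ i)))\<bar> \<le> 2 ^ i * Psi i"
    using len by (simp add: S_def s_def card_cube)
qed

section \<open>Lebesgue measure and Baire category\<close>

text \<open>For each \<open>k\<close> the set of points never covered from stage \<open>k\<close> on
  must be null. Through \<open>prod_decode\<close> each \<open>k\<close> is the target of infinitely
  many stages, and at such a stage the choice covers at least a ninth of what is still uncovered for
  \<open>k\<close>.\<close>

lemma (in finite_measure) greedy_limsup_cover: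
  fixes C :: "nat \<Rightarrow> nat \<Rightarrow> 'a set"
  assumes Cm: "\<And>i w. C i w \<in> sets M" and cover: "\<And>i. space M \<subseteq> (\<Union>w<9. C i w)"
  shows "\<exists>g. (\<forall>i. g i < 9) \<and> {x \<in> space M. \<exists>m. \<forall>i\<ge>m. x \<notin> C i (g i)} \<in> null_sets M"
proof -
  define target where "target n = fst (prod_decode n)" for n
  define pick where "pick E n = (SOME w. w < 9 \<and> measure M E \<le> 9 * measure M (E \<inter> C n w))" for E n
  have pick: "pick E n < 9" "measure M E \<le> 9 * measure M (E \<inter> C n (pick E n))" if E: "E \<in> sets M" for E n
  proof -
    have "\<exists>w. w < 9 \<and> measure M E \<le> 9 * measure M (E \<inter> C n w)"
    proof (rule ccontr)
      assume "\<not> ?thesis"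
      then have less: "9 * measure M (E \<inter> C n w) < measure M E" if "w < 9" for w using that by force
      have "E = (\<Union>w<9. E \<inter> C n w)" using cover sets.sets_into_space[OF E] by auto
      then have "measure M E \<le> (\<Sum>w<9. measure M (E \<inter> C n w))"
        using measure_UNION_le[of "{..<9::nat}" "\<lambda>w. E \<inter> C n w"] E Cm by auto
      also have "\<dots> < (\<Sum>w\<in>{..<9::nat}. measure M E / 9)"
      proof (rule sum_strict_mono)
        show "measure M (E \<inter> C n w) < measure M E / 9" if "w \<in> {..<9}" for w
          using less[of w] that by simp
      qed (auto simp: lessThan_empty_iff)
      finally show False by simp
    qed
    then have "pick E n < 9 \<and> measure M E \<le> 9 * measure M (E \<inter> C n (pick E n))"
      unfolding pick_def by (rule someI_ex)
    then show "pick E n < 9" "measure M E \<le> 9 * measure M (E \<inter> C n (pick E n))" by auto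
  qed
  \<comment> \<open>\<open>e n k\<close> is what the choices at stages from \<open>k\<close> to
    \<open>n - 1\<close> have left uncovered.\<close>
  define e where "e = rec_nat (\<lambda>_. space M)
    (\<lambda>n e k. if k \<le> n then e k - C n (pick (e (target n)) n) else e k)"
  define g where "g n = pick (e n (target n)) n" for n
  have e0: "e 0 k = space M" and eS: "e (Suc n) k = (if k \<le> n then e n k - C n (g n) else e n k)" for n k
    by (simp_all add: e_def g_def)
  have es: "e n k \<in> sets M" for n k by (induction n) (auto simp: e0 eS Cm)
  have null: "{x \<in> space M. \<forall>i\<ge>k. x \<notin> C i (g i)} \<in> null_sets M" for k
  proof -
    let ?E = "{x \<in> space M. \<forall>i\<ge>k. x \<notin> C i (g i)}"
    have sub: "?E \<subseteq> e n k" for n by (induction n) (auto simp: e0 eS)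
    have "?E = space M - (\<Union>i\<in>{k..}. C i (g i))" by auto
    then have Em: "?E \<in> sets M" using Cm by auto
    have dec: "decseq (\<lambda>n. measure M (e n k))"
      by (rule decseq_SucI) (rule finite_measure_mono, auto simp: eS es)
    then obtain L where L: "(\<lambda>n. measure M (e n k)) \<longlonglongrightarrow> L" "\<And>n. L \<le> measure M (e n k)"
      using decseq_convergent[OF dec, of 0] by auto
    \<comment> \<open>If the limit \<open>L\<close> were positive, then at a late stage with target
      \<open>k\<close> the measure would be below \<open>9 / 8 * L\<close>, and losing a ninth of it
      would leave less than \<open>L\<close>.\<close>
    have "L \<le> 0"
    proof (rule ccontr)
      assume "\<not> L \<le> 0"
      then have "L < 9 / 8 * L" by simp
      then have "\<forall>\<^sub>F n in sequentially. measure M (e n k) < 9 / 8 * L" using L(1) by (intro order_tendstoD)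
      then obtain n0 where n0: "\<And>n. n \<ge> n0 \<Longrightarrow> measure M (e n k) < 9 / 8 * L"
        by (auto simp: eventually_sequentially)
      define n where "n = prod_encode (k, max n0 k)"
      have n: "n0 \<le> n" "k \<le> n" "target n = k"
        using le_prod_encode_2[of "max n0 k" k] by (auto simp: n_def target_def)
      have "measure M (e (Suc n) k) = measure M (e n k) - measure M (e n k \<inter> C n (g n))"
        using n(2) finite_measure_Diff'[OF es Cm, of n k n "g n"] by (simp add: eS)
      moreover have "measure M (e n k) \<le> 9 * measure M (e n k \<inter> C n (g n))"
        using pick(2)[OF es[of n k], of n] by (simp add: g_def n(3))
      ultimately show False using n0[OF n(1)] L(2)[of "Suc n"] by linarith
    qed
    moreover have "measure M ?E \<le> L"
      by (rule LIMSEQ_le_const[OF L(1)]) (auto intro!: finite_measure_mono sub es)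
    ultimately have "measure M ?E = 0" using measure_nonneg[of M ?E] by linarith
    then have "emeasure M ?E = 0" by (simp only: emeasure_eq_measure ennreal_0)
    then show ?thesis using Em by (rule null_setsI)
  qed
  have "{x \<in> space M. \<exists>m. \<forall>i\<ge>m. x \<notin> C i (g i)} = (\<Union>k. {x \<in> space M. \<forall>i\<ge>k. x \<notin> C i (g i)})" by auto
  also have "\<dots> \<in> null_sets M" by (rule null_sets_UN[OF null])
  finally show ?thesis using pick(1)[OF es] by (auto simp: g_def intro!: exI[of _ g])
qed

section \<open>Meager sets and the Baire property\<close>

lemma meager_subset:
  assumes "meager_in T S" "R \<subseteq> S" shows "meager_in T R"
proof -
  obtain F where F: "countable F \<and> (\<forall>N\<in>F. nowhere_dense_in T N) \<and> S \<subseteq> \<Union>F"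
    using assms(1) unfolding meager_in_def by (elim exE)
  then have "R \<subseteq> \<Union>F" using assms(2) by (meson order_trans)
  then show ?thesis unfolding meager_in_def using F by (intro exI[of _ F]) simp
qed

lemma meager_UN:
  assumes "\<And>i::nat. meager_in T (S i)" shows "meager_in T (\<Union>i. S i)"
proof -
  have "\<forall>i. \<exists>F. countable F \<and> (\<forall>N\<in>F. nowhere_dense_in T N) \<and> S i \<subseteq> \<Union>F"
    using assms unfolding meager_in_def ..
  then obtain F where F: "\<forall>i. countable (F i) \<and> (\<forall>N\<in>F i. nowhere_dense_in T N) \<and> S i \<subseteq> \<Union>(F i)"
    by (rule choice[THEN exE])
  show ?thesis
    unfolding meager_in_def
  proof (intro exI conjI)
    show "countable (\<Union>i. F i)" using F by (intro countable_UN) auto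
    show "\<forall>N\<in>(\<Union>i. F i). nowhere_dense_in T N" using F by auto
    show "(\<Union>i. S i) \<subseteq> \<Union>(\<Union>i. F i)" using F by fastforce
  qed
qed

lemma meager_empty [simp]: "meager_in T {}"
  unfolding meager_in_def by (rule exI[of _ "{}"]) simp

lemma meager_Union:
  assumes "countable I" "\<And>i. i \<in> I \<Longrightarrow> meager_in T (S i)" shows "meager_in T (\<Union>i\<in>I. S i)"
proof (cases "I = {}")
  case False
  have "(\<Union>i\<in>I. S i) = (\<Union>i\<in>range (from_nat_into I). S i)"
    by (simp only: range_from_nat_into[OF False assms(1)])
  also have "\<dots> = (\<Union>n. S (from_nat_into I n))" by blast
  finally show ?thesis using meager_UN[of T "\<lambda>n. S (from_nat_into I n)"] assms False by (simp add: from_nat_into)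
qed simp

lemma meager_Un: "meager_in T S \<Longrightarrow> meager_in T R \<Longrightarrow> meager_in T (S \<union> R)"
  using meager_Union[of "{S, R}" T "\<lambda>x. x"] by auto

lemma meager_frontier:
  assumes "openin T U" shows "meager_in T (T closure_of U - U)"
proof -
  let ?F = "T closure_of U - U"
  have "closedin T ?F" using assms by (intro closedin_diff) auto
  moreover have "T interior_of ?F = {}"
  proof -
    have "openin T (T interior_of ?F)" by simp
    moreover have "T interior_of ?F \<inter> U = {}" using interior_of_subset[of T ?F] by auto
    ultimately have "T interior_of ?F \<inter> T closure_of U = {}"
      using openin_Int_closure_of_eq_empty by metis
    then show ?thesis using interior_of_subset[of T ?F] by auto
  qed
  ultimately have "nowhere_dense_in T ?F"
    unfolding nowhere_dense_in_def by (simp add: closure_of_closedin closedin_subset)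
  then show ?thesis unfolding meager_in_def by (intro exI[of _ "{?F}"]) auto
qed

text \<open>For complements, the open approximation is replaced by the complement of its closure;
  the error grows only by the frontier of an open set, which is meager.\<close>

lemma baire_sigma_algebra: "sigma_algebra (topspace T) {A. baire_measurable_in T A}"
  unfolding sigma_algebra_iff2
proof (intro conjI ballI allI impI)
  show "{A. baire_measurable_in T A} \<subseteq> Pow (topspace T)"
    by (auto simp: baire_measurable_in_def)
  show "{} \<in> {A. baire_measurable_in T A}"
    by (auto simp: baire_measurable_in_def intro!: exI[of _ "{}"])
  fix A assume "A \<in> {A. baire_measurable_in T A}"
  then obtain U where A: "A \<subseteq> topspace T" and U: "openin T U" "meager_in T ((A - U) \<union> (U - A))"
    by (auto simp: baire_measurable_in_def)
  let ?V = "topspace T - T closure_of U"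
  have Us: "U \<subseteq> T closure_of U" using U(1) by (simp add: closure_of_subset openin_subset)
  have "meager_in T (((A - U) \<union> (U - A)) \<union> (T closure_of U - U))"
    by (rule meager_Un[OF U(2) meager_frontier[OF U(1)]])
  then have "meager_in T (((topspace T - A) - ?V) \<union> (?V - (topspace T - A)))"
    by (rule meager_subset) (use Us in auto)
  moreover have "openin T ?V" by auto
  ultimately show "topspace T - A \<in> {A. baire_measurable_in T A}"
    by (auto simp: baire_measurable_in_def)
next
  fix A :: "nat \<Rightarrow> 'a set" assume "range A \<subseteq> {A. baire_measurable_in T A}"
  then have "\<And>i. A i \<subseteq> topspace T \<and> (\<exists>U. openin T U \<and> meager_in T ((A i - U) \<union> (U - A i)))"
    by (auto simp: baire_measurable_in_def)
  then obtain U where U: "\<And>i. A i \<subseteq> topspace T" "\<And>i. openin T (U i)" "\<And>i. meager_in T ((A i - U i) \<union> (U i - A i))"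
    by metis
  have "meager_in T (\<Union>i. (A i - U i) \<union> (U i - A i))" using U(3) by (rule meager_UN)
  then have "meager_in T (((\<Union>i. A i) - (\<Union>i. U i)) \<union> ((\<Union>i. U i) - (\<Union>i. A i)))"
    by (rule meager_subset) auto
  moreover have "openin T (\<Union>i. U i)" using U(2) by auto
  ultimately show "(\<Union>i. A i) \<in> {A. baire_measurable_in T A}"
    using U(1) by (auto simp: baire_measurable_in_def intro!: exI[of _ "\<Union>i. U i"])
qed

text \<open>A measure space only in form: it carries the sigma-algebra in the shape that the common
  argument expects.\<close>

definition baire_sets :: "'a topology \<Rightarrow> 'a measure" where
  "baire_sets T = sigma (topspace T) {A. baire_measurable_in T A}"

lemma space_baire_sets [simp]: "space (baire_sets T) = topspace T"
  unfolding baire_sets_def by (rule space_measure_of) (auto simp: baire_measurable_in_def)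

lemma sets_baire_sets: "A \<in> sets (baire_sets T) \<longleftrightarrow> baire_measurable_in T A"
proof -
  have "sets (baire_sets T) = sigma_sets (topspace T) {A. baire_measurable_in T A}"
    unfolding baire_sets_def by (rule sets_measure_of) (auto simp: baire_measurable_in_def)
  then show ?thesis using sigma_algebra.sigma_sets_eq[OF baire_sigma_algebra[of T]] by simp
qed

lemma open_baire: "openin T U \<Longrightarrow> U \<in> sets (baire_sets T)"
  by (auto simp: sets_baire_sets baire_measurable_in_def openin_subset intro!: exI[of _ U])

lemma meager_baire: "meager_in T S \<Longrightarrow> S \<subseteq> topspace T \<Longrightarrow> S \<in> sets (baire_sets T)"
  by (auto simp: sets_baire_sets baire_measurable_in_def intro!: exI[of _ "{}"])

lemma meager_image:
  assumes h: "homeomorphic_map T T h" and S: "meager_in T S" shows "meager_in T (h ` S)"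
proof -
  obtain F where F: "countable F" "\<And>N. N \<in> F \<Longrightarrow> nowhere_dense_in T N" "S \<subseteq> \<Union>F"
    using S unfolding meager_in_def by blast
  have "nowhere_dense_in T (h ` N)" if "N \<in> F" for N
  proof -
    have N: "N \<subseteq> topspace T" "T interior_of (T closure_of N) = {}"
      using F(2)[OF that] by (auto simp: nowhere_dense_in_def)
    have "h ` topspace T = topspace T" by (rule homeomorphic_imp_surjective_map[OF h])
    then have "h ` N \<subseteq> topspace T" using N(1) by blast
    moreover have "T interior_of (T closure_of (h ` N)) = {}"
      using N homeomorphic_map_closure_of[OF h N(1)]
        homeomorphic_map_interior_of[OF h closure_of_subset_topspace, of N] by simp
    ultimately show ?thesis by (simp add: nowhere_dense_in_def)
  qed
  then show ?thesis
    unfolding meager_in_def using F(1) image_mono[OF F(3), of h]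
    by (intro exI[of _ "(`) h ` F"]) (auto simp: image_Union)
qed

lemma baire_image:
  assumes h: "homeomorphic_map T T h" and A: "A \<in> sets (baire_sets T)"
  shows "h ` A \<in> sets (baire_sets T)"
proof -
  obtain U where U: "A \<subseteq> topspace T" "openin T U" "meager_in T ((A - U) \<union> (U - A))"
    using A by (auto simp: sets_baire_sets baire_measurable_in_def)
  have inj: "inj_on h (topspace T)" by (rule homeomorphic_imp_injective_map[OF h])
  have surj: "h ` topspace T = topspace T" by (rule homeomorphic_imp_surjective_map[OF h])
  have Us: "U \<subseteq> topspace T" using U(2) by (rule openin_subset)
  have "h ` ((A - U) \<union> (U - A)) = (h ` A - h ` U) \<union> (h ` U - h ` A)"
  proof -
    have "A - U \<subseteq> topspace T" "U - A \<subseteq> topspace T" using U(1) Us by auto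
    then show ?thesis
      using inj_on_image_set_diff[OF inj _ Us, of A] inj_on_image_set_diff[OF inj _ U(1), of U]
      by (simp add: image_Un)
  qed
  then have "meager_in T ((h ` A - h ` U) \<union> (h ` U - h ` A))" using meager_image[OF h U(3)] by simp
  moreover have "openin T (h ` U)" using homeomorphic_map_openness[OF h Us] U(2) by simp
  ultimately show ?thesis using U(1) surj by (auto simp: sets_baire_sets baire_measurable_in_def)
qed

text \<open>If \<open>V i\<close> is not meager, one of the nine pieces of \<open>V i\<close> is
  not; that one is chosen whenever \<open>i\<close> is the target. The set missed from stage
  \<open>m\<close> on agrees with an open \<open>U\<close> up to a meager set. For
  \<open>V i\<close> inside \<open>U\<close>, a stage after \<open>m\<close> with target
  \<open>i\<close> has its chosen piece inside that error, so \<open>V i\<close> is meager; hence so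
  are \<open>U\<close> and the missed set.\<close>

lemma baire_limsup_cover:
  fixes C :: "nat \<Rightarrow> nat \<Rightarrow> 'a set" and V :: "nat \<Rightarrow> 'a set"
  assumes Cm: "\<And>i w. C i w \<in> sets (baire_sets T)" and cover: "\<And>i. topspace T \<subseteq> (\<Union>w<9. C i w)"
    and V: "\<And>i. V i \<subseteq> topspace T" "\<And>U. openin T U \<Longrightarrow> U = (\<Union>i\<in>{i. V i \<subseteq> U}. V i)"
  shows "\<exists>g. (\<forall>i. g i < 9) \<and> meager_in T {x \<in> topspace T. \<exists>m. \<forall>i\<ge>m. x \<notin> C i (g i)}"
proof -
  define target where "target n = fst (prod_decode n)" for n
  have "\<exists>w<9. meager_in T (V (target n) \<inter> C n w) \<longrightarrow> meager_in T (V (target n))" for n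
  proof (rule ccontr)
    assume "\<not> ?thesis"
    then have a: "\<not> meager_in T (V (target n))" "\<And>w. w < 9 \<Longrightarrow> meager_in T (V (target n) \<inter> C n w)"
      using zero_less_numeral by blast+
    have "meager_in T (\<Union>w\<in>{..<9}. V (target n) \<inter> C n w)" by (rule meager_Union) (auto intro: a(2))
    then have "meager_in T (V (target n))"
      by (rule meager_subset) (use cover[of n] V(1)[of "target n"] in auto)
    with a(1) show False ..
  qed
  then obtain g where g: "\<And>n. g n < 9"
    "\<And>n. meager_in T (V (target n) \<inter> C n (g n)) \<Longrightarrow> meager_in T (V (target n))" by metis
  have "meager_in T {x \<in> topspace T. \<forall>i\<ge>m. x \<notin> C i (g i)}" for m
  proof -
    let ?E = "{x \<in> topspace T. \<forall>i\<ge>m. x \<notin> C i (g i)}"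
    have "?E = topspace T - (\<Union>i\<in>{m..}. C i (g i))" by auto
    then have "?E \<in> sets (baire_sets T)" using Cm sets.top[of "baire_sets T"] by auto
    then obtain U where U: "openin T U" "meager_in T ((?E - U) \<union> (U - ?E))"
      by (auto simp: sets_baire_sets baire_measurable_in_def)
    have "meager_in T (V i)" if "V i \<subseteq> U" for i
    proof -
      define n where "n = prod_encode (i, m)"
      have n: "m \<le> n" "target n = i" using le_prod_encode_2[of m i] by (auto simp: n_def target_def)
      have "V (target n) \<inter> C n (g n) \<subseteq> (?E - U) \<union> (U - ?E)" using that n by auto
      then show ?thesis using g(2)[of n] meager_subset[OF U(2)] n(2) by simp
    qed
    then have "meager_in T (\<Union>i\<in>{i. V i \<subseteq> U}. V i)" by (intro meager_Union) auto
    then have "meager_in T U" using V(2)[OF U(1)] by simp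
    then show ?thesis by (rule meager_subset[OF meager_Un[OF U(2)]]) auto
  qed
  then have "meager_in T (\<Union>m. {x \<in> topspace T. \<forall>i\<ge>m. x \<notin> C i (g i)})" by (rule meager_UN)
  then have "meager_in T {x \<in> topspace T. \<exists>m. \<forall>i\<ge>m. x \<notin> C i (g i)}" by (rule meager_subset) auto
  then show ?thesis using g(1) by blast
qed

section \<open>Lebesgue measurable subsets of the torus\<close>

definition int_vectors :: "(real^'k) set" where "int_vectors = {z. \<forall>j. z $ j \<in> \<int>}"

lemma countable_int_vectors: "countable (int_vectors :: (real^'k) set)"
proof -
  have "countable (PiE UNIV (\<lambda>_. UNIV) :: ('k \<Rightarrow> int) set)" by (rule countable_PiE) auto
  then have "countable (range (\<lambda>f :: 'k \<Rightarrow> int. (\<chi> j. of_int (f j)) :: real^'k))" by simp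
  moreover have "int_vectors \<subseteq> range (\<lambda>f :: 'k \<Rightarrow> int. (\<chi> j. of_int (f j)) :: real^'k)"
  proof
    fix z :: "real^'k" assume "z \<in> int_vectors"
    then have "z = (\<chi> j. of_int \<lfloor>z $ j\<rfloor>)" by (simp add: int_vectors_def vec_eq_iff)
    then show "z \<in> range (\<lambda>f :: 'k \<Rightarrow> int. (\<chi> j. of_int (f j)) :: real^'k)"
      by (intro image_eqI[of _ _ "\<lambda>j. \<lfloor>z $ j\<rfloor>"]) auto
  qed
  ultimately show ?thesis by (rule countable_subset[rotated])
qed

lemma tproj_diff_int: "x - tproj x \<in> int_vectors"
  by (simp add: int_vectors_def minus_frac_Ints)

lemma tproj_add_int: "z \<in> int_vectors \<Longrightarrow> tproj (z + x) = tproj x"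
  by (rule tproj_cong) (simp add: int_vectors_def)

text \<open>Addition modulo 1 is cut into countably many genuine translations, to which translation
  invariance in Euclidean space applies.\<close>

lemma tadd_vimage_eq:
  assumes "S \<subseteq> torus"
  shows "{x \<in> torus. tadd x v \<in> S} = torus \<inter> (\<Union>z\<in>int_vectors. (+) (z - v) ` S)"
proof (intro equalityI subsetI)
  fix x assume x: "x \<in> {x \<in> torus. tadd x v \<in> S}"
  let ?z = "(x + v) - tproj (x + v)"
  have "x = (?z - v) + tadd x v" by (simp add: tadd_def)
  then show "x \<in> torus \<inter> (\<Union>z\<in>int_vectors. (+) (z - v) ` S)" using x tproj_diff_int by blast
next
  fix x assume "x \<in> torus \<inter> (\<Union>z\<in>int_vectors. (+) (z - v) ` S)"
  then obtain z y where "x \<in> torus" "z \<in> int_vectors" "y \<in> S" "x = (z - v) + y" by blast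
  moreover from this have "tadd x v = y" using assms by (auto simp: tadd_def tproj_add_int tproj_id)
  ultimately show "x \<in> {x \<in> torus. tadd x v \<in> S}" by simp
qed

lemma tadd_torus: "tadd x v \<in> torus"
  by (simp add: tadd_def tproj_torus)

lemma torus_borel: "torus \<in> sets borel"
proof -
  have "torus = (\<Inter>j. {x :: real^'k. 0 \<le> x $ j \<and> x $ j < 1})" by (auto simp: torus_def)
  also have "\<dots> \<in> sets borel" by (intro sets.countable_INT'') auto
  finally show ?thesis .
qed

lemma torus_lebesgue: "torus \<in> sets lebesgue"
  using sets_completionI_sets[of torus lborel] torus_borel by simp

lemma lebesgue_torus_action:
  assumes "length xs = d" "2 \<le> d" "free_vecs xs"
  shows "torus_action (restrict_space lebesgue torus) {S. S \<subseteq> torus \<and> negligible S} (xs :: (real^'k) list) d"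
proof
  let ?M = "restrict_space lebesgue (torus :: (real^'k) set)"
  have sets: "S \<in> sets ?M \<longleftrightarrow> S \<subseteq> torus \<and> S \<in> sets lebesgue" for S
    using torus_lebesgue by (intro sets_restrict_space_iff) simp
  show sp: "space ?M = torus" by (simp add: space_restrict_space)
  show "length xs = d" "2 \<le> d" "free_vecs xs" by fact+
  show "(\<lambda>x. tadd x v) \<in> measurable ?M ?M" for v
  proof (rule measurableI)
    show "tadd x v \<in> space ?M" for x by (simp add: sp tadd_torus)
    fix S assume "S \<in> sets ?M"
    then have S: "S \<subseteq> torus" "S \<in> sets lebesgue" by (auto simp: sets)
    have "(\<lambda>x. tadd x v) -` S \<inter> space ?M = torus \<inter> (\<Union>z\<in>int_vectors. (+) (z - v) ` S)"
      using tadd_vimage_eq[OF S(1), of v] by (auto simp: sp)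
    also have "\<dots> \<in> sets lebesgue"
      by (intro sets.Int torus_lebesgue sets.countable_UN'' countable_int_vectors lebesgue_sets_translation S)
    finally show "(\<lambda>x. tadd x v) -` S \<inter> space ?M \<in> sets ?M" by (auto simp: sets sp)
  qed
  show "{x \<in> torus. x $ j < c} \<in> sets ?M" for j c
  proof -
    have "{x :: real^'k. x $ j < c} \<in> sets borel" by measurable
    then have "torus \<inter> {x. x $ j < c} \<in> sets lebesgue" using torus_borel by (intro sets.Int) auto
    then show ?thesis by (auto simp: sets Int_def)
  qed
  show "A \<in> sets ?M" if "A \<in> {S. S \<subseteq> torus \<and> negligible S}" for A
    using that by (auto simp: sets negligible_imp_sets)
  show "B \<in> {S. S \<subseteq> torus \<and> negligible S}" if "A \<in> {S. S \<subseteq> torus \<and> negligible S}" "B \<subseteq> A" for A B :: "(real^'k) set"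
    using that by (auto intro: negligible_subset)
  show "(\<Union>i. H i) \<in> {S. S \<subseteq> torus \<and> negligible S}" if "\<And>i::nat. H i \<in> {S. S \<subseteq> torus \<and> negligible S}" for H :: "nat \<Rightarrow> (real^'k) set"
    using that by (auto intro!: negligible_countable_Union)
  show "{x \<in> torus. tadd x v \<in> A} \<in> {S. S \<subseteq> torus \<and> negligible S}" if A: "A \<in> {S. S \<subseteq> torus \<and> negligible S}" for A :: "(real^'k) set" and v
  proof -
    have "negligible (\<Union>z\<in>int_vectors. (+) (z - v) ` A)"
      using A countable_int_vectors by (intro negligible_countable_Union) (auto intro: negligible_translation)
    then show ?thesis using A by (auto simp: tadd_vimage_eq intro: negligible_subset)
  qed
  fix C :: "nat \<Rightarrow> nat \<Rightarrow> (real^'k) set"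
  assume C: "\<And>i w. C i w \<in> sets ?M" "\<And>i. space ?M \<subseteq> (\<Union>w<9. C i w)"
  interpret finite_measure ?M
  proof
    have "bounded (torus :: (real^'k) set)"
      by (rule bounded_subset[OF bounded_cbox[of 0 "\<chi> j. 1"]]) (auto simp: torus_def mem_box_cart less_imp_le)
    then have "emeasure lebesgue (torus :: (real^'k) set) < \<infinity>"
      using bounded_set_imp_lmeasurable[OF _ torus_lebesgue] fmeasurable_def by blast
    then show "emeasure ?M (space ?M) \<noteq> \<infinity>"
    proof -
      have "emeasure ?M torus = emeasure lebesgue (torus :: (real^'k) set)"
        by (rule emeasure_restrict_space) (use torus_lebesgue in auto)
      then show ?thesis using \<open>emeasure lebesgue (torus :: (real^'k) set) < \<infinity>\<close> unfolding sp by (metis less_irrefl)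
    qed
  qed
  obtain g where g: "\<forall>i. g i < 9" "{x \<in> space ?M. \<exists>m. \<forall>i\<ge>m. x \<notin> C i (g i)} \<in> null_sets ?M"
    using greedy_limsup_cover[of C] C by blast
  let ?Z = "{x \<in> space ?M. \<exists>m. \<forall>i\<ge>m. x \<notin> C i (g i)}"
  have "?Z \<subseteq> torus \<and> ?Z \<in> null_sets lebesgue"
    by (rule iffD1[OF null_sets_restrict_space[OF torus_lebesgue] g(2)])
  then have "?Z \<in> {S. S \<subseteq> torus \<and> negligible S}" by (simp only: negligible_iff_null_sets mem_Collect_eq)
  with g(1) show "\<exists>g. (\<forall>i. g i < 9) \<and> {x \<in> space ?M. \<exists>m. \<forall>i\<ge>m. x \<notin> C i (g i)} \<in> {S. S \<subseteq> torus \<and> negligible S}"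
    by (intro exI[of _ g] conjI)
qed

section \<open>Baire measurable subsets of the torus\<close>

lemma openin_torus_top:
  fixes U :: "(real^'k) set"
  shows "openin torus_top U \<longleftrightarrow> U \<subseteq> torus \<and> open (tproj -` U)"
proof -
  have "istopology (\<lambda>U :: (real^'k) set. U \<subseteq> torus \<and> open (tproj -` U))"
    unfolding istopology_def by (auto simp: vimage_Int vimage_Union)
  then show ?thesis unfolding torus_top_def by (simp only: topology_inverse')
qed

lemma topspace_torus_top [simp]: "topspace torus_top = (torus :: (real^'k) set)"
proof
  show "topspace torus_top \<subseteq> (torus :: (real^'k) set)" unfolding topspace_def by (auto simp: openin_torus_top)
  have "tproj -` torus = (UNIV :: (real^'k) set)" using tproj_torus by auto
  then have "openin torus_top (torus :: (real^'k) set)" by (simp add: openin_torus_top)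
  then show "(torus :: (real^'k) set) \<subseteq> topspace torus_top" by (rule openin_subset)
qed

lemma tadd_cancel: "x \<in> torus \<Longrightarrow> tadd (tadd x v) (- v) = x"
  unfolding tadd_def tproj_tproj_add by (simp add: tproj_id)

lemma tadd_homeomorphic:
  fixes v :: "real^'k"
  shows "homeomorphic_map torus_top torus_top (\<lambda>x. tadd x v)"
proof -
  have "continuous_map torus_top torus_top (\<lambda>x. tadd x v)" for v :: "real^'k"
    unfolding continuous_map
  proof (intro conjI allI impI)
    show "(\<lambda>x. tadd x v) ` topspace torus_top \<subseteq> topspace torus_top" by (auto simp: tadd_torus)
    fix U :: "(real^'k) set" assume "openin torus_top U"
    then have "open (tproj -` U)" by (simp add: openin_torus_top)
    then have "open ((\<lambda>y. y + v) -` (tproj -` U))"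
      by (rule open_vimage) (intro continuous_intros)
    moreover have "(\<lambda>y. y + v) -` (tproj -` U) = tproj -` {x \<in> torus. tadd x v \<in> U}"
      by (auto simp: tadd_def tproj_tproj_add tproj_torus)
    ultimately show "openin torus_top {x \<in> topspace torus_top. tadd x v \<in> U}"
      by (auto simp: openin_torus_top)
  qed
  then have "homeomorphic_maps torus_top torus_top (\<lambda>x. tadd x v) (\<lambda>x. tadd x (- v))"
    using tadd_cancel[of _ v] tadd_cancel[of _ "- v"] by (simp add: homeomorphic_maps_def)
  then show ?thesis using homeomorphic_map_maps by blast
qed

lemma tadd_vimage_image:
  assumes "S \<subseteq> torus" shows "{x \<in> torus. tadd x v \<in> S} = (\<lambda>x. tadd x (- v)) ` S"
proof (intro equalityI subsetI)
  fix x assume "x \<in> {x \<in> torus. tadd x v \<in> S}"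
  then show "x \<in> (\<lambda>x. tadd x (- v)) ` S" using tadd_cancel[of x v] by (intro image_eqI[of _ _ "tadd x v"]) auto
next
  fix x assume "x \<in> (\<lambda>x. tadd x (- v)) ` S"
  then show "x \<in> {x \<in> torus. tadd x v \<in> S}" using assms tadd_cancel[of _ "- v"] by (auto simp: tadd_torus)
qed

lemma torus_top_base:
  obtains V :: "nat \<Rightarrow> (real^'k) set" where "\<And>i. V i \<subseteq> torus"
    "\<And>U. openin torus_top U \<Longrightarrow> U = (\<Union>i\<in>{i. V i \<subseteq> U}. V i)"
proof -
  obtain B :: "(real^'k) set set" where B: "countable B" "topological_basis B"
    using ex_countable_basis by blast
  have ne: "B \<noteq> {}" using B(2) topological_basisE[OF B(2), of UNIV 0] by blast
  define V where "V i = tproj ` from_nat_into B i" for i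
  show thesis
  proof (rule that[of V])
    show "V i \<subseteq> torus" for i using tproj_torus by (auto simp: V_def)
    fix U :: "(real^'k) set" assume "openin torus_top U"
    then have U: "U \<subseteq> torus" "open (tproj -` U)" by (auto simp: openin_torus_top)
    show "U = (\<Union>i\<in>{i. V i \<subseteq> U}. V i)"
    proof (intro equalityI subsetI)
      fix x assume x: "x \<in> U"
      then have "tproj x = x" using U(1) tproj_id by blast
      then have "x \<in> tproj -` U" using x by simp
      then obtain b where b: "b \<in> B" "x \<in> b" "b \<subseteq> tproj -` U" using topological_basisE[OF B(2) U(2)] by blast
      then obtain i where "b = from_nat_into B i" using range_from_nat_into[OF ne B(1)] by blast
      then have "V i \<subseteq> U" "x \<in> V i" using b \<open>tproj x = x\<close> by (auto simp: V_def intro: image_eqI[of x tproj x])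
      then show "x \<in> (\<Union>i\<in>{i. V i \<subseteq> U}. V i)" by blast
    qed auto
  qed
qed

text \<open>Excluding the value 0 avoids the jump of \<open>frac\<close>, so the set is a union of
  open slabs; \<open>c \<le> 1\<close> keeps each slab within one unit interval.\<close>

lemma open_frac_less: fixes j :: "'k::finite" assumes "c \<le> 1" shows "open {y :: real^'k. 0 < frac (y $ j) \<and> frac (y $ j) < c}"
proof -
  have "{y :: real^'k. 0 < frac (y $ j) \<and> frac (y $ j) < c} = (\<Union>m::int. {y. of_int m < y $ j} \<inter> {y. y $ j < of_int m + c})"
  proof (intro equalityI subsetI)
    fix y :: "real^'k" assume "y \<in> {y. 0 < frac (y $ j) \<and> frac (y $ j) < c}"
    then have "y \<in> {y. of_int \<lfloor>y $ j\<rfloor> < y $ j} \<inter> {y. y $ j < of_int \<lfloor>y $ j\<rfloor> + c}" by (auto simp: frac_def)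
    then show "y \<in> (\<Union>m::int. {y. of_int m < y $ j} \<inter> {y. y $ j < of_int m + c})" by blast
  next
    fix y :: "real^'k" assume "y \<in> (\<Union>m::int. {y. of_int m < y $ j} \<inter> {y. y $ j < of_int m + c})"
    then obtain m :: int where m: "of_int m < y $ j" "y $ j < of_int m + c" by blast
    then have "\<lfloor>y $ j\<rfloor> = m" using assms by (intro floor_unique) auto
    then show "y \<in> {y. 0 < frac (y $ j) \<and> frac (y $ j) < c}" using m by (auto simp: frac_def)
  qed
  moreover have "open (\<Union>m::int. {y :: real^'k. of_int m < y $ j} \<inter> {y. y $ j < of_int m + c})"
    by (intro open_UN ballI open_Int open_Collect_less continuous_intros)
  ultimately show ?thesis by simp
qed

lemma baire_torus_action:
  assumes "length xs = d" "2 \<le> d" "free_vecs xs"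
  shows "torus_action (baire_sets torus_top) {S. S \<subseteq> torus \<and> meager_in torus_top S} (xs :: (real^'k) list) d"
proof
  let ?M = "baire_sets (torus_top :: (real^'k) topology)"
  show sp: "space ?M = torus" by simp
  show "length xs = d" "2 \<le> d" "free_vecs xs" by fact+
  have sub: "S \<subseteq> torus" if "S \<in> sets ?M" for S using sets.sets_into_space[OF that] by simp
  show "(\<lambda>x. tadd x v) \<in> measurable ?M ?M" for v
  proof (rule measurableI)
    show "tadd x v \<in> space ?M" for x by (simp add: tadd_torus)
    fix S assume S: "S \<in> sets ?M"
    have "(\<lambda>x. tadd x v) -` S \<inter> space ?M = {x \<in> torus. tadd x v \<in> S}" by auto
    then show "(\<lambda>x. tadd x v) -` S \<inter> space ?M \<in> sets ?M"
      using baire_image[OF tadd_homeomorphic S] by (simp add: tadd_vimage_image[OF sub[OF S]])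
  qed
  show "{x \<in> torus. x $ j < c} \<in> sets ?M" for j c
  proof -
    have pos: "{x \<in> torus. 0 < x $ j \<and> x $ j < c} \<in> sets ?M" if "c \<le> 1" for c
    proof (rule open_baire)
      have "tproj -` {x :: real^'k. x \<in> torus \<and> 0 < x $ j \<and> x $ j < c} = {y. 0 < frac (y $ j) \<and> frac (y $ j) < c}"
        using tproj_torus by auto
      then show "openin torus_top {x :: real^'k. x \<in> torus \<and> 0 < x $ j \<and> x $ j < c}"
        using open_frac_less[OF that] by (auto simp: openin_torus_top)
    qed
    \<comment> \<open>The face of the cube lost by excluding 0 is recovered as the complement of an
      open set.\<close>
    have zero: "{x \<in> torus. x $ j = 0} \<in> sets ?M"
    proof -
      have "{x \<in> torus. x $ j = 0} = torus - {x \<in> torus. 0 < x $ j \<and> x $ j < 1}"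
        by (auto simp: torus_def) (metis less_eq_real_def)
      then show ?thesis using pos[of 1] sets.top[of ?M] by (simp add: sets.Diff)
    qed
    have "{x \<in> torus. x $ j < c} = (if 0 < c then {x \<in> torus. x $ j = 0} \<union> {x \<in> torus. 0 < x $ j \<and> x $ j < min c 1} else {})"
      by (auto simp: torus_def) (metis less_eq_real_def, meson not_less order_trans)
    then show ?thesis using zero pos[of "min c 1"] by auto
  qed
  show "A \<in> sets ?M" if "A \<in> {S. S \<subseteq> torus \<and> meager_in torus_top S}" for A
    using that meager_baire[of torus_top A] by simp
  show "B \<in> {S. S \<subseteq> torus \<and> meager_in torus_top S}" if "A \<in> {S. S \<subseteq> torus \<and> meager_in torus_top S}" "B \<subseteq> A" for A B :: "(real^'k) set"
    using that by (auto intro: meager_subset)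
  show "(\<Union>i. H i) \<in> {S. S \<subseteq> torus \<and> meager_in torus_top S}" if "\<And>i::nat. H i \<in> {S. S \<subseteq> torus \<and> meager_in torus_top S}" for H :: "nat \<Rightarrow> (real^'k) set"
    using that by (auto intro!: meager_UN)
  show "{x \<in> torus. tadd x v \<in> A} \<in> {S. S \<subseteq> torus \<and> meager_in torus_top S}" if A: "A \<in> {S. S \<subseteq> torus \<and> meager_in torus_top S}" for A :: "(real^'k) set" and v
    using A meager_image[OF tadd_homeomorphic, of A "- v"] tadd_vimage_image[of A v] by auto
  fix C :: "nat \<Rightarrow> nat \<Rightarrow> (real^'k) set"
  assume C: "\<And>i w. C i w \<in> sets ?M" "\<And>i. space ?M \<subseteq> (\<Union>w<9. C i w)"
  obtain V :: "nat \<Rightarrow> (real^'k) set" where V: "\<And>i. V i \<subseteq> torus"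
    "\<And>U. openin torus_top U \<Longrightarrow> U = (\<Union>i\<in>{i. V i \<subseteq> U}. V i)"
  proof (rule torus_top_base)
    fix V :: "nat \<Rightarrow> (real^'k) set"
    assume "\<And>i. V i \<subseteq> torus" "\<And>U. openin torus_top U \<Longrightarrow> U = (\<Union>i\<in>{i. V i \<subseteq> U}. V i)"
    then show thesis by (rule that)
  qed
  have "\<exists>g. (\<forall>i. g i < 9) \<and> meager_in torus_top {x \<in> topspace torus_top. \<exists>m. \<forall>i\<ge>m. x \<notin> C i (g i)}"
  proof (rule baire_limsup_cover[of C torus_top V])
    show "C i w \<in> sets ?M" "topspace torus_top \<subseteq> (\<Union>w<9. C i w)" "V i \<subseteq> topspace torus_top" for i w
      using C V(1) by auto
  qed (rule V(2))
  then show "\<exists>g. (\<forall>i. g i < 9) \<and> {x \<in> space ?M. \<exists>m. \<forall>i\<ge>m. x \<notin> C i (g i)} \<in> {S. S \<subseteq> torus \<and> meager_in torus_top S}"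
    by auto
qed

lemma equidecomposable_mono:
  assumes "equidecomposable P xs A B" "\<And>S. P S \<Longrightarrow> Q S" shows "equidecomposable Q xs A B"
proof -
  obtain m :: nat and AA BB v where
    "A = (\<Union>i<m. AA i) \<and> B = (\<Union>i<m. BB i) \<and>
       (\<forall>i<m. \<forall>j<m. i \<noteq> j \<longrightarrow> AA i \<inter> AA j = {} \<and> BB i \<inter> BB j = {}) \<and>
       (\<forall>i<m. P (AA i) \<and> P (BB i)) \<and> (\<forall>i<m. \<exists>n. v i = tcomb xs n) \<and>
       (\<forall>i<m. BB i = (\<lambda>a. tadd a (v i)) ` AA i)"
    using assms(1) unfolding equidecomposable_def by (elim exE)
  then show ?thesis
    unfolding equidecomposable_def using assms(2)
    by (rule_tac exI[of _ m], rule_tac exI[of _ AA], rule_tac exI[of _ BB], rule_tac exI[of _ v]) simp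
qed

theorem theorem2p2:
  fixes xs :: "(real^'k) list" and \<delta> :: real and Psi Phi :: "nat \<Rightarrow> real" and d :: nat
  assumes "length xs = d" and "d \<ge> 2" and "\<delta> > 0"
    and "set xs \<subseteq> torus" and "free_vecs xs"
    and "summable (\<lambda>i. Psi i / 2 ^ ((d - 2) * i))"
    and "\<And>i. Phi i = 2 ^ i * Psi i"
  shows
    "(\<forall>A B. A \<subseteq> torus \<and> B \<subseteq> torus \<and> A \<in> sets lebesgue \<and> B \<in> sets lebesgue \<and>
        (\<forall>ys. length ys = d - 1 \<and> distinct ys \<and> set ys \<subseteq> set xs \<longrightarrow>
           uniform_T Psi \<delta> ys A \<and> uniform_T Psi \<delta> ys B)
      \<longrightarrow> equidecomposable (\<lambda>S. S \<in> sets lebesgue) xs A B)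
   \<and> (\<forall>A B. A \<subseteq> torus \<and> B \<subseteq> torus \<and>
        baire_measurable_in torus_top A \<and> baire_measurable_in torus_top B \<and>
        uniform_T Phi \<delta> xs A \<and> uniform_T Phi \<delta> xs B
      \<longrightarrow> equidecomposable (baire_measurable_in torus_top) xs A B)"
proof -
  have "Phi i / 2 ^ ((d - 1) * i) = Psi i / 2 ^ ((d - 2) * i)" for i
  proof -
    \<comment> \<open>This identity, for truncated subtraction, turns the summability hypothesis on
      \<open>Psi\<close> into the one for \<open>Phi\<close> with exponent \<open>d - 1\<close> that
      both parts use.\<close>
    have "(d - 1) * i = i + (d - 2) * i" using assms(2) by (cases d; cases "d - 1") auto
    then show ?thesis by (simp add: assms(7) power_add)
  qed
  then have sP: "summable (\<lambda>i. Phi i / 2 ^ ((d - 1) * i))" using assms(6) by simp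
  have Phi: "Phi = (\<lambda>i. 2 ^ i * Psi i)" using assms(7) by auto
  show ?thesis
  proof (intro conjI allI impI; elim conjE)
    fix A B :: "(real^'k) set"
    assume AB: "A \<subseteq> torus" "B \<subseteq> torus" "A \<in> sets lebesgue" "B \<in> sets lebesgue"
      and u: "\<forall>ys. length ys = d - 1 \<and> distinct ys \<and> set ys \<subseteq> set xs \<longrightarrow>
           uniform_T Psi \<delta> ys A \<and> uniform_T Psi \<delta> ys B"
    interpret torus_action "restrict_space lebesgue torus" "{S. S \<subseteq> torus \<and> negligible S}" xs d
      by (rule lebesgue_torus_action[OF assms(1,2,5)])
    have "length (take (d - 1) xs) = d - 1" "distinct (take (d - 1) xs)" "set (take (d - 1) xs) \<subseteq> set xs"
      using free_vecs_distinct[OF assms(5)] assms(1) by (auto simp: set_take_subset)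
    then have "uniform_T Psi \<delta> (take (d - 1) xs) A" "uniform_T Psi \<delta> (take (d - 1) xs) B" using u by blast+
    moreover have "length xs = Suc (d - 1)" using assms(1,2) by simp
    ultimately have "uniform_T Phi \<delta> xs A" "uniform_T Phi \<delta> xs B"
      unfolding Phi by (auto intro: uniform_T_slices)
    moreover have sets: "S \<in> sets (restrict_space lebesgue torus) \<longleftrightarrow> S \<subseteq> torus \<and> S \<in> sets lebesgue" for S :: "(real^'k) set"
      using torus_lebesgue by (intro sets_restrict_space_iff) simp
    ultimately have "equidecomposable (\<lambda>S. S \<in> sets (restrict_space lebesgue torus)) xs A B"
      using AB by (intro equidecomposition[OF _ _ assms(3) _ _ sP]) auto
    then show "equidecomposable (\<lambda>S. S \<in> sets lebesgue) xs A B"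
      by (rule equidecomposable_mono) (simp add: sets)
  next
    fix A B :: "(real^'k) set"
    assume AB: "baire_measurable_in torus_top A" "baire_measurable_in torus_top B"
      "uniform_T Phi \<delta> xs A" "uniform_T Phi \<delta> xs B"
    interpret torus_action "baire_sets torus_top" "{S. S \<subseteq> torus \<and> meager_in torus_top S}" xs d
      by (rule baire_torus_action[OF assms(1,2,5)])
    show "equidecomposable (baire_measurable_in torus_top) xs A B"
      using equidecomposition[OF _ _ assms(3) AB(3,4) sP] AB(1,2) by (simp add: sets_baire_sets)
  qed
qed

end
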